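(* Let $f:\mathbb{R}^2\to\mathbb{R}$ satisfy (f1)–(f7), assume that $x'=f(t,x)$ has an attractor-repeller pair $(\tilde a,\tilde r)$, and let $\Gamma:\mathbb{R}\to\mathbb{R}$ be bounded and continuous with finite limits $\gamma_\pm=\lim_{t\to\pm\infty}\Gamma(t)$. Fix $h>0$. Assume the existence of $j_0\in\mathbb{Z}$, $n\in\mathbb{N}$ and $\nu_{j_0},\nu_{j_0+1},\ldots,\nu_{j_0+n}$ in $[0,1]$ such that $\mathfrak{a}_h(j_0h)-\Gamma(j_0h)\ge b^{\nu_{j_0}}(j_0h)$, $\mathfrak{r}_h((j_0+n)h)-\Gamma((j_0+n)h)<b^{\nu_{j_0+n}}((j_0+n)h)$ (in particular, $\mathfrak{a}_h$ and $\mathfrak{r}_h$ are defined at these points), and $$x((j+1)h,jh,b^{\nu_j}(jh))-b^{\nu_{j+1}}((j+1)h)\ge\Gamma((j+1)h)-\Gamma(jh)$$ for $j\in\{j_0,\ldots,j_0+n-1\}$. Then the equation $x'=f(t,x-\Gamma^h(t))$ has an attractor-repeller pair.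
   Context: Conditions on a function $f:\mathbb{R}^2\to\mathbb{R}$ ("a.e. $t$" refers to Lebesgue measure on $\mathbb{R}$): (f1) $f$ is Borel measurable; (f2) for all $j\in\mathbb{N}$ there exists $m_j\in\mathbb{R}$ such that $\sup_{x\in[-j,j]}|f(t,x)|\le m_j$ for a.e. $t$; (f3) for all $j\in\mathbb{N}$ there exists $l_j\in\mathbb{R}$ such that $\sup_{x_1,x_2\in[-j,j],\,x_1\ne x_2}|f(t,x_2)-f(t,x_1)|/|x_2-x_1|\le l_j$ for a.e. $t$; (f4) for a.e. $t$, the map $x\mapsto f(t,x)$ is $C^1$; (f5) $f_x=\partial f/\partial x$ satisfies condition (f3); (f6) there exist a subset $\mathcal{R}\subseteq\mathbb{R}$ with full Lebesgue measure and $\delta>0$ such that $\limsup_{x\to\pm\infty}f(t,x)/x^2<-\delta$ uniformly on $t\in\mathcal{R}$; (f7) for all $j\in\mathbb{N}$ there exists $\delta_j>0$ such that $\sup_{x_1,x_2\in[-j,j],\,x_1\ne x_2}(f_x(t,x_2)-f_x(t,x_1))/(x_2-x_1)<-\delta_j$ for a.e. $t$. Solutions are Carathéodory solutions (absolutely continuous on compact intervals, satisfying the equation for a.e. $t$). $x(t,s,x_0)$ denotes the maximal solution of the unperturbed equation $x'=f(t,x)$ with value $x_0$ at $t=s$. $\Gamma^h$ is the piecewise constant function $\Gamma^h(t):=\Gamma(jh)$ for $t\in[jh,(j+1)h)$, $j\in\mathbb{Z}$. $b^\nu:=\nu\,\tilde a+(1-\nu)\,\tilde r$ for $\nu\in[0,1]$.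 Attractor-repeller pair. For an equation $x'=g(t,x)$ with $g$ satisfying (f1)–(f7) and having bounded solutions on $\mathbb{R}$, there are a maximal one $a$ and a minimal one $r$ (a solution is globally defined and bounded iff it lies between $r$ and $a$). The equation has an attractor-repeller pair $(a,r)$ if $a$ and $r$ are hyperbolic, $a$ attractive and $r$ repulsive: there exist $k\ge1,\beta>0$ with $\exp\int_s^t g_x(l,a(l))\,dl\le k e^{-\beta(t-s)}$ for $t\ge s$ and $\exp\int_s^t g_x(l,r(l))\,dl\le k e^{\beta(t-s)}$ for $t\le s$. This is equivalent to $\inf_{t\in\mathbb{R}}(a(t)-r(t))>0$. Special solutions. $\mathfrak{a}_h$ is the maximal solution of $x'=f(t,x-\Gamma^h(t))$, defined on $\mathbb{R}$ or on an open half-line unbounded below, such that for each $s$ in its domain the solution with value $x_0$ at $s$ remains bounded as $t\to-\infty$ iff $x_0\le\mathfrak{a}_h(s)$, and which tends to $-\infty$ at the right end of its domain if this is finite. $\mathfrak{r}_h$ is the maximal solution, defined on $\mathbb{R}$ or on an open half-line unbounded above, such that for each $s$ in its domain the solution with value $x_0$ at $s$ remains bounded as $t\to+\infty$ iff $x_0\ge\mathfrak{r}_h(s)$, and which tends to $+\infty$ at the left end of its domain if this is finite. Both exist under the present hypotheses. *)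

theory Defs
  imports "HOL-Analysis.Analysis"
begin

section \<open>Conditions on the right-hand side\<close>

text \<open>Suprema and upper limits are taken in the extended reals, so that they always exist.
  In particular the supremum over an empty set (the case \<open>j = 0\<close> below) is \<open>-\<infinity>\<close>.\<close>

definition partial_x :: "(real \<Rightarrow> real \<Rightarrow> real) \<Rightarrow> real \<Rightarrow> real \<Rightarrow> real" where
  "partial_x f t x = deriv (f t) x"

definition cond_f1 :: "(real \<Rightarrow> real \<Rightarrow> real) \<Rightarrow> bool" where
  "cond_f1 f \<longleftrightarrow> (\<lambda>(t, x). f t x) \<in> borel_measurable (borel :: (real \<times> real) measure)"

definition cond_f2 :: "(real \<Rightarrow> real \<Rightarrow> real) \<Rightarrow> bool" where
  "cond_f2 f \<longleftrightarrow> (\<forall>j::nat. \<exists>m::real. AE t in lebesgue.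
     (SUP x\<in>{- real j..real j}. ereal \<bar>f t x\<bar>) \<le> ereal m)"

definition cond_f3 :: "(real \<Rightarrow> real \<Rightarrow> real) \<Rightarrow> bool" where
  "cond_f3 f \<longleftrightarrow> (\<forall>j::nat. \<exists>l::real. AE t in lebesgue.
     (SUP (x1, x2)\<in>{(x1, x2). x1 \<in> {- real j..real j} \<and> x2 \<in> {- real j..real j} \<and> x1 \<noteq> x2}.
        ereal (\<bar>f t x2 - f t x1\<bar> / \<bar>x2 - x1\<bar>)) \<le> ereal l)"

definition cond_f4 :: "(real \<Rightarrow> real \<Rightarrow> real) \<Rightarrow> bool" where
  "cond_f4 f \<longleftrightarrow> (AE t in lebesgue. f t C1_differentiable_on UNIV)"

definition cond_f5 :: "(real \<Rightarrow> real \<Rightarrow> real) \<Rightarrow> bool" where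
  "cond_f5 f \<longleftrightarrow> cond_f3 (partial_x f)"

text \<open>Uniformity in \<open>t \<in> R\<close> of the upper limit is expressed by taking the supremum over \<open>R\<close>
  inside the upper limit.\<close>

definition cond_f6 :: "(real \<Rightarrow> real \<Rightarrow> real) \<Rightarrow> bool" where
  "cond_f6 f \<longleftrightarrow> (\<exists>R::real set. \<exists>\<delta>::real. negligible (- R) \<and> \<delta> > 0 \<and>
     Limsup at_top (\<lambda>x. SUP t\<in>R. ereal (f t x / x\<^sup>2)) < ereal (- \<delta>) \<and>
     Limsup at_bot (\<lambda>x. SUP t\<in>R. ereal (f t x / x\<^sup>2)) < ereal (- \<delta>))"

definition cond_f7 :: "(real \<Rightarrow> real \<Rightarrow> real) \<Rightarrow> bool" where
  "cond_f7 f \<longleftrightarrow> (\<forall>j::nat. \<exists>\<delta>::real. \<delta> > 0 \<and> (AE t in lebesgue.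
     (SUP (x1, x2)\<in>{(x1, x2). x1 \<in> {- real j..real j} \<and> x2 \<in> {- real j..real j} \<and> x1 \<noteq> x2}.
        ereal ((partial_x f t x2 - partial_x f t x1) / (x2 - x1))) < ereal (- \<delta>)))"

definition cond_f1_f7 :: "(real \<Rightarrow> real \<Rightarrow> real) \<Rightarrow> bool" where
  "cond_f1_f7 f \<longleftrightarrow> cond_f1 f \<and> cond_f2 f \<and> cond_f3 f \<and> cond_f4 f \<and> cond_f5 f \<and> cond_f6 f \<and> cond_f7 f"

section \<open>Caratheodory solutions\<close>

text \<open>The usual \<open>\<epsilon>\<close>-\<open>\<delta>\<close> definition. A finite family of non-overlapping compact intervals
  contained in \<open>S\<close> is a set \<open>\<D>\<close> with \<open>\<D> division_of \<Union>\<D>\<close> and \<open>\<Union>\<D> \<subseteq> S\<close>; the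
  endpoints of a member \<open>K\<close> are \<open>Inf K\<close> and \<open>Sup K\<close>.\<close>

definition abs_continuous_on :: "real set \<Rightarrow> (real \<Rightarrow> real) \<Rightarrow> bool" where
  "abs_continuous_on S x \<longleftrightarrow> (\<forall>\<epsilon>>0. \<exists>\<delta>>0. \<forall>\<D>.
     \<D> division_of \<Union>\<D> \<and> \<Union>\<D> \<subseteq> S \<and> (\<Sum>K\<in>\<D>. Sup K - Inf K) < \<delta> \<longrightarrow>
     (\<Sum>K\<in>\<D>. \<bar>x (Sup K) - x (Inf K)\<bar>) < \<epsilon>)"

text \<open>\<open>solution g I x\<close>: the restriction of \<open>x\<close> to the interval \<open>I\<close> solves \<open>x' = g(t,x)\<close>.
  The values of \<open>x\<close> off \<open>I\<close> are irrelevant (the at most two endpoints of \<open>I\<close> form a null set).\<close>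

definition solution :: "(real \<Rightarrow> real \<Rightarrow> real) \<Rightarrow> real set \<Rightarrow> (real \<Rightarrow> real) \<Rightarrow> bool" where
  "solution g I x \<longleftrightarrow> is_interval I \<and>
     (\<forall>a b. {a..b} \<subseteq> I \<longrightarrow> abs_continuous_on {a..b} x) \<and>
     (AE t in lebesgue. t \<in> I \<longrightarrow> (x has_real_derivative g t (x t)) (at t))"

definition maximal_solution :: "(real \<Rightarrow> real \<Rightarrow> real) \<Rightarrow> real set \<Rightarrow> (real \<Rightarrow> real) \<Rightarrow> bool" where
  "maximal_solution g I x \<longleftrightarrow> I \<noteq> {} \<and> solution g I x \<and>
     (\<forall>J y. solution g J y \<and> I \<subseteq> J \<and> (\<forall>t\<in>I. y t = x t) \<longrightarrow> J = I)"

text \<open>\<open>sol_value g t s x0\<close> is \<open>x(t,s,x\<^sub>0)\<close>, the value at \<open>t\<close> of the maximal solution with value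
  \<open>x0\<close> at \<open>s\<close>; it is meaningful only for \<open>t\<close> in the domain of that solution.\<close>

definition sol_value :: "(real \<Rightarrow> real \<Rightarrow> real) \<Rightarrow> real \<Rightarrow> real \<Rightarrow> real \<Rightarrow> real" where
  "sol_value g t s x0 =
     (THE v. \<exists>I x. maximal_solution g I x \<and> s \<in> I \<and> x s = x0 \<and> t \<in> I \<and> x t = v)"

section \<open>Attractor-repeller pairs\<close>

definition bounded_solution :: "(real \<Rightarrow> real \<Rightarrow> real) \<Rightarrow> (real \<Rightarrow> real) \<Rightarrow> bool" where
  "bounded_solution g x \<longleftrightarrow> solution g UNIV x \<and> bounded (range x)"

text \<open>The integrals are oriented: for \<open>t < s\<close> the integral from \<open>s\<close> to \<open>t\<close> is minus the
  integral from \<open>t\<close> to \<open>s\<close>. They are taken with respect to the completed measure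
  \<open>lebesgue\<close> because \<open>partial_x g l (a l)\<close> is unconstrained for \<open>l\<close> in a null set, which may
  destroy Borel measurability.\<close>

definition attractor_repeller_pair ::
    "(real \<Rightarrow> real \<Rightarrow> real) \<Rightarrow> (real \<Rightarrow> real) \<Rightarrow> (real \<Rightarrow> real) \<Rightarrow> bool" where
  "attractor_repeller_pair g a r \<longleftrightarrow>
     bounded_solution g a \<and> bounded_solution g r \<and>
     (\<forall>x. bounded_solution g x \<longrightarrow> (\<forall>t. r t \<le> x t \<and> x t \<le> a t)) \<and>
     (\<exists>k \<beta>. k \<ge> 1 \<and> \<beta> > 0 \<and>
       (\<forall>s t. t \<ge> s \<longrightarrow>
          exp (LINT l=ereal s..ereal t|lebesgue. partial_x g l (a l)) \<le> k * exp (- \<beta> * (t - s))) \<and>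
       (\<forall>s t. t \<le> s \<longrightarrow>
          exp (LINT l=ereal s..ereal t|lebesgue. partial_x g l (r l)) \<le> k * exp (\<beta> * (t - s))))"

section \<open>The special solutions of the perturbed equation\<close>

text \<open>A maximal solution \<open>x\<close> on \<open>I\<close> remains bounded as \<open>t \<rightarrow> -\<infinity>\<close> if \<open>I\<close> is unbounded below
  and \<open>x\<close> is bounded near \<open>-\<infinity>\<close>.\<close>

definition upper_special_solution ::
    "(real \<Rightarrow> real \<Rightarrow> real) \<Rightarrow> real set \<Rightarrow> (real \<Rightarrow> real) \<Rightarrow> bool" where
  "upper_special_solution g D a \<longleftrightarrow> maximal_solution g D a \<and>
     (D = UNIV \<or> (\<exists>c. D = {..<c} \<and> filterlim a at_bot (at_left c))) \<and>
     (\<forall>s\<in>D. \<forall>I x. maximal_solution g I x \<and> s \<in> I \<longrightarrow>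
        (eventually (\<lambda>t. t \<in> I) at_bot \<and> Bfun x at_bot \<longleftrightarrow> x s \<le> a s))"

definition lower_special_solution ::
    "(real \<Rightarrow> real \<Rightarrow> real) \<Rightarrow> real set \<Rightarrow> (real \<Rightarrow> real) \<Rightarrow> bool" where
  "lower_special_solution g D r \<longleftrightarrow> maximal_solution g D r \<and>
     (D = UNIV \<or> (\<exists>c. D = {c<..} \<and> filterlim r at_top (at_right c))) \<and>
     (\<forall>s\<in>D. \<forall>I x. maximal_solution g I x \<and> s \<in> I \<longrightarrow>
        (eventually (\<lambda>t. t \<in> I) at_top \<and> Bfun x at_top \<longleftrightarrow> x s \<ge> r s))"

text \<open>\<open>\<lfloor>t / h\<rfloor>\<close> is the integer \<open>j\<close> with \<open>t \<in> [jh, (j+1)h)\<close> (for \<open>h > 0\<close>).\<close>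

definition step_fun :: "real \<Rightarrow> (real \<Rightarrow> real) \<Rightarrow> real \<Rightarrow> real" where
  "step_fun h \<Gamma> t = \<Gamma> (of_int \<lfloor>t / h\<rfloor> * h)"

definition perturbed :: "(real \<Rightarrow> real \<Rightarrow> real) \<Rightarrow> real \<Rightarrow> (real \<Rightarrow> real) \<Rightarrow> real \<Rightarrow> real \<Rightarrow> real" where
  "perturbed f h \<Gamma> t x = f t (x - step_fun h \<Gamma> t)"

definition conv_comb :: "(real \<Rightarrow> real) \<Rightarrow> (real \<Rightarrow> real) \<Rightarrow> real \<Rightarrow> real \<Rightarrow> real" where
  "conv_comb a r \<nu> t = \<nu> * a t + (1 - \<nu>) * r t"

end

theory Submission
  imports Defs
begin

text \<open>On \<open>[jh, (j+1)h)\<close> a solution of the perturbed equation is a translate of a solution of the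
  unperturbed one. By induction on the steps the hypotheses give
  \<open>a\<^sub>h(t) - \<Gamma>(t) \<ge> b(t)\<close> at each \<open>t = jh\<close>, hence \<open>a\<^sub>h > r\<^sub>h\<close> at the last one. Then both
  special solutions are globally defined and bounded, and they bound every bounded solution.

  Strong concavity turns \<open>inf (a - r) > 0\<close> into hyperbolicity, so this is what remains to be shown.
  The midpoint of the unperturbed pair, shifted by \<open>\<gamma>\<^sub>\<plusminus>\<close>, is a strict lower solution \<open>c\<close>
  of the perturbed equation near \<open>\<plusminus>\<infinity>\<close>, because \<open>\<Gamma>\<^sup>h\<close> converges there. Near
  \<open>-\<infinity>\<close> the solution \<open>a\<close> stays above \<open>c\<close> by a fixed amount, and \<open>r\<close> cannot stay above \<open>c\<close>,
  since above \<open>c\<close> the distance of two solutions grows exponentially backwards in time. The case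
  \<open>+\<infinity>\<close> follows by the reflection \<open>(t, x) \<mapsto> (-t, -x)\<close>.\<close>

section \<open>Absolutely continuous functions\<close>

text \<open>Hyperbolicity speaks of integrals of \<open>partial_x\<close> along \<open>a\<close> and
  \<open>r\<close>, which are known only through order and boundedness. The link is
  \<open>ln (a - r)\<close>: strong concavity separates \<open>partial_x\<close> at \<open>a\<close>
  and at \<open>r\<close> from the derivative of this logarithm, in opposite directions, by a
  multiple of \<open>a - r\<close>. A uniform gap thus gives exponential rates, and boundedness
  turns the increments of the logarithm into the constant \<open>k\<close>. On compact time
  intervals the gap is free by continuity; only the two ends of the line can fail. For them the
  unperturbed pair must first be shown to have a uniform gap, because the margin by which its
  midpoint is a strict lower solution is quadratic in that gap. The bounds hold only for almost
  every t, so comparisons are integrated inequalities between absolutely continuous functions and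
  rest on the fundamental theorem for these. Existence rests on the converse, Lebesgue's
  differentiation theorem: solutions are defined by an almost everywhere derivative, while Picard
  iteration produces an integral.\<close>

lemma division_of_reals_member:
  fixes S :: "real set"
  assumes "\<D> division_of S" and "K \<in> \<D>"
  shows "Inf K \<le> Sup K" "Inf K \<in> S" "Sup K \<in> S"
proof -
  obtain a b where K: "K = cbox a b" using division_ofD(4)[OF assms] by blast
  moreover have "K \<noteq> {}" using division_ofD(3)[OF assms] .
  ultimately have ab: "K = {a..b}" "a \<le> b" by auto
  moreover have "K \<subseteq> S" using division_ofD(2)[OF assms] .
  ultimately show "Inf K \<le> Sup K" "Inf K \<in> S" "Sup K \<in> S" by auto
qed

lemma abs_continuous_onE:
  assumes "abs_continuous_on S x" and "\<epsilon> > 0"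
  obtains \<delta> where "\<delta> > 0"
    "\<And>\<D>. \<D> division_of \<Union>\<D> \<Longrightarrow> \<Union>\<D> \<subseteq> S \<Longrightarrow> (\<Sum>K\<in>\<D>. Sup K - Inf K) < \<delta> \<Longrightarrow>
       (\<Sum>K\<in>\<D>. \<bar>x (Sup K) - x (Inf K)\<bar>) < \<epsilon>"
proof -
  have "\<exists>\<delta>>0. \<forall>\<D>. \<D> division_of \<Union>\<D> \<and> \<Union>\<D> \<subseteq> S \<and> (\<Sum>K\<in>\<D>. Sup K - Inf K) < \<delta> \<longrightarrow>
     (\<Sum>K\<in>\<D>. \<bar>x (Sup K) - x (Inf K)\<bar>) < \<epsilon>"
    using assms unfolding abs_continuous_on_def by simp
  then show thesis using that by auto
qed

text \<open>Common source of the closure properties: the increments of sums, differences, multiples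
  and, locally, logarithms are dominated by those of the given functions.\<close>

lemma abs_continuous_on_dominated2:
  assumes x: "abs_continuous_on S x" and y: "abs_continuous_on S y"
    and C: "\<And>u v. u \<in> S \<Longrightarrow> v \<in> S \<Longrightarrow> u \<le> v \<Longrightarrow> \<bar>z v - z u\<bar> \<le> C * (\<bar>x v - x u\<bar> + \<bar>y v - y u\<bar>)"
  shows "abs_continuous_on S z"
  unfolding abs_continuous_on_def
proof (intro allI impI)
  fix e :: real assume e: "e > 0"
  define C' where "C' = \<bar>C\<bar> + 1"
  have C': "C' > 0" "C \<le> C'" by (auto simp: C'_def)
  have e': "e / (2 * C') > 0" using e C' by simp
  obtain d1 where d1: "d1 > 0" "\<And>\<D>. \<D> division_of \<Union>\<D> \<Longrightarrow> \<Union>\<D> \<subseteq> S \<Longrightarrow> (\<Sum>K\<in>\<D>. Sup K - Inf K) < d1 \<Longrightarrow>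
     (\<Sum>K\<in>\<D>. \<bar>x (Sup K) - x (Inf K)\<bar>) < e / (2 * C')"
    by (rule abs_continuous_onE[OF x e'], rule that)
  obtain d2 where d2: "d2 > 0" "\<And>\<D>. \<D> division_of \<Union>\<D> \<Longrightarrow> \<Union>\<D> \<subseteq> S \<Longrightarrow> (\<Sum>K\<in>\<D>. Sup K - Inf K) < d2 \<Longrightarrow>
     (\<Sum>K\<in>\<D>. \<bar>y (Sup K) - y (Inf K)\<bar>) < e / (2 * C')"
    by (rule abs_continuous_onE[OF y e'], rule that)
  have "(\<Sum>K\<in>\<D>. \<bar>z (Sup K) - z (Inf K)\<bar>) < e"
    if D: "\<D> division_of \<Union>\<D> \<and> \<Union>\<D> \<subseteq> S \<and> (\<Sum>K\<in>\<D>. Sup K - Inf K) < min d1 d2" for \<D>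
  proof -
    have "(\<Sum>K\<in>\<D>. \<bar>z (Sup K) - z (Inf K)\<bar>)
      \<le> (\<Sum>K\<in>\<D>. C' * (\<bar>x (Sup K) - x (Inf K)\<bar> + \<bar>y (Sup K) - y (Inf K)\<bar>))"
    proof (rule sum_mono)
      fix K assume K: "K \<in> \<D>"
      define a b where ab_def: "a = Inf K" "b = Sup K"
      have ab: "a \<le> b" "a \<in> \<Union>\<D>" "b \<in> \<Union>\<D>"
        using division_of_reals_member[of \<D> "\<Union>\<D>" K] D K by (simp_all add: ab_def)
      have "\<bar>z b - z a\<bar> \<le> C * (\<bar>x b - x a\<bar> + \<bar>y b - y a\<bar>)"
        using ab D by (intro C) auto
      also have "\<dots> \<le> C' * (\<bar>x b - x a\<bar> + \<bar>y b - y a\<bar>)"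
        using C' by (intro mult_right_mono) auto
      finally show "\<bar>z (Sup K) - z (Inf K)\<bar> \<le> C' * (\<bar>x (Sup K) - x (Inf K)\<bar> + \<bar>y (Sup K) - y (Inf K)\<bar>)"
        by (simp add: ab_def)
    qed
    also have "\<dots> = C' * ((\<Sum>K\<in>\<D>. \<bar>x (Sup K) - x (Inf K)\<bar>) + (\<Sum>K\<in>\<D>. \<bar>y (Sup K) - y (Inf K)\<bar>))"
      by (simp add: sum.distrib[symmetric] sum_distrib_left)
    also have "\<dots> < C' * (e / (2 * C') + e / (2 * C'))"
      using d1(2)[of \<D>] d2(2)[of \<D>] D C' by (intro mult_strict_left_mono add_strict_mono) auto
    also have "\<dots> = e" using C' by (simp add: field_simps)
    finally show ?thesis .
  qed
  moreover have "min d1 d2 > 0" using d1 d2 by simp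
  ultimately show "\<exists>\<delta>>0. \<forall>\<D>. \<D> division_of \<Union> \<D> \<and> \<Union> \<D> \<subseteq> S \<and> (\<Sum>K\<in>\<D>. Sup K - Inf K) < \<delta> \<longrightarrow>
            (\<Sum>K\<in>\<D>. \<bar>z (Sup K) - z (Inf K)\<bar>) < e"
    by blast
qed

lemma abs_continuous_on_dominated:
  assumes x: "abs_continuous_on S x"
    and C: "\<And>u v. u \<in> S \<Longrightarrow> v \<in> S \<Longrightarrow> u \<le> v \<Longrightarrow> \<bar>z v - z u\<bar> \<le> C * \<bar>x v - x u\<bar>"
  shows "abs_continuous_on S z"
proof (rule abs_continuous_on_dominated2[OF x x, of _ "\<bar>C\<bar>"])
  fix u v assume uv: "u \<in> S" "v \<in> S" "u \<le> v"
  have "C * \<bar>x v - x u\<bar> \<le> \<bar>C\<bar> * (\<bar>x v - x u\<bar> + \<bar>x v - x u\<bar>)"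
    by (intro mult_mono) auto
  then show "\<bar>z v - z u\<bar> \<le> \<bar>C\<bar> * (\<bar>x v - x u\<bar> + \<bar>x v - x u\<bar>)"
    using C[OF uv] by linarith
qed

lemma abs_continuous_on_ident: "abs_continuous_on S (\<lambda>t. t)"
  unfolding abs_continuous_on_def
proof (intro allI impI exI conjI)
  fix e :: real and \<D> :: "real set set" assume e: "e > 0"
    and D: "\<D> division_of \<Union>\<D> \<and> \<Union>\<D> \<subseteq> S \<and> (\<Sum>K\<in>\<D>. Sup K - Inf K) < e"
  have "(\<Sum>K\<in>\<D>. \<bar>Sup K - Inf K\<bar>) = (\<Sum>K\<in>\<D>. Sup K - Inf K)"
  proof (rule sum.cong)
    fix K assume "K \<in> \<D>"
    with D division_of_reals_member(1)[of \<D> "\<Union>\<D>" K]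
    show "\<bar>Sup K - Inf K\<bar> = Sup K - Inf K" by simp
  qed simp
  then show "(\<Sum>K\<in>\<D>. \<bar>Sup K - Inf K\<bar>) < e" using D by simp
qed

lemma lipschitz_imp_abs_continuous_on:
  assumes "\<And>u v. u \<in> S \<Longrightarrow> v \<in> S \<Longrightarrow> u \<le> v \<Longrightarrow> \<bar>z v - z u\<bar> \<le> C * (v - u)"
  shows "abs_continuous_on S z"
  by (rule abs_continuous_on_dominated[OF abs_continuous_on_ident, of _ _ C]) (use assms in auto)

lemma abs_continuous_on_imp_continuous_on:
  assumes "abs_continuous_on {a..b} x"
  shows "continuous_on {a..b} x"
  unfolding continuous_on_iff
proof (intro ballI allI impI)
  fix t e :: real assume t: "t \<in> {a..b}" and "e > 0"
  obtain d where d: "d > 0" "\<And>\<D>. \<D> division_of \<Union>\<D> \<Longrightarrow> \<Union>\<D> \<subseteq> {a..b} \<Longrightarrow> (\<Sum>K\<in>\<D>. Sup K - Inf K) < d \<Longrightarrow>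
     (\<Sum>K\<in>\<D>. \<bar>x (Sup K) - x (Inf K)\<bar>) < e"
    by (rule abs_continuous_onE[OF assms \<open>e > 0\<close>], rule that)
  have *: "\<bar>x v - x u\<bar> < e" if "a \<le> u" "u \<le> v" "v \<le> b" "v - u < d" for u v
    using d(2)[of "{{u..v}}"] that division_of_self[of u v] by (simp add: cbox_interval)
  have "dist (x s) (x t) < e" if "s \<in> {a..b}" "dist s t < d" for s
    using *[of s t] *[of t s] that t by (cases "s \<le> t") (auto simp: dist_real_def abs_minus_commute)
  then show "\<exists>d>0. \<forall>x'\<in>{a..b}. dist x' t < d \<longrightarrow> dist (x x') (x t) < e"
    using d(1) by blast
qed

text \<open>The fundamental theorem in gauge form. Intervals tagged in the null set are forced into
  a thin open set, where absolute continuity makes the increments of \<open>x\<close> small in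
  total. At the other tags differentiability compares each increment with the derivative times the
  length.\<close>

theorem abs_continuous_on_has_integral:
  assumes "a \<le> b" and ac: "abs_continuous_on {a..b} x" and "negligible N"
    and der: "\<And>t. t \<in> {a<..<b} - N \<Longrightarrow> (x has_real_derivative p t) (at t)"
  shows "(p has_integral (x b - x a)) {a..b}"
proof -
  \<comment> \<open>The endpoints join the exceptional set because \<open>der\<close> speaks of the
    open interval only.\<close>
  define N' where "N' = N \<union> {a, b}"
  have N': "negligible N'" using \<open>negligible N\<close> by (simp add: N'_def)
  define q where "q t = (if t \<in> N' then 0 else p t)" for t
  have "(q has_integral (x b - x a)) (cbox a b)"
    unfolding has_integral
  proof (intro allI impI)
    fix e :: real assume e: "e > 0"
    then have "e / 2 > 0" by simp
    obtain d where d: "d > 0" "\<And>\<D>. \<D> division_of \<Union>\<D> \<Longrightarrow> \<Union>\<D> \<subseteq> {a..b} \<Longrightarrow> (\<Sum>K\<in>\<D>. Sup K - Inf K) < d \<Longrightarrow>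
     (\<Sum>K\<in>\<D>. \<bar>x (Sup K) - x (Inf K)\<bar>) < e / 2"
    by (rule abs_continuous_onE[OF ac \<open>e / 2 > 0\<close>], rule that)
    obtain U where U: "open U" "N' \<subseteq> U" "emeasure lebesgue (U - N') < ennreal d"
        by (rule sets_lebesgue_outer_open[OF negligible_imp_sets[OF N'] d(1)], rule that)
    \<comment> \<open>Chosen so that \<open>c * (b - a) < e / 2\<close>; the added 1 keeps the
      denominator positive when \<open>a = b\<close>.\<close>
    define c where "c = e / (2 * (b - a + 1))"
    have c: "c > 0" using e \<open>a \<le> b\<close> by (simp add: c_def)
    have "\<exists>r>0. \<forall>s. \<bar>s - t\<bar> < r \<longrightarrow> \<bar>x s - x t - p t * (s - t)\<bar> \<le> c * \<bar>s - t\<bar>"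
      if "t \<in> {a..b} - N'" for t
    proof -
      have "(x has_derivative (\<lambda>h. p t * h)) (at t)"
        using der[of t] that by (auto simp: N'_def has_field_derivative_def)
      then show ?thesis
        unfolding has_derivative_at_alt using c by (metis (no_types) real_norm_def)
    qed
    then obtain r where r: "\<And>t. t \<in> {a..b} - N' \<Longrightarrow> r t > 0"
      "\<And>t s. t \<in> {a..b} - N' \<Longrightarrow> \<bar>s - t\<bar> < r t \<Longrightarrow> \<bar>x s - x t - p t * (s - t)\<bar> \<le> c * \<bar>s - t\<bar>"
      by metis
    define \<gamma> where "\<gamma> t = (if t \<in> N' then U else if t \<in> {a..b} then ball t (r t) else UNIV)" for t
    have g: "gauge \<gamma>"
      unfolding gauge_def \<gamma>_def using U r(1) by auto
    have "norm ((\<Sum>(t, K)\<in>\<D>. measure lborel K *\<^sub>R q t) - (x b - x a)) < e"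
      if D: "\<D> tagged_division_of cbox a b" and fine: "\<gamma> fine \<D>" for \<D>
    proof -
      let ?I = "\<lambda>K. x (Sup K) - x (Inf K)"
      note DD = tagged_division_ofD[OF D]
      have mem: "\<exists>u v. K = {u..v} \<and> u \<le> v \<and> Inf K = u \<and> Sup K = v \<and> a \<le> u \<and> v \<le> b \<and> u \<le> t \<and> t \<le> v"
        if tK: "(t, K) \<in> \<D>" for t K
      proof -
        obtain u v where uv: "K = cbox u v" using DD(4)[OF tK] by blast
        moreover have "t \<in> K" "K \<subseteq> {a..b}" using DD(2,3)[OF tK] by auto
        ultimately show ?thesis by auto
      qed
      define D1 where "D1 = {(t, K) \<in> \<D>. t \<in> N'}"
      define D2 where "D2 = {(t, K) \<in> \<D>. t \<notin> N'}"
      have split: "\<D> = D1 \<union> D2" "D1 \<inter> D2 = {}" "finite D1" "finite D2"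
        using DD(1) by (auto simp: D1_def D2_def intro: rev_finite_subset)
      have tele: "(\<Sum>(t, K)\<in>\<D>. ?I K) = x b - x a"
        using additive_tagged_division_1[OF \<open>a \<le> b\<close>, of \<D> x] D by simp
      have "(\<Sum>(t, K)\<in>\<D>. measure lborel K *\<^sub>R q t) - (x b - x a) = (\<Sum>(t, K)\<in>\<D>. measure lborel K * q t - ?I K)"
        unfolding tele[symmetric] by (simp add: sum_subtractf[symmetric] split_def)
      also have "\<dots> = (\<Sum>(t, K)\<in>D1. measure lborel K * q t - ?I K) + (\<Sum>(t, K)\<in>D2. measure lborel K * q t - ?I K)"
        using split by (simp add: sum.union_disjoint)
      finally have eq: "(\<Sum>(t, K)\<in>\<D>. measure lborel K *\<^sub>R q t) - (x b - x a) = \<dots>" .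
      have tp: "D1 tagged_partial_division_of cbox a b"
        using D unfolding tagged_division_of_def D1_def
        by (auto intro: tagged_partial_division_subset)
      note D1self = tagged_partial_division_of_Union_self[OF tp]
      have div1: "snd ` D1 division_of \<Union>(snd ` D1)"
        using division_of_tagged_division[OF D1self] .
      \<comment> \<open>\<open>Sup\<close> and \<open>Inf\<close> of the empty set have no useful
        value, whereas the passage from tagged intervals to intervals requires a function that
        vanishes on every interval with empty interior.\<close>
      define J where "J K = (if K = {} then 0 else \<bar>?I K\<bar>)" for K
      have "\<bar>\<Sum>(t, K)\<in>D1. measure lborel K * q t - ?I K\<bar> \<le> (\<Sum>(t, K)\<in>D1. J K)"
        unfolding split_def
        by (rule order_trans[OF sum_abs])
          (rule sum_mono, auto simp: D1_def q_def J_def dest!: mem)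
      also have "\<dots> = (\<Sum>K\<in>snd ` D1. J K)"
        by (rule sum.over_tagged_division_lemma[OF D1self]) (auto simp: J_def box_real)
      also have "\<dots> = (\<Sum>K\<in>snd ` D1. \<bar>?I K\<bar>)"
        using division_ofD(3)[OF div1] by (intro sum.cong) (auto simp: J_def)
      also have "\<dots> < e / 2"
      proof (rule d(2))
        show sub: "\<Union>(snd ` D1) \<subseteq> {a..b}" using DD(3) unfolding D1_def by fastforce
        have "(\<Sum>K\<in>snd ` D1. Sup K - Inf K) = (\<Sum>K\<in>snd ` D1. measure lebesgue K)"
        proof (rule sum.cong)
          fix K assume "K \<in> snd ` D1"
          then obtain t where "(t, K) \<in> \<D>" by (auto simp: D1_def)
          from mem[OF this] obtain u v where uv: "K = {u..v}" "u \<le> v" "Inf K = u" "Sup K = v" by blast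
          have "measure lebesgue {u..v} = v - u" using uv(2) by simp
          then show "Sup K - Inf K = measure lebesgue K" using uv by metis
        qed simp
        also have "\<dots> = measure lebesgue (\<Union>(snd ` D1))"
          by (rule content_division[OF div1])
        also have "\<dots> < d"
        proof -
          have "\<Union>(snd ` D1) \<subseteq> U"
            using fine by (fastforce simp: fine_def D1_def \<gamma>_def)
          have "emeasure lebesgue (\<Union>(snd ` D1)) \<le> emeasure lebesgue U"
            using \<open>\<Union>(snd ` D1) \<subseteq> U\<close> U(1) by (intro emeasure_mono) auto
          also have "\<dots> \<le> emeasure lebesgue (U - N') + emeasure lebesgue N'"
          proof -
            have UN: "U - N' \<in> sets lebesgue"
              using U(1) negligible_imp_sets[OF N'] by (intro sets.Diff) auto
            have "emeasure lebesgue ((U - N') \<union> N') \<le> emeasure lebesgue (U - N') + emeasure lebesgue N'"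
              by (rule emeasure_subadditive[OF UN negligible_imp_sets[OF N']])
            moreover have "(U - N') \<union> N' = U" using U(2) by auto
            ultimately show ?thesis by metis
          qed
          also have "\<dots> = emeasure lebesgue (U - N')"
            using N' negligible_iff_null_sets null_setsD1 by fastforce
          also have "\<dots> < ennreal d" by fact
          finally show ?thesis
            using d(1) lmeasurable_division[OF div1] by (simp add: emeasure_eq_measure2 fmeasurableD2 ennreal_less_iff)
        qed
        finally show "(\<Sum>K\<in>snd ` D1. Sup K - Inf K) < d" .
      qed (fact div1)
      finally have e1: "\<bar>\<Sum>(t, K)\<in>D1. measure lborel K * q t - ?I K\<bar> < e / 2" .
      have "\<bar>\<Sum>(t, K)\<in>D2. measure lborel K * q t - ?I K\<bar> \<le> (\<Sum>(t, K)\<in>D2. c * measure lborel K)"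
      proof -
        have "\<bar>measure lborel K * q t - ?I K\<bar> \<le> c * measure lborel K" if "(t, K) \<in> D2" for t K
        proof -
          have tK: "(t, K) \<in> \<D>" "t \<notin> N'" using that by (auto simp: D2_def)
          from mem[OF tK(1)] obtain u v where uv: "K = {u..v}" "u \<le> v" "Inf K = u" "Sup K = v" "a \<le> u" "v \<le> b" "u \<le> t" "t \<le> v"
            by blast
          have t: "t \<in> {a..b} - N'" using uv tK by auto
          have "K \<subseteq> ball t (r t)" using fineD[OF fine tK(1)] t by (simp add: \<gamma>_def)
          then have "u \<in> ball t (r t)" "v \<in> ball t (r t)"
            using uv by (simp_all add: subset_iff)
          then have uvr: "\<bar>u - t\<bar> < r t" "\<bar>v - t\<bar> < r t" by (auto simp: dist_real_def)
          have "\<bar>x u - x t - p t * (u - t)\<bar> \<le> c * \<bar>u - t\<bar>" "\<bar>x v - x t - p t * (v - t)\<bar> \<le> c * \<bar>v - t\<bar>"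
            using r(2)[OF t] uvr by auto
          moreover have "\<bar>u - t\<bar> = t - u" "\<bar>v - t\<bar> = v - t" using uv by auto
          ultimately show ?thesis
            using uv tK by (simp add: q_def abs_le_iff algebra_simps)
        qed
        then show ?thesis
          unfolding split_def by (intro order_trans[OF sum_abs] sum_mono) auto
      qed
      also have "\<dots> \<le> (\<Sum>(t, K)\<in>\<D>. c * measure lborel K)"
        unfolding split_def using c DD(1) by (intro sum_mono2) (auto simp: D2_def)
      also have "\<dots> = c * (b - a)"
        using additive_content_tagged_division[OF D] \<open>a \<le> b\<close>
        by (simp add: split_def sum_distrib_left[symmetric])
      also have "\<dots> < e / 2"
        using e \<open>a \<le> b\<close> by (simp add: c_def field_simps)
      finally show ?thesis
        unfolding eq using e1 by simp
    qed
    then show "\<exists>\<gamma>. gauge \<gamma> \<and> (\<forall>\<D>. \<D> tagged_division_of cbox a b \<and> \<gamma> fine \<D> \<longrightarrow>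
              norm ((\<Sum>(x, k)\<in>\<D>. measure lborel k *\<^sub>R q x) - (x b - x a)) < e)"
      using g by blast
  qed
  then show ?thesis
    by (intro has_integral_spike[OF N', of "{a..b}" p q]) (auto simp: q_def)
qed

text \<open>Bridge from the almost everywhere conditions to gauge integration. Since
  \<open>lebesgue\<close> is complete, the exceptional set itself is a null set.\<close>

lemma AE_lebesgue_iff_negligible: "(AE t in lebesgue. P t) \<longleftrightarrow> negligible {t. \<not> P t}"
proof
  assume "AE t in lebesgue. P t"
  then obtain N where "N \<in> null_sets lebesgue" "{t \<in> space lebesgue. \<not> P t} \<subseteq> N"
    by (auto simp: eventually_ae_filter)
  then have N: "negligible N" "{t. \<not> P t} \<subseteq> N" by (auto simp: negligible_iff_null_sets)
  show "negligible {t. \<not> P t}"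
    by (rule negligible_subset[OF N])
next
  assume "negligible {t. \<not> P t}"
  then show "AE t in lebesgue. P t"
    by (intro AE_I'[of "{t. \<not> P t}"]) (auto simp: negligible_iff_null_sets)
qed

lemma AE_lebesgue_uminus:
  assumes "AE t::real in lebesgue. P t"
  shows "AE t::real in lebesgue. P (- t)"
proof -
  have "negligible (uminus ` {t. \<not> P t})"
    using assms by (intro negligible_differentiable_image_negligible)
      (auto simp: AE_lebesgue_iff_negligible)
  moreover have "{t. \<not> P (- t)} = uminus ` {t. \<not> P t}"
    by (auto intro!: image_eqI[where x = "- t" for t])
  ultimately show ?thesis by (simp add: AE_lebesgue_iff_negligible)
qed

text \<open>Lebesgue's differentiation theorem on the line. By Henstock's lemma, finitely many disjoint
  intervals on which the difference quotient is off by at least \<open>c\<close> have small total length, and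
  by Vitali such intervals cover almost all exceptional points.\<close>

theorem negligible_nondifferentiable_integral:
  fixes \<phi> :: "real \<Rightarrow> real"
  assumes int: "\<phi> integrable_on {a..b}"
  shows "negligible {t \<in> {a<..<b}. \<not> ((\<lambda>u. integral {a..u} \<phi>) has_real_derivative \<phi> t) (at t)}"
proof -
  define F where "F u = integral {a..u} \<phi>" for u
  have Fdiff: "F v - F u = integral {u..v} \<phi>" if "a \<le> u" "u \<le> v" "v \<le> b" for u v
  proof -
    have "\<phi> integrable_on {a..v}"
      using int that by (auto intro: integrable_on_subinterval)
    from Henstock_Kurzweil_Integration.integral_combine[OF that(1,2) this]
    show ?thesis by (simp add: F_def)
  qed
  \<comment> \<open>A countable family: failure of differentiability at \<open>t\<close> means that
    for some \<open>n\<close> difference quotients at points arbitrarily close to \<open>t\<close>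
    are off by at least \<open>1 / Suc n\<close>.\<close>
  define B where "B n = {t \<in> {a<..<b}. \<forall>d>0. \<exists>s\<in>{a..b}. s \<noteq> t \<and> \<bar>s - t\<bar> < d \<and>
      \<bar>F s - F t - \<phi> t * (s - t)\<bar> \<ge> \<bar>s - t\<bar> / real (Suc n)}" for n
  have sub: "{t \<in> {a<..<b}. \<not> (F has_real_derivative \<phi> t) (at t)} \<subseteq> (\<Union>n. B n)"
  proof
    fix t assume "t \<in> {t \<in> {a<..<b}. \<not> (F has_real_derivative \<phi> t) (at t)}"
    then have t: "a < t" "t < b" and nd: "\<not> (F has_derivative (\<lambda>h. \<phi> t * h)) (at t)"
      by (auto simp: has_field_derivative_def)
    obtain e where e: "e > 0" and ne: "\<And>d. d > 0 \<Longrightarrow> \<exists>s. \<bar>s - t\<bar> < d \<and> \<not> \<bar>F s - F t - \<phi> t * (s - t)\<bar> \<le> e * \<bar>s - t\<bar>"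
      using nd bounded_linear_mult_right[of "\<phi> t"] unfolding has_derivative_at_alt real_norm_def by blast
    obtain n where n: "1 / real (Suc n) < e" using nat_approx_posE[OF e] by blast
    have "t \<in> B n"
      unfolding B_def
    proof (intro CollectI conjI allI impI)
      fix d :: real assume "d > 0"
      define d' where "d' = min d (min (t - a) (b - t))"
      have "d' > 0" using \<open>d > 0\<close> t by (simp add: d'_def)
      then obtain s where s: "\<bar>s - t\<bar> < d'" "\<not> \<bar>F s - F t - \<phi> t * (s - t)\<bar> \<le> e * \<bar>s - t\<bar>"
        using ne by blast
      have "\<bar>s - t\<bar> / real (Suc n) = 1 / real (Suc n) * \<bar>s - t\<bar>" by simp
      also have "\<dots> \<le> e * \<bar>s - t\<bar>" using n by (intro mult_right_mono) auto
      also have "\<dots> \<le> \<bar>F s - F t - \<phi> t * (s - t)\<bar>" using s(2) by simp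
      finally have "\<bar>F s - F t - \<phi> t * (s - t)\<bar> \<ge> \<bar>s - t\<bar> / real (Suc n)" .
      moreover have "s \<noteq> t" using s(2) by auto
      moreover have "s \<in> {a..b}" "\<bar>s - t\<bar> < d" using s(1) by (auto simp: d'_def)
      ultimately show "\<exists>s\<in>{a..b}. s \<noteq> t \<and> \<bar>s - t\<bar> < d \<and>
          \<bar>F s - F t - \<phi> t * (s - t)\<bar> \<ge> \<bar>s - t\<bar> / real (Suc n)" by blast
    qed (use t in auto)
    then show "t \<in> (\<Union>n. B n)" by blast
  qed
  have neg: "negligible (B n)" for n
    unfolding negligible_outer_le
  proof (intro allI impI)
    fix \<eta> :: real assume \<eta>: "\<eta> > 0"
    define c where "c = 1 / real (Suc n)"
    have c: "c > 0" by (simp add: c_def)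
    have int': "\<phi> integrable_on cbox a b" using int by simp
    obtain \<gamma> where g: "gauge \<gamma>" and \<gamma>: "\<And>p. p tagged_partial_division_of (cbox a b) \<Longrightarrow> \<gamma> fine p \<Longrightarrow>
             (\<Sum>(x,k)\<in>p. norm (measure lborel k *\<^sub>R \<phi> x - integral k \<phi>)) < c * \<eta>"
      by (rule Henstock_lemma[OF int' mult_pos_pos[OF c \<eta>]], rule that)
    \<comment> \<open>Centre and radius that present the interval with endpoints \<open>t\<close>
      and \<open>s\<close> as a closed ball, the shape the covering theorem asks for. The tag
      \<open>t\<close> is an endpoint, not the centre.\<close>
    define M where "M t s = (t + s) / 2" for t s :: real
    define R where "R t s = \<bar>s - t\<bar> / 2" for t s :: real
    have cb: "cball (M t s) (R t s) = {min t s..max t s}" for t s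
      by (auto simp: cball_eq_atLeastAtMost M_def R_def min_def max_def field_simps)
    define X where "X = {(t, s). t \<in> B n \<and> s \<in> {a..b} \<and> s \<noteq> t \<and> {min t s..max t s} \<subseteq> \<gamma> t \<and>
      \<bar>F s - F t - \<phi> t * (s - t)\<bar> \<ge> c * \<bar>s - t\<bar>}"
    obtain C where C: "countable C" "C \<subseteq> X"
      "pairwise (\<lambda>i j. disjnt (cball (case_prod M i) (case_prod R i)) (cball (case_prod M j) (case_prod R j))) C"
      "negligible (B n - (\<Union>i\<in>C. cball (case_prod M i) (case_prod R i)))"
    proof (rule Vitali_covering_theorem_cballs[of X "case_prod R" "B n" "case_prod M"])
      show "0 < case_prod R i" if "i \<in> X" for i
        using that by (auto simp: X_def R_def)
      fix t d :: real assume t: "t \<in> B n" and d: "0 < d"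
      have "open (\<gamma> t)" "t \<in> \<gamma> t" using g by (auto simp: gauge_def)
      then obtain r where r: "r > 0" "ball t r \<subseteq> \<gamma> t" using open_contains_ball by blast
      have "min r d > 0" using r d by simp
      then obtain s where s: "s \<in> {a..b}" "s \<noteq> t" "\<bar>s - t\<bar> < min r d" "\<bar>F s - F t - \<phi> t * (s - t)\<bar> \<ge> \<bar>s - t\<bar> / real (Suc n)"
        using t unfolding B_def by blast
      have "{min t s..max t s} \<subseteq> ball t r"
        using s(3) by (auto simp: dist_real_def min_def max_def split: if_splits)
      then have "(t, s) \<in> X" using s r t by (auto simp: X_def c_def)
      moreover have "t \<in> cball (M t s) (R t s)" by (simp add: cb)
      moreover have "R t s < d" using s(3) d by (simp add: R_def)
      ultimately show "\<exists>i. i \<in> X \<and> t \<in> cball (case_prod M i) (case_prod R i) \<and> case_prod R i < d"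
        by (intro exI[of _ "(t, s)"]) simp
    qed (rule that)
    define I where "I i = (case i of (t, s) \<Rightarrow> {min t s..max t s})" for i :: "real \<times> real"
    have I: "cball (case_prod M i) (case_prod R i) = I i" for i
      by (cases i) (simp add: I_def cb)
    note C = C[unfolded I]
    \<comment> \<open>Henstock's lemma speaks of finite families. A bound that is uniform over them
      passes to the countable union.\<close>
    have bound: "measure lebesgue (\<Union>i\<in>C'. I i) \<le> \<eta>" if C': "C' \<subseteq> C" "finite C'" for C'
    proof -
      define p where "p = (\<lambda>i. (fst i, I i)) ` C'"
      have disj: "I i \<inter> I j = {}" if "i \<in> C'" "j \<in> C'" "i \<noteq> j" for i j
        using C(3) C'(1) that by (auto simp: pairwise_def disjnt_def)
      have ne: "I i \<noteq> {}" for i by (cases i) (auto simp: I_def)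
      have inj: "inj_on (\<lambda>i. (fst i, I i)) C'"
        using disj ne by (fastforce simp: inj_on_def)
      have XC: "i \<in> X" if "i \<in> C'" for i using that C' C(2) by blast
      have p: "p tagged_partial_division_of (cbox a b)"
        unfolding tagged_partial_division_of_def
      proof (intro conjI allI impI)
        show "finite p" using C' by (simp add: p_def)
        fix x K assume "(x, K) \<in> p"
        then obtain s where xs: "(x, s) \<in> C'" "K = {min x s..max x s}" by (auto simp: p_def I_def)
        then show "x \<in> K" "K \<subseteq> cbox a b" "\<exists>a b. K = cbox a b"
          using XC[OF xs(1)] by (auto simp: X_def B_def)
      next
        fix x1 K1 x2 K2 assume "(x1, K1) \<in> p \<and> (x2, K2) \<in> p \<and> (x1, K1) \<noteq> (x2, K2)"
        then obtain i j where "i \<in> C'" "j \<in> C'" "K1 = I i" "K2 = I j" "i \<noteq> j" by (auto simp: p_def)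
        then have "K1 \<inter> K2 = {}" using disj by blast
        then show "interior K1 \<inter> interior K2 = {}"
          using interior_subset by blast
      qed
      have fine: "\<gamma> fine p"
        using XC by (fastforce simp: fine_def p_def X_def I_def)
      have lower: "c * measure lebesgue (I i) \<le> norm (measure lborel (I i) *\<^sub>R \<phi> (fst i) - integral (I i) \<phi>)"
        if "i \<in> C'" for i
      proof (cases i)
        case (Pair t s)
        have X: "(t, s) \<in> X" using XC[OF that] Pair by simp
        then have ts: "a < t" "t < b" "s \<in> {a..b}" "\<bar>F s - F t - \<phi> t * (s - t)\<bar> \<ge> c * \<bar>s - t\<bar>"
          by (auto simp: X_def B_def)
        show ?thesis
        proof (cases "t \<le> s")
          case True
          with ts Fdiff[of t s] show ?thesis
            by (simp add: Pair I_def min_def max_def abs_minus_commute mult.commute)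
        next
          case False
          with ts Fdiff[of s t] show ?thesis
            by (auto simp: Pair I_def min_def max_def algebra_simps abs_minus_commute)
        qed
      qed
      have "c * measure lebesgue (\<Union>i\<in>C'. I i) \<le> c * (\<Sum>i\<in>C'. measure lebesgue (I i))"
        using c C'(2) by (intro mult_left_mono measure_UNION_le) (auto simp: I_def split: prod.splits)
      also have "\<dots> = (\<Sum>i\<in>C'. c * measure lebesgue (I i))" by (simp add: sum_distrib_left)
      also have "\<dots> \<le> (\<Sum>i\<in>C'. norm (measure lborel (I i) *\<^sub>R \<phi> (fst i) - integral (I i) \<phi>))"
        by (intro sum_mono lower)
      also have "\<dots> = (\<Sum>(x,k)\<in>p. norm (measure lborel k *\<^sub>R \<phi> x - integral k \<phi>))"
        unfolding p_def by (subst sum.reindex[OF inj]) simp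
      also have "\<dots> < c * \<eta>" by (rule \<gamma>[OF p fine])
      finally show ?thesis using c by simp
    qed
    have meas: "I i \<in> lmeasurable" for i by (cases i) (simp add: I_def)
    have U: "(\<Union>i\<in>C. I i) \<in> lmeasurable" "measure lebesgue (\<Union>i\<in>C. I i) \<le> \<eta>"
      using fmeasurable_UN_bound[OF C(1) meas bound] measure_UN_bound[OF C(1) meas bound] by auto
    let ?T = "(\<Union>i\<in>C. I i) \<union> (B n - (\<Union>i\<in>C. I i))"
    have T1: "?T \<in> lmeasurable" by (rule fmeasurable.Un[OF U(1) negligible_imp_measurable[OF C(4)]])
    have T2: "measure lebesgue ?T \<le> \<eta>"
      using measure_Un_le[OF fmeasurableD[OF U(1)] negligible_imp_sets[OF C(4)]] U(2)
        negligible_imp_measure0[OF C(4)] by linarith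
    show "\<exists>T. B n \<subseteq> T \<and> T \<in> lmeasurable \<and> measure lebesgue T \<le> \<eta>"
      by (intro exI[of _ ?T] conjI T1 T2) auto
  qed
  show ?thesis
    using negligible_subset[OF negligible_Union_nat[OF neg] sub] unfolding F_def[abs_def] .
qed

section \<open>Calculus of absolutely continuous functions with a prescribed almost everywhere
  derivative\<close>

text \<open>The derivative is an argument of its own because the differences and logarithms of
  solutions that carry the proof satisfy differential inequalities rather than an equation of the
  form \<open>x' = g(t, x)\<close>.\<close>

definition ac_derivative :: "real set \<Rightarrow> (real \<Rightarrow> real) \<Rightarrow> (real \<Rightarrow> real) \<Rightarrow> bool" where
  "ac_derivative I w p \<longleftrightarrow> (\<forall>a b. {a..b} \<subseteq> I \<longrightarrow> abs_continuous_on {a..b} w) \<and>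
     (AE t in lebesgue. t \<in> I \<longrightarrow> (w has_real_derivative p t) (at t))"

lemma solution_iff_ac_derivative:
  "solution g I x \<longleftrightarrow> is_interval I \<and> ac_derivative I x (\<lambda>t. g t (x t))"
  by (simp add: solution_def ac_derivative_def)

lemma ac_derivative_subset: "ac_derivative I w p \<Longrightarrow> J \<subseteq> I \<Longrightarrow> ac_derivative J w p"
  unfolding ac_derivative_def by (blast intro: eventually_mono)

lemma ac_derivative_AE:
  "ac_derivative I w p \<Longrightarrow> AE t in lebesgue. t \<in> I \<longrightarrow> (w has_real_derivative p t) (at t)"
  by (simp add: ac_derivative_def)

text \<open>The constant may depend on the compact interval, as it must for the logarithm.\<close>

lemma ac_derivative_dominated2:
  assumes v: "ac_derivative I v p" and w: "ac_derivative I w q"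
    and C: "\<And>a b. {a..b} \<subseteq> I \<Longrightarrow> \<exists>C. \<forall>s\<in>{a..b}. \<forall>t\<in>{a..b}.
      \<bar>z t - z s\<bar> \<le> C * (\<bar>v t - v s\<bar> + \<bar>w t - w s\<bar>)"
    and der: "\<And>t. t \<in> I \<Longrightarrow> (v has_real_derivative p t) (at t) \<Longrightarrow> (w has_real_derivative q t) (at t) \<Longrightarrow>
      (z has_real_derivative r t) (at t)"
  shows "ac_derivative I z r"
  unfolding ac_derivative_def
proof (intro conjI allI impI)
  fix a b :: real assume ab: "{a..b} \<subseteq> I"
  obtain C where "\<forall>s\<in>{a..b}. \<forall>t\<in>{a..b}. \<bar>z t - z s\<bar> \<le> C * (\<bar>v t - v s\<bar> + \<bar>w t - w s\<bar>)"
    using C[OF ab] by blast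
  moreover have "abs_continuous_on {a..b} v" "abs_continuous_on {a..b} w"
    using v w ab by (simp_all add: ac_derivative_def)
  ultimately show "abs_continuous_on {a..b} z"
    by - (rule abs_continuous_on_dominated2[of "{a..b}" v w z C], simp_all)
next
  show "AE t in lebesgue. t \<in> I \<longrightarrow> (z has_real_derivative r t) (at t)"
    using ac_derivative_AE[OF v] ac_derivative_AE[OF w] by eventually_elim (auto intro: der)
qed

lemma ac_derivative_add:
  assumes "ac_derivative I v p" and "ac_derivative I w q"
  shows "ac_derivative I (\<lambda>t. v t + w t) (\<lambda>t. p t + q t)"
  by (rule ac_derivative_dominated2[OF assms]) (auto intro!: exI[of _ 1] derivative_eq_intros)

lemma ac_derivative_diff:
  assumes "ac_derivative I v p" and "ac_derivative I w q"
  shows "ac_derivative I (\<lambda>t. v t - w t) (\<lambda>t. p t - q t)"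
  by (rule ac_derivative_dominated2[OF assms]) (auto intro!: exI[of _ 1] derivative_eq_intros)

lemma ac_derivative_cmult:
  assumes "ac_derivative I v p"
  shows "ac_derivative I (\<lambda>t. c * v t) (\<lambda>t. c * p t)"
proof (rule ac_derivative_dominated2[OF assms assms])
  fix a b
  have "\<bar>c * v t - c * v s\<bar> \<le> \<bar>c\<bar> * (\<bar>v t - v s\<bar> + \<bar>v t - v s\<bar>)" for s t
    by (simp add: right_diff_distrib[symmetric] abs_mult distrib_left)
  then show "\<exists>C. \<forall>s\<in>{a..b}. \<forall>t\<in>{a..b}. \<bar>c * v t - c * v s\<bar> \<le> C * (\<bar>v t - v s\<bar> + \<bar>v t - v s\<bar>)"
    by blast
qed (auto intro!: derivative_eq_intros)

lemma ac_derivative_linear: "ac_derivative I (\<lambda>t. c * t + d) (\<lambda>_. c)"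
  unfolding ac_derivative_def
proof (intro conjI allI impI)
  fix a b
  show "abs_continuous_on {a..b} (\<lambda>t. c * t + d)"
    by (rule lipschitz_imp_abs_continuous_on[of _ _ "\<bar>c\<bar>"])
      (simp add: right_diff_distrib[symmetric] abs_mult)
qed (auto intro!: AE_I2 derivative_eq_intros)

lemma ac_derivative_const: "ac_derivative I (\<lambda>t. d) (\<lambda>_. 0)"
  using ac_derivative_linear[of I 0 d] by simp

lemma ac_derivative_continuous_on:
  "ac_derivative I w p \<Longrightarrow> {a..b} \<subseteq> I \<Longrightarrow> continuous_on {a..b} w"
  unfolding ac_derivative_def by (blast intro: abs_continuous_on_imp_continuous_on)

text \<open>On a compact interval \<open>v\<close> has a positive minimum \<open>m\<close>, and
  \<open>ln\<close> is Lipschitz with constant \<open>1 / m\<close> above \<open>m\<close>.\<close>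

lemma ac_derivative_ln:
  assumes v: "ac_derivative I v p" and pos: "\<And>t. t \<in> I \<Longrightarrow> v t > 0"
  shows "ac_derivative I (\<lambda>t. ln (v t)) (\<lambda>t. p t / v t)"
proof (rule ac_derivative_dominated2[OF v v])
  fix a b :: real assume ab: "{a..b} \<subseteq> I"
  show "\<exists>C. \<forall>s\<in>{a..b}. \<forall>t\<in>{a..b}. \<bar>ln (v t) - ln (v s)\<bar> \<le> C * (\<bar>v t - v s\<bar> + \<bar>v t - v s\<bar>)"
  proof (cases "{a..b} = {}")
    case False
    then obtain t0 where t0: "t0 \<in> {a..b}" "\<And>t. t \<in> {a..b} \<Longrightarrow> v t0 \<le> v t"
      using continuous_attains_inf[OF _ False ac_derivative_continuous_on[OF v ab]] by blast
    define m where "m = v t0"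
    have m: "m > 0" "\<And>t. t \<in> {a..b} \<Longrightarrow> m \<le> v t" using t0 pos ab by (auto simp: m_def)
    have *: "ln y - ln x \<le> (y - x) / m" if "m \<le> x" "x \<le> y" for x y
    proof -
      have "ln y - ln x = ln (y / x)" using that m by (simp add: ln_div)
      also have "\<dots> \<le> y / x - 1" using that m by (intro ln_le_minus_one) auto
      also have "\<dots> = (y - x) / x" using that m by (simp add: field_simps)
      also have "\<dots> \<le> (y - x) / m" using that m by (intro divide_left_mono) auto
      finally show ?thesis .
    qed
    have "\<bar>ln (v t) - ln (v s)\<bar> \<le> 1 / m * (\<bar>v t - v s\<bar> + \<bar>v t - v s\<bar>)"
      if "s \<in> {a..b}" "t \<in> {a..b}" for s t
    proof -
      have vs: "m \<le> v s" "m \<le> v t" using that m by auto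
      have "\<bar>ln (v t) - ln (v s)\<bar> \<le> \<bar>v t - v s\<bar> / m"
      proof (cases "v s \<le> v t")
        case True
        then have "ln (v s) \<le> ln (v t)" using vs m by (intro ln_mono) auto
        with *[of "v s" "v t"] vs True show ?thesis by simp
      next
        case False
        then have "ln (v t) \<le> ln (v s)" using vs m by (intro ln_mono) auto
        with *[of "v t" "v s"] vs False show ?thesis by simp
      qed
      also have "\<dots> \<le> 1 / m * (\<bar>v t - v s\<bar> + \<bar>v t - v s\<bar>)"
        using m by (simp add: field_simps)
      finally show ?thesis .
    qed
    then show ?thesis by blast
  qed auto
next
  fix t assume "t \<in> I" "(v has_real_derivative p t) (at t)"
  then show "((\<lambda>t. ln (v t)) has_real_derivative p t / v t) (at t)"
    using pos[of t] by (auto intro!: derivative_eq_intros)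
qed

lemma ac_derivative_has_integral:
  assumes "ac_derivative I w p" and "{a..b} \<subseteq> I" and "a \<le> b"
  shows "(p has_integral (w b - w a)) {a..b}"
proof (rule abs_continuous_on_has_integral[OF \<open>a \<le> b\<close>])
  show "abs_continuous_on {a..b} w" using assms by (simp add: ac_derivative_def)
  show "negligible {t. \<not> (t \<in> I \<longrightarrow> (w has_real_derivative p t) (at t))}"
    using ac_derivative_AE[OF assms(1)] by (simp add: AE_lebesgue_iff_negligible)
  fix t assume t: "t \<in> {a<..<b} - {t. \<not> (t \<in> I \<longrightarrow> (w has_real_derivative p t) (at t))}"
  then have "t \<in> I" using assms(2) by (simp add: subset_iff)
  then show "(w has_real_derivative p t) (at t)" using t by simp
qed

text \<open>Takes the place of the mean value inequality when the derivatives are ordered only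
  almost everywhere: both are set to 0 on the exceptional set and then integrated.\<close>

lemma ac_derivative_le:
  assumes w: "ac_derivative I w p" and v: "ac_derivative I v q" and I: "{a..b} \<subseteq> I" and ab: "a \<le> b"
    and le: "AE t in lebesgue. t \<in> {a..b} \<longrightarrow> p t \<le> q t"
  shows "w b - w a \<le> v b - v a"
proof -
  define N where "N = {t. \<not> (t \<in> {a..b} \<longrightarrow> p t \<le> q t)}"
  have N: "negligible N" using le by (simp add: AE_lebesgue_iff_negligible N_def)
  have "((\<lambda>t. if t \<in> N then 0 else p t) has_integral (w b - w a)) {a..b}"
    by (rule has_integral_spike[OF N _ ac_derivative_has_integral[OF w I ab]]) auto
  moreover have "((\<lambda>t. if t \<in> N then 0 else q t) has_integral (v b - v a)) {a..b}"
    by (rule has_integral_spike[OF N _ ac_derivative_has_integral[OF v I ab]]) auto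
  ultimately show ?thesis
    by (rule has_integral_le) (auto simp: N_def)
qed

lemma ac_derivative_bound:
  assumes w: "ac_derivative I w p" and I: "{a..b} \<subseteq> I" and ab: "a \<le> b"
    and le: "AE t in lebesgue. t \<in> {a..b} \<longrightarrow> \<bar>p t\<bar> \<le> C"
  shows "\<bar>w b - w a\<bar> \<le> C * (b - a)"
proof -
  have "w b - w a \<le> (C * b + 0) - (C * a + 0)"
  proof (rule ac_derivative_le[OF w ac_derivative_linear I ab])
    show "AE t in lebesgue. t \<in> {a..b} \<longrightarrow> p t \<le> C"
      using le by eventually_elim auto
  qed
  moreover have "(- C * b + 0) - (- C * a + 0) \<le> w b - w a"
  proof (rule ac_derivative_le[OF ac_derivative_linear w I ab])
    show "AE t in lebesgue. t \<in> {a..b} \<longrightarrow> - C \<le> p t"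
      using le by eventually_elim auto
  qed
  ultimately show ?thesis by (simp add: algebra_simps abs_le_iff)
qed

text \<open>The bound on \<open>p\<close> makes the reflected function Lipschitz, so that divisions
  of the interval are not carried through the reflection. The two signs cancel in the
  derivative.\<close>

lemma ac_derivative_uminus_arg:
  assumes w: "ac_derivative I w p"
    and C: "\<And>a b. {a..b} \<subseteq> I \<Longrightarrow> \<exists>C. AE t in lebesgue. t \<in> {a..b} \<longrightarrow> \<bar>p t\<bar> \<le> C"
  shows "ac_derivative (uminus ` I) (\<lambda>t. - w (- t)) (\<lambda>t. p (- t))"
  unfolding ac_derivative_def
proof (intro conjI allI impI)
  fix a b :: real assume ab: "{a..b} \<subseteq> uminus ` I"
  have I: "{- b..- a} \<subseteq> I"
  proof
    fix t assume "t \<in> {- b..- a}"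
    then have "- t \<in> uminus ` I" using ab by auto
    then show "t \<in> I" by auto
  qed
  obtain C where C: "AE t in lebesgue. t \<in> {- b..- a} \<longrightarrow> \<bar>p t\<bar> \<le> C" using C[OF I] by blast
  show "abs_continuous_on {a..b} (\<lambda>t. - w (- t))"
  proof (rule lipschitz_imp_abs_continuous_on[of _ _ C])
    fix u v assume uv: "u \<in> {a..b}" "v \<in> {a..b}" "u \<le> v"
    have "\<bar>w (- u) - w (- v)\<bar> \<le> C * (- u - - v)"
    proof (rule ac_derivative_bound[OF w])
      show "AE t in lebesgue. t \<in> {- v..- u} \<longrightarrow> \<bar>p t\<bar> \<le> C"
        using C by eventually_elim (use uv in auto)
    qed (use uv I in auto)
    then show "\<bar>- w (- v) - - w (- u)\<bar> \<le> C * (v - u)" by simp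
  qed
next
  show "AE t in lebesgue. t \<in> uminus ` I \<longrightarrow> ((\<lambda>t. - w (- t)) has_real_derivative p (- t)) (at t)"
    using AE_lebesgue_uminus[OF ac_derivative_AE[OF w]]
  proof eventually_elim
    case (elim t)
    show ?case
    proof
      assume "t \<in> uminus ` I"
      then have "(w has_real_derivative p (- t)) (at (- t))" using elim by auto
      then have "((\<lambda>t. w (- t)) has_real_derivative p (- t) * (- 1)) (at t)"
        by (simp add: DERIV_mirror)
      from DERIV_minus[OF this] show "((\<lambda>t. - w (- t)) has_real_derivative p (- t)) (at t)" by simp
    qed
  qed
qed

section \<open>Differential inequalities\<close>

text \<open>Gronwall's inequality, obtained by integrating the derivative of
  \<open>ln w\<close>.\<close>

lemma growth_lower_bound:
  assumes w: "ac_derivative {s..t} w p" and st: "s \<le> t"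
    and pos: "\<And>l. l \<in> {s..t} \<Longrightarrow> w l > 0"
    and p: "AE l in lebesgue. l \<in> {s..t} \<longrightarrow> p l \<ge> - L * w l"
  shows "w t \<ge> exp (- L * (t - s)) * w s"
proof -
  have "(- L * t + 0) - (- L * s + 0) \<le> ln (w t) - ln (w s)"
  proof (rule ac_derivative_le[OF ac_derivative_linear ac_derivative_ln[OF w pos] order_refl st])
    show "AE l in lebesgue. l \<in> {s..t} \<longrightarrow> - L \<le> p l / w l"
      using p by eventually_elim (use pos in \<open>auto simp: pos_le_divide_eq\<close>)
  qed auto
  then have "ln (w s) + (- L * (t - s)) \<le> ln (w t)" by (simp add: algebra_simps)
  then have "exp (ln (w s) + (- L * (t - s))) \<le> exp (ln (w t))" by simp
  then show ?thesis using pos[of s] pos[of t] st by (simp only: exp_add) (simp add: mult.commute)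
qed

lemma growth_upper_bound:
  assumes w: "ac_derivative {s..t} w p" and st: "s \<le> t"
    and pos: "\<And>l. l \<in> {s..t} \<Longrightarrow> w l > 0"
    and p: "AE l in lebesgue. l \<in> {s..t} \<longrightarrow> p l \<le> L * w l"
  shows "w s \<ge> exp (- L * (t - s)) * w t"
proof -
  have "ln (w t) - ln (w s) \<le> (L * t + 0) - (L * s + 0)"
  proof (rule ac_derivative_le[OF ac_derivative_ln[OF w pos] ac_derivative_linear order_refl st])
    show "AE l in lebesgue. l \<in> {s..t} \<longrightarrow> p l / w l \<le> L"
      using p by eventually_elim (use pos in \<open>auto simp: pos_divide_le_eq\<close>)
  qed auto
  then have "ln (w t) + (- L * (t - s)) \<le> ln (w s)" by (simp add: algebra_simps)
  then have "exp (ln (w t) + (- L * (t - s))) \<le> exp (ln (w s))" by simp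
  then show ?thesis using pos[of s] pos[of t] st by (simp only: exp_add) (simp add: mult.commute)
qed

text \<open>The inequality for \<open>p\<close> is available only while \<open>w\<close> is
  positive, so a zero must be excluded first. Up to the first time at which \<open>w\<close> is at
  most \<open>m / 2\<close> Gronwall applies and gives \<open>w \<ge> m\<close> there, a
  contradiction.\<close>

lemma positive_forward:
  assumes w: "ac_derivative {s..t} w p" and st: "s \<le> t" and ws: "w s > 0"
    and p: "AE l in lebesgue. l \<in> {s..t} \<longrightarrow> w l > 0 \<longrightarrow> p l \<ge> - L * w l"
  shows "w t \<ge> exp (- L * (t - s)) * w s"
proof -
  \<comment> \<open>With the absolute value of \<open>L\<close> this lies below every Gronwall bound
    on \<open>{s..t}\<close>, whatever the sign of \<open>L\<close>.\<close>
  define m where "m = exp (- \<bar>L\<bar> * (t - s)) * w s"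
  have m: "m > 0" using ws by (simp add: m_def)
  have m_le: "m \<le> exp (- L * (\<tau> - s)) * w s" if "s \<le> \<tau>" "\<tau> \<le> t" for \<tau>
  proof -
    have "L * (\<tau> - s) \<le> \<bar>L\<bar> * (\<tau> - s)" using that by (intro mult_right_mono) auto
    also have "\<dots> \<le> \<bar>L\<bar> * (t - s)" using that by (intro mult_left_mono) auto
    finally show ?thesis using ws by (simp add: m_def)
  qed
  have cont: "continuous_on {s..t} w" by (rule ac_derivative_continuous_on[OF w order_refl])
  have pos: "w l > 0" if l: "l \<in> {s..t}" for l
  proof (rule ccontr)
    assume neg: "\<not> w l > 0"
    define A where "A = {s..t} \<inter> w -` {..m / 2}"
    have "closed A" unfolding A_def
      by (intro continuous_closed_preimage[OF cont] closed_atLeastAtMost closed_atMost)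
    then have "compact ({s..t} \<inter> A)" by (intro compact_Int_closed) auto
    moreover have "{s..t} \<inter> A = A" by (auto simp: A_def)
    ultimately have "compact A" by simp
    moreover have "l \<in> A" using l neg m by (simp add: A_def)
    ultimately obtain \<tau> where \<tau>: "\<tau> \<in> A" "\<And>x. x \<in> A \<Longrightarrow> \<tau> \<le> x"
      using compact_attains_inf[of A] by blast
    have st': "s \<le> \<tau>" "\<tau> \<le> t" and w\<tau>: "w \<tau> \<le> m / 2" using \<tau>(1) by (auto simp: A_def)
    have "m \<le> w s" using m_le[of s] st by simp
    then have "m / 2 \<le> w s" using m by simp
    moreover have "continuous_on {s..\<tau>} w" using cont st' by (auto intro: continuous_on_subset)
    \<comment> \<open>The intermediate value theorem shows that \<open>w\<close> equals
      \<open>m / 2\<close> at its first visit, so it is still positive at \<open>\<tau>\<close>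
      itself.\<close>
    ultimately obtain \<sigma> where \<sigma>: "s \<le> \<sigma>" "\<sigma> \<le> \<tau>" "w \<sigma> = m / 2"
      using IVT2'[of w \<tau> "m / 2" s] w\<tau> st' by blast
    then have "\<sigma> \<in> A" using st' by (simp add: A_def)
    then have w\<tau>': "w \<tau> = m / 2" using \<tau>(2) \<sigma> by force
    have "w x > 0" if "x \<in> {s..\<tau>}" for x
    proof (cases "x = \<tau>")
      case False
      then have "x \<notin> A" using \<tau>(2)[of x] that by auto
      then show ?thesis using that st' m by (auto simp: A_def)
    qed (use \<open>w \<tau> = m / 2\<close> m in simp)
    have "w \<tau> \<ge> exp (- L * (\<tau> - s)) * w s"
    proof (intro growth_lower_bound[OF ac_derivative_subset[OF w]])
      show "AE l in lebesgue. l \<in> {s..\<tau>} \<longrightarrow> p l \<ge> - L * w l"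
        using p by eventually_elim (use st' \<open>\<And>x. x \<in> {s..\<tau>} \<Longrightarrow> w x > 0\<close> in auto)
    qed (use st' \<open>\<And>x. x \<in> {s..\<tau>} \<Longrightarrow> w x > 0\<close> in auto)
    with w\<tau>' show False using m_le[OF st'] m by simp
  qed
  show ?thesis
  proof (rule growth_lower_bound[OF w st pos])
    show "AE l in lebesgue. l \<in> {s..t} \<longrightarrow> p l \<ge> - L * w l"
      using p by eventually_elim (use pos in auto)
  qed
qed

text \<open>Time mirror of \<open>positive_forward\<close>. Reflection by
  \<open>ac_derivative_uminus_arg\<close> would ask for a bound on \<open>p\<close>, so the argument
  is repeated with the last time at which \<open>w\<close> is at most \<open>m / 2\<close>.\<close>

lemma positive_backward:
  assumes w: "ac_derivative {s..t} w p" and st: "s \<le> t" and wt: "w t > 0"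
    and p: "AE l in lebesgue. l \<in> {s..t} \<longrightarrow> w l > 0 \<longrightarrow> p l \<le> L * w l"
  shows "w s \<ge> exp (- L * (t - s)) * w t"
proof -
  define m where "m = exp (- \<bar>L\<bar> * (t - s)) * w t"
  have m: "m > 0" using wt by (simp add: m_def)
  have m_le: "m \<le> exp (- L * (t - \<tau>)) * w t" if "s \<le> \<tau>" "\<tau> \<le> t" for \<tau>
  proof -
    have "L * (t - \<tau>) \<le> \<bar>L\<bar> * (t - \<tau>)" using that by (intro mult_right_mono) auto
    also have "\<dots> \<le> \<bar>L\<bar> * (t - s)" using that by (intro mult_left_mono) auto
    finally show ?thesis using wt by (simp add: m_def)
  qed
  have cont: "continuous_on {s..t} w" by (rule ac_derivative_continuous_on[OF w order_refl])
  have pos: "w l > 0" if l: "l \<in> {s..t}" for l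
  proof (rule ccontr)
    assume neg: "\<not> w l > 0"
    define A where "A = {s..t} \<inter> w -` {..m / 2}"
    have "closed A" unfolding A_def
      by (intro continuous_closed_preimage[OF cont] closed_atLeastAtMost closed_atMost)
    then have "compact ({s..t} \<inter> A)" by (intro compact_Int_closed) auto
    moreover have "{s..t} \<inter> A = A" by (auto simp: A_def)
    ultimately have "compact A" by simp
    moreover have "l \<in> A" using l neg m by (simp add: A_def)
    ultimately obtain \<tau> where \<tau>: "\<tau> \<in> A" "\<And>x. x \<in> A \<Longrightarrow> x \<le> \<tau>"
      using compact_attains_sup[of A] by blast
    have st': "s \<le> \<tau>" "\<tau> \<le> t" and w\<tau>: "w \<tau> \<le> m / 2" using \<tau>(1) by (auto simp: A_def)
    have "m \<le> w t" using m_le[of t] st by simp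
    then have "m / 2 \<le> w t" using m by simp
    moreover have "continuous_on {\<tau>..t} w" using cont st' by (auto intro: continuous_on_subset)
    ultimately obtain \<sigma> where \<sigma>: "\<tau> \<le> \<sigma>" "\<sigma> \<le> t" "w \<sigma> = m / 2"
      using IVT'[of w \<tau> "m / 2" t] w\<tau> st' by blast
    then have "\<sigma> \<in> A" using st' by (simp add: A_def)
    then have w\<tau>': "w \<tau> = m / 2" using \<tau>(2) \<sigma> by force
    have "w x > 0" if "x \<in> {\<tau>..t}" for x
    proof (cases "x = \<tau>")
      case False
      then have "x \<notin> A" using \<tau>(2)[of x] that by auto
      then show ?thesis using that st' m by (auto simp: A_def)
    qed (use \<open>w \<tau> = m / 2\<close> m in simp)
    have "w \<tau> \<ge> exp (- L * (t - \<tau>)) * w t"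
    proof (intro growth_upper_bound[OF ac_derivative_subset[OF w]])
      show "AE l in lebesgue. l \<in> {\<tau>..t} \<longrightarrow> p l \<le> L * w l"
        using p by eventually_elim (use st' \<open>\<And>x. x \<in> {\<tau>..t} \<Longrightarrow> w x > 0\<close> in auto)
    qed (use st' \<open>\<And>x. x \<in> {\<tau>..t} \<Longrightarrow> w x > 0\<close> in auto)
    with w\<tau>' show False using m_le[OF st'] m by simp
  qed
  show ?thesis
  proof (rule growth_upper_bound[OF w st pos])
    show "AE l in lebesgue. l \<in> {s..t} \<longrightarrow> p l \<le> L * w l"
      using p by eventually_elim (use pos in auto)
  qed
qed

text \<open>If \<open>w\<close> were positive at \<open>t\<close>, positivity would propagate
  backwards to \<open>s\<close>.\<close>

lemma barrier_forward:
  assumes w: "ac_derivative {s..t} w p" and st: "s \<le> t" and ws: "w s \<le> 0"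
    and p: "AE l in lebesgue. l \<in> {s..t} \<longrightarrow> w l > 0 \<longrightarrow> p l \<le> L * w l"
  shows "w t \<le> 0"
proof (rule ccontr)
  assume "\<not> w t \<le> 0"
  then have "exp (- L * (t - s)) * w t > 0" by simp
  moreover have "w s \<ge> exp (- L * (t - s)) * w t"
    using \<open>\<not> w t \<le> 0\<close> by (intro positive_backward[OF w st _ p]) simp
  ultimately show False using ws by linarith
qed

text \<open>The null set is fixed before \<open>x\<close> and \<open>y\<close>, so the estimate may
  be used along any curve.\<close>

definition locally_lipschitz :: "(real \<Rightarrow> real \<Rightarrow> real) \<Rightarrow> bool" where
  "locally_lipschitz g \<longleftrightarrow> (\<forall>K. \<exists>L. AE t in lebesgue. \<forall>x y. \<bar>x\<bar> \<le> K \<longrightarrow> \<bar>y\<bar> \<le> K \<longrightarrow>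
     \<bar>g t x - g t y\<bar> \<le> L * \<bar>x - y\<bar>)"

lemma ac_derivative_bounded_on_interval:
  assumes "ac_derivative {s..t} w p"
  obtains K where "\<And>l. l \<in> {s..t} \<Longrightarrow> \<bar>w l\<bar> \<le> K"
proof -
  have "bounded (w ` {s..t})"
    by (intro compact_imp_bounded compact_continuous_image ac_derivative_continuous_on[OF assms]) auto
  then obtain K where "\<forall>v\<in>w ` {s..t}. norm v \<le> K" unfolding bounded_iff ..
  then show thesis by (intro that[of K]) simp
qed

text \<open>Comparison of a subsolution \<open>x\<close> with a supersolution \<open>y\<close>. The
  strict part is \<open>positive_forward\<close> for \<open>y - x\<close>, the weak part
  \<open>barrier_forward\<close> for \<open>x - y\<close>.\<close>

lemma compare_solutions:
  assumes lip: "locally_lipschitz g"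
    and x: "ac_derivative {s..t} x p" and y: "ac_derivative {s..t} y q"
    and xp: "AE l in lebesgue. l \<in> {s..t} \<longrightarrow> p l \<le> g l (x l)"
    and yq: "AE l in lebesgue. l \<in> {s..t} \<longrightarrow> g l (y l) \<le> q l"
    and st: "s \<le> t"
  shows "x s < y s \<Longrightarrow> x t < y t" and "x s \<le> y s \<Longrightarrow> x t \<le> y t"
proof -
  obtain K1 where K1: "\<And>l. l \<in> {s..t} \<Longrightarrow> \<bar>x l\<bar> \<le> K1" by (rule ac_derivative_bounded_on_interval[OF x], rule that)
  obtain K2 where K2: "\<And>l. l \<in> {s..t} \<Longrightarrow> \<bar>y l\<bar> \<le> K2" by (rule ac_derivative_bounded_on_interval[OF y], rule that)
  obtain L where L: "AE l in lebesgue. \<forall>x y. \<bar>x\<bar> \<le> max K1 K2 \<longrightarrow> \<bar>y\<bar> \<le> max K1 K2 \<longrightarrow>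
     \<bar>g l x - g l y\<bar> \<le> L * \<bar>x - y\<bar>"
    using lip unfolding locally_lipschitz_def by blast
  have bnd: "AE l in lebesgue. l \<in> {s..t} \<longrightarrow> g l (y l) - g l (x l) \<ge> - L * \<bar>y l - x l\<bar>"
    using L
  proof eventually_elim
    case (elim l)
    show ?case
    proof
      assume "l \<in> {s..t}"
      then have "\<bar>g l (y l) - g l (x l)\<bar> \<le> L * \<bar>y l - x l\<bar>"
        using K1[of l] K2[of l] by (intro elim[rule_format]) auto
      then show "g l (y l) - g l (x l) \<ge> - L * \<bar>y l - x l\<bar>" by simp
    qed
  qed
  show "x t < y t" if "x s < y s"
  proof -
    have "AE l in lebesgue. l \<in> {s..t} \<longrightarrow> y l - x l > 0 \<longrightarrow> q l - p l \<ge> - L * (y l - x l)"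
      using xp yq bnd by eventually_elim auto
    then have "y t - x t \<ge> exp (- L * (t - s)) * (y s - x s)"
      using that by (intro positive_forward[OF ac_derivative_diff[OF y x] st]) auto
    moreover have "exp (- L * (t - s)) * (y s - x s) > 0" using that by simp
    ultimately show ?thesis by linarith
  qed
  show "x t \<le> y t" if "x s \<le> y s"
  proof -
    have "AE l in lebesgue. l \<in> {s..t} \<longrightarrow> x l - y l > 0 \<longrightarrow> p l - q l \<le> L * (x l - y l)"
      using xp yq bnd by eventually_elim auto
    from barrier_forward[OF ac_derivative_diff[OF x y] st _ this] that
    show ?thesis by simp
  qed
qed

section \<open>Existence of solutions\<close>

definition locally_bounded :: "(real \<Rightarrow> real \<Rightarrow> real) \<Rightarrow> bool" where
  "locally_bounded g \<longleftrightarrow> (\<forall>K. \<exists>m. AE t in lebesgue. \<forall>x. \<bar>x\<bar> \<le> K \<longrightarrow> \<bar>g t x\<bar> \<le> m)"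

lemma bounded_measurable_absolutely_integrable:
  fixes \<phi> :: "real \<Rightarrow> real"
  assumes "\<phi> \<in> borel_measurable lebesgue" and "AE t in lebesgue. t \<in> {a..b} \<longrightarrow> \<bar>\<phi> t\<bar> \<le> m"
  shows "\<phi> absolutely_integrable_on {a..b}"
  unfolding set_integrable_def
  by (rule integrableI_bounded_set_indicator[where B = m]) (use assms in \<open>auto simp: emeasure_lborel_Icc_eq\<close>)

lemma superposition_measurable:
  assumes "case_prod F \<in> borel_measurable (borel :: (real \<times> real) measure)"
    and "x \<in> borel_measurable borel"
  shows "(\<lambda>t. F t (x t) :: real) \<in> borel_measurable lebesgue"
proof -
  have "(\<lambda>t. (t, x t)) \<in> borel_measurable borel"
    using assms(2) by (intro borel_measurable_Pair) auto
  from measurable_compose[OF this assms(1)] have "(\<lambda>t. F t (x t)) \<in> borel_measurable borel"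
    by simp
  then show ?thesis by (intro measurable_completion) simp
qed

lemma ac_derivative_smooth:
  assumes der: "\<And>t. (w has_real_derivative p t) (at t)" and p: "continuous_on UNIV p"
  shows "ac_derivative UNIV w p"
  unfolding ac_derivative_def
proof (intro conjI allI impI)
  fix a b :: real
  have "bounded (p ` {a..b})"
    by (intro compact_imp_bounded compact_continuous_image continuous_on_subset[OF p]) auto
  then obtain C where C: "\<forall>v\<in>p ` {a..b}. norm v \<le> C" unfolding bounded_iff ..
  show "abs_continuous_on {a..b} w"
  proof (rule lipschitz_imp_abs_continuous_on[of _ _ C])
    fix u v assume uv: "u \<in> {a..b}" "v \<in> {a..b}" "u \<le> v"
    have "norm (w v - w u) \<le> C * norm (v - u)"
    proof (rule field_differentiable_bound[of "{a..b}"])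
      show "(w has_field_derivative p z) (at z within {a..b})" for z
        using der by (rule has_field_derivative_at_within)
    qed (use C uv in auto)
    then show "\<bar>w v - w u\<bar> \<le> C * (v - u)" using uv by simp
  qed
qed (use der in auto)

text \<open>The oriented integral: one of the two intervals has at most one point and contributes
  0.\<close>

definition signed_integral :: "real \<Rightarrow> (real \<Rightarrow> real) \<Rightarrow> real \<Rightarrow> real" where
  "signed_integral s \<phi> t = integral {s..t} \<phi> - integral {t..s} \<phi>"

lemma signed_integral_same [simp]: "signed_integral s \<phi> s = 0"
  by (simp add: signed_integral_def)

lemma signed_integral_diff:
  assumes int: "\<And>a b. \<phi> integrable_on {a..b}" and uv: "u \<le> v"
  shows "signed_integral s \<phi> v - signed_integral s \<phi> u = integral {u..v} \<phi>"
proof -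
  note comb = Henstock_Kurzweil_Integration.integral_combine[OF _ _ int]
  have triv: "integral {a..b} \<phi> = 0" if "b \<le> a" for a b
    using that by (cases "a = b") auto
  consider "v \<le> s" | "u \<le> s" "s \<le> v" | "s \<le> u" using uv by linarith
  then show ?thesis
  proof cases
    case 1
    then show ?thesis
      using comb[of u v s] uv triv[of v s] triv[of u s] by (simp add: signed_integral_def)
  next
    case 2
    then show ?thesis
      using comb[of u s v] uv triv[of s v] triv[of u s] by (simp add: signed_integral_def)
  next
    case 3
    then show ?thesis
      using comb[of s u v] uv triv[of s v] triv[of s u] by (simp add: signed_integral_def)
  qed
qed

text \<open>The bound on \<open>\<phi>\<close> makes the primitive Lipschitz. Differentiability
  almost everywhere is taken from the intervals \<open>[-n, n]\<close>, and their exceptional sets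
  are united.\<close>

lemma ac_derivative_signed_integral:
  assumes meas: "\<phi> \<in> borel_measurable lebesgue" and bnd: "AE t in lebesgue. \<bar>\<phi> t\<bar> \<le> m"
  shows "ac_derivative UNIV (\<lambda>t. c + signed_integral s \<phi> t) \<phi>"
  unfolding ac_derivative_def
proof (intro conjI allI impI)
  have abs: "\<phi> absolutely_integrable_on {a..b}" for a b
  proof (rule bounded_measurable_absolutely_integrable[OF meas])
    show "AE t in lebesgue. t \<in> {a..b} \<longrightarrow> \<bar>\<phi> t\<bar> \<le> m" using bnd by eventually_elim simp
  qed
  then have int: "\<phi> integrable_on {a..b}" for a b
    by (simp add: absolutely_integrable_on_def)
  note diff = signed_integral_diff[OF int]
  {
    fix a b :: real
    define N where "N = {t. \<not> \<bar>\<phi> t\<bar> \<le> m}"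
    have N: "negligible N" using bnd by (simp add: AE_lebesgue_iff_negligible N_def)
    have m: "m \<ge> 0"
    proof (rule ccontr)
      assume "\<not> m \<ge> 0"
      then have "N = UNIV" by (auto simp: N_def)
      then show False using N by simp
    qed
    show "abs_continuous_on {a..b} (\<lambda>t. c + signed_integral s \<phi> t)"
    proof (rule lipschitz_imp_abs_continuous_on[of _ _ m])
      fix u v :: real assume uv: "u \<le> v"
      have "norm (integral (cbox u v) (\<lambda>t. if t \<in> N then 0 else \<phi> t)) \<le> m * measure lborel (cbox u v)"
      proof (rule has_integral_bound[OF m, of "\<lambda>t. if t \<in> N then 0 else \<phi> t"])
        show "((\<lambda>t. if t \<in> N then 0 else \<phi> t) has_integral
            integral (cbox u v) (\<lambda>t. if t \<in> N then 0 else \<phi> t)) (cbox u v)"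
          by (rule integrable_integral, rule integrable_spike[OF _ N, of \<phi>]) (use int[of u v] in auto)
      qed (use m in \<open>auto simp: N_def\<close>)
      moreover have "integral (cbox u v) (\<lambda>t. if t \<in> N then 0 else \<phi> t) = integral (cbox u v) \<phi>"
        by (rule integral_spike[OF N]) auto
      ultimately show "\<bar>c + signed_integral s \<phi> v - (c + signed_integral s \<phi> u)\<bar> \<le> m * (v - u)"
        using diff[OF uv, of s] uv by simp
    qed
  }
  define B where "B n = {t \<in> {- real n<..<real n}.
      \<not> ((\<lambda>u. integral {- real n..u} \<phi>) has_real_derivative \<phi> t) (at t)}" for n
  have B: "negligible (B n)" for n
    unfolding B_def by (rule negligible_nondifferentiable_integral[OF int])
  have "{t. \<not> (t \<in> UNIV \<longrightarrow> ((\<lambda>t. c + signed_integral s \<phi> t) has_real_derivative \<phi> t) (at t))} \<subseteq> (\<Union>n. B n)"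
  proof
    fix t assume t: "t \<in> {t. \<not> (t \<in> UNIV \<longrightarrow> ((\<lambda>t. c + signed_integral s \<phi> t) has_real_derivative \<phi> t) (at t))}"
    obtain n where n: "\<bar>t\<bar> < real n" using reals_Archimedean2 by blast
    have "t \<in> B n"
    proof (rule ccontr)
      assume "t \<notin> B n"
      then have "((\<lambda>u. integral {- real n..u} \<phi>) has_real_derivative \<phi> t) (at t)"
        using n by (auto simp: B_def)
      \<comment> \<open>To the right of \<open>- n\<close> the two primitives differ by a constant
        only.\<close>
      then have "((\<lambda>u. c + signed_integral s \<phi> (- real n) + integral {- real n..u} \<phi>) has_real_derivative \<phi> t) (at t)"
        by (auto intro!: derivative_eq_intros)
      then have "((\<lambda>t. c + signed_integral s \<phi> t) has_real_derivative \<phi> t) (at t)"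
      proof (rule has_field_derivative_transform_within_open[of _ _ _ "{- real n<..}"])
        show "c + signed_integral s \<phi> (- real n) + integral {- real n..u} \<phi> = c + signed_integral s \<phi> u"
          if "u \<in> {- real n<..}" for u
          using diff[of "- real n" u s] that by auto
      qed (use n in auto)
      then show False using t by simp
    qed
    then show "t \<in> (\<Union>n. B n)" by blast
  qed
  then show "AE t in lebesgue. t \<in> UNIV \<longrightarrow> ((\<lambda>t. c + signed_integral s \<phi> t) has_real_derivative \<phi> t) (at t)"
    unfolding AE_lebesgue_iff_negligible by (rule negligible_subset[OF negligible_Union_nat[OF B]])
qed

text \<open>Picard iteration in the weighted norm \<open>sup exp (- 2 L \<bar>t - s\<bar>) \<bar>x t - x0\<bar>\<close>, in which the
  integral operator is a contraction on the whole line at once.\<close>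

lemma global_solution_lipschitz:
  assumes meas: "case_prod F \<in> borel_measurable (borel :: (real \<times> real) measure)"
    and bnd: "AE t in lebesgue. \<forall>x. \<bar>F t x\<bar> \<le> m"
    and lip: "AE t in lebesgue. \<forall>x y. \<bar>F t x - F t y\<bar> \<le> L * \<bar>x - y\<bar>"
    and L: "L > 0"
  obtains x where "x s = x0" "ac_derivative UNIV x (\<lambda>t. F t (x t))"
proof -
  \<comment> \<open>The rate is twice the Lipschitz constant: the integral of
    \<open>L * exp (2 * L * u)\<close> is at most half of the final exponential, which yields the
    contraction factor 1/2.\<close>
  define E where "E t = exp (2 * L * \<bar>t - s\<bar>)" for t
  have E: "E t > 0" for t by (simp add: E_def)
  have contE: "continuous_on UNIV E" unfolding E_def by (intro continuous_intros)
  \<comment> \<open>The unknown is the weighted deviation \<open>v = (x - x0) / E\<close>, so the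
    supremum metric of bounded continuous functions is the weighted one for
    \<open>x\<close>.\<close>
  define \<phi> where "\<phi> v l = F l (x0 + E l * apply_bcontfun v l)" for v l
  have measphi: "\<phi> v \<in> borel_measurable lebesgue" for v
    unfolding \<phi>_def
    by (intro superposition_measurable[OF meas] borel_measurable_continuous_onI continuous_intros contE
        continuous_on_apply_bcontfun)
  have bndphi: "AE t in lebesgue. \<bar>\<phi> v t\<bar> \<le> m" for v
    using bnd by eventually_elim (simp add: \<phi>_def)
  note J = ac_derivative_signed_integral[OF measphi bndphi, of 0 s, simplified]
  define G where "G v t = signed_integral s (\<phi> v) t / E t" for v t
  have J_bound: "\<bar>signed_integral s (\<phi> v) t\<bar> \<le> m * \<bar>t - s\<bar>" for v t
  proof (cases "s \<le> t")
    case True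
    have "\<bar>signed_integral s (\<phi> v) t - signed_integral s (\<phi> v) s\<bar> \<le> m * (t - s)"
    proof (rule ac_derivative_bound[OF J _ True])
      show "AE l in lebesgue. l \<in> {s..t} \<longrightarrow> \<bar>\<phi> v l\<bar> \<le> m"
        using bndphi[of v] by eventually_elim simp
    qed simp
    then show ?thesis using True by simp
  next
    case False
    then have ts: "t \<le> s" by simp
    have "\<bar>signed_integral s (\<phi> v) s - signed_integral s (\<phi> v) t\<bar> \<le> m * (s - t)"
    proof (rule ac_derivative_bound[OF J _ ts])
      show "AE l in lebesgue. l \<in> {t..s} \<longrightarrow> \<bar>\<phi> v l\<bar> \<le> m"
        using bndphi[of v] by eventually_elim simp
    qed simp
    then show ?thesis using ts by simp
  qed
  have contJ: "continuous_on UNIV (signed_integral s (\<phi> v))" for v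
  proof -
    have "continuous (at t) (signed_integral s (\<phi> v))" for t
    proof -
      have "continuous_on {t - 1..t + 1} (signed_integral s (\<phi> v))"
        by (rule ac_derivative_continuous_on[OF J]) simp
      then show ?thesis by (rule continuous_on_interior) simp
    qed
    then show ?thesis by (simp add: continuous_on_eq_continuous_at)
  qed
  have Gb: "G v \<in> bcontfun" for v
  proof (rule bcontfun_normI)
    show "continuous_on UNIV (G v)"
      unfolding G_def using E by (intro continuous_intros contJ contE) (auto simp: less_imp_neq[symmetric] intro: less_imp_neq[symmetric])
    fix t
    have "2 * L * \<bar>t - s\<bar> \<le> E t"
      unfolding E_def using exp_ge_add_one_self[of "2 * L * \<bar>t - s\<bar>"] by linarith
    then have "\<bar>t - s\<bar> \<le> E t / (2 * L)" using L by (simp add: field_simps)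
    then have "\<bar>m\<bar> * \<bar>t - s\<bar> \<le> \<bar>m\<bar> * (E t / (2 * L))" by (intro mult_left_mono) auto
    moreover have "m * \<bar>t - s\<bar> \<le> \<bar>m\<bar> * \<bar>t - s\<bar>" by (intro mult_right_mono) auto
    ultimately have "\<bar>signed_integral s (\<phi> v) t\<bar> \<le> \<bar>m\<bar> * (E t / (2 * L))"
      using J_bound[of v t] by linarith
    then show "norm (G v t) \<le> \<bar>m\<bar> / (2 * L)"
      using E[of t] by (simp add: G_def field_simps)
  qed
  define T where "T v = Bcontfun (G v)" for v
  have T: "apply_bcontfun (T v) = G v" for v
    unfolding T_def by (rule Bcontfun_inverse[OF Gb])
  \<comment> \<open>An upper bound suffices, since \<open>v\<close> and \<open>w\<close> may be
    exchanged.\<close>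
  have one_side: "signed_integral s (\<phi> v) t - signed_integral s (\<phi> w) t \<le> dist v w / 2 * E t" for v w t
  proof -
    let ?J = "\<lambda>t. signed_integral s (\<phi> v) t - signed_integral s (\<phi> w) t"
    have acJ: "ac_derivative UNIV ?J (\<lambda>t. \<phi> v t - \<phi> w t)" by (rule ac_derivative_diff[OF J J])
    have pw: "AE l in lebesgue. \<bar>\<phi> v l - \<phi> w l\<bar> \<le> L * E l * dist v w"
      using lip
    proof eventually_elim
      case (elim l)
      have "\<bar>\<phi> v l - \<phi> w l\<bar> \<le> L * \<bar>E l * apply_bcontfun v l - E l * apply_bcontfun w l\<bar>"
        using elim[rule_format, of "x0 + E l * apply_bcontfun v l" "x0 + E l * apply_bcontfun w l"]
        by (simp add: \<phi>_def)
      also have "\<dots> = L * (E l * dist (apply_bcontfun v l) (apply_bcontfun w l))"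
        using E[of l] by (simp add: right_diff_distrib[symmetric] abs_mult dist_real_def)
      also have "\<dots> \<le> L * (E l * dist v w)"
        using L E[of l] by (intro mult_left_mono dist_bounded) auto
      finally show ?case by (simp add: mult.assoc)
    qed
    show ?thesis
    proof (cases "s \<le> t")
      case True
      have ac: "ac_derivative UNIV (\<lambda>t. dist v w / 2 * exp (2 * L * (t - s))) (\<lambda>t. dist v w * L * exp (2 * L * (t - s)))"
        by (rule ac_derivative_smooth) (auto intro!: derivative_eq_intros continuous_intros)
      have "?J t - ?J s \<le> dist v w / 2 * exp (2 * L * (t - s)) - dist v w / 2 * exp (2 * L * (s - s))"
      proof (rule ac_derivative_le[OF acJ ac _ True])
        show "AE l in lebesgue. l \<in> {s..t} \<longrightarrow> \<phi> v l - \<phi> w l \<le> dist v w * L * exp (2 * L * (l - s))"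
          using pw by eventually_elim (auto simp: E_def abs_le_iff mult_ac)
      qed simp
      then have "?J t \<le> dist v w / 2 * exp (2 * L * (t - s)) - dist v w / 2" by simp
      then have "?J t \<le> dist v w / 2 * exp (2 * L * (t - s))" using zero_le_dist[of v w] by linarith
      then show ?thesis using True by (simp add: E_def)
    next
      case False
      then have ts: "t \<le> s" by simp
      have ac: "ac_derivative UNIV (\<lambda>t. dist v w / 2 * exp (2 * L * (s - t))) (\<lambda>t. - dist v w * L * exp (2 * L * (s - t)))"
        by (rule ac_derivative_smooth) (auto intro!: derivative_eq_intros continuous_intros)
      have "dist v w / 2 * exp (2 * L * (s - s)) - dist v w / 2 * exp (2 * L * (s - t)) \<le> ?J s - ?J t"
      proof (rule ac_derivative_le[OF ac acJ _ ts])
        show "AE l in lebesgue. l \<in> {t..s} \<longrightarrow> - dist v w * L * exp (2 * L * (s - l)) \<le> \<phi> v l - \<phi> w l"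
          using pw by eventually_elim (auto simp: E_def abs_le_iff mult_ac)
      qed simp
      then have "?J t \<le> dist v w / 2 * exp (2 * L * (s - t)) - dist v w / 2" by simp
      then have "?J t \<le> dist v w / 2 * exp (2 * L * (s - t))" using zero_le_dist[of v w] by linarith
      then show ?thesis using ts by (simp add: E_def)
    qed
  qed
  have "\<exists>!v. T v = v"
  proof (rule banach_fix_type[of "1/2"], simp, simp, intro allI)
    fix v w :: "real \<Rightarrow>\<^sub>C real"
    show "dist (T v) (T w) \<le> 1 / 2 * dist v w"
    proof (rule dist_bound)
      fix t
      have "\<bar>signed_integral s (\<phi> v) t - signed_integral s (\<phi> w) t\<bar> \<le> dist v w / 2 * E t"
        using one_side[of v t w] one_side[of w t v] unfolding dist_commute[of w v] by linarith
      then have "\<bar>(signed_integral s (\<phi> v) t - signed_integral s (\<phi> w) t) / E t\<bar> \<le> 1 / 2 * dist v w"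
        using E[of t] by (simp add: abs_divide pos_divide_le_eq)
      then show "dist (apply_bcontfun (T v) t) (apply_bcontfun (T w) t) \<le> 1 / 2 * dist v w"
        by (simp add: T G_def dist_real_def diff_divide_distrib)
    qed
  qed
  then obtain v where v: "T v = v" by blast
  define x where "x t = x0 + E t * apply_bcontfun v t" for t
  have x_eq: "x t = x0 + signed_integral s (\<phi> v) t" for t
    using T[of v] E[of t] by (simp add: v x_def G_def)
  have "ac_derivative UNIV (\<lambda>t. x0 + signed_integral s (\<phi> v) t) (\<phi> v)"
    by (rule ac_derivative_signed_integral[OF measphi bndphi])
  moreover have "(\<lambda>t. x0 + signed_integral s (\<phi> v) t) = x" using x_eq by auto
  moreover have "\<phi> v = (\<lambda>t. F t (x t))" by (auto simp: \<phi>_def x_def)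
  ultimately have "ac_derivative UNIV x (\<lambda>t. F t (x t))" by simp
  moreover have "x s = x0" by (simp add: x_eq)
  ultimately show thesis by (intro that)
qed

text \<open>Clamping the state turns local bounds into global ones, which gives global solutions. A
  solution that stays in \<open>[-K, K]\<close> does not notice the change.\<close>

definition truncate :: "real \<Rightarrow> real \<Rightarrow> real" where
  "truncate K x = max (- K) (min K x)"

lemma truncate_id: "\<bar>x\<bar> \<le> K \<Longrightarrow> truncate K x = x"
  by (auto simp: truncate_def)

lemma abs_truncate_le: "K \<ge> 0 \<Longrightarrow> \<bar>truncate K x\<bar> \<le> K"
  by (auto simp: truncate_def)

lemma truncate_lipschitz: "\<bar>truncate K x - truncate K y\<bar> \<le> \<bar>x - y\<bar>"
  by (auto simp: truncate_def min_def max_def)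

lemma locally_lipschitz_truncate:
  assumes "locally_lipschitz f" and "K \<ge> 0"
  shows "\<exists>L>0. AE t in lebesgue. \<forall>x y. \<bar>f t (truncate K x) - f t (truncate K y)\<bar> \<le> L * \<bar>x - y\<bar>"
proof -
  obtain L where L: "AE t in lebesgue. \<forall>x y. \<bar>x\<bar> \<le> K \<longrightarrow> \<bar>y\<bar> \<le> K \<longrightarrow> \<bar>f t x - f t y\<bar> \<le> L * \<bar>x - y\<bar>"
    using assms(1) unfolding locally_lipschitz_def by blast
  have "AE t in lebesgue. \<forall>x y. \<bar>f t (truncate K x) - f t (truncate K y)\<bar> \<le> (\<bar>L\<bar> + 1) * \<bar>x - y\<bar>"
    using L
  proof eventually_elim
    case (elim t)
    show ?case
    proof (intro allI)
      fix x y
      have "\<bar>f t (truncate K x) - f t (truncate K y)\<bar> \<le> L * \<bar>truncate K x - truncate K y\<bar>"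
        using elim abs_truncate_le[OF assms(2)] by blast
      also have "\<dots> \<le> (\<bar>L\<bar> + 1) * \<bar>x - y\<bar>"
        by (intro mult_mono truncate_lipschitz) auto
      finally show "\<bar>f t (truncate K x) - f t (truncate K y)\<bar> \<le> (\<bar>L\<bar> + 1) * \<bar>x - y\<bar>" .
    qed
  qed
  then show ?thesis by (intro exI[of _ "\<bar>L\<bar> + 1"]) auto
qed

lemma global_solution_truncate:
  assumes meas: "case_prod f \<in> borel_measurable (borel :: (real \<times> real) measure)"
    and bnd: "locally_bounded f" and lip: "locally_lipschitz f" and K: "K \<ge> 0"
  obtains x where "x s = x0" "ac_derivative UNIV x (\<lambda>t. f t (truncate K (x t)))"
proof -
  obtain m where m: "AE t in lebesgue. \<forall>x. \<bar>x\<bar> \<le> K \<longrightarrow> \<bar>f t x\<bar> \<le> m"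
    using bnd unfolding locally_bounded_def by blast
  obtain L where L: "L > 0" "AE t in lebesgue. \<forall>x y. \<bar>f t (truncate K x) - f t (truncate K y)\<bar> \<le> L * \<bar>x - y\<bar>"
    using locally_lipschitz_truncate[OF lip K] by blast
  have "truncate K \<in> borel_measurable borel" unfolding truncate_def[abs_def] by measurable
  then have "(\<lambda>(t, x). (t, truncate K x)) \<in> borel_measurable (borel :: (real \<times> real) measure)"
    unfolding borel_prod[symmetric] by measurable
  from measurable_compose[OF this meas]
  have "case_prod (\<lambda>t x. f t (truncate K x)) \<in> borel_measurable borel"
    by (simp add: case_prod_unfold)
  moreover have "AE t in lebesgue. \<forall>x. \<bar>f t (truncate K x)\<bar> \<le> m"
    using m by eventually_elim (use abs_truncate_le[OF K] in blast)
  ultimately show thesis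
    by (rule global_solution_lipschitz[OF _ _ L(2,1), of m s x0]) (rule that)
qed

section \<open>Order, trapping and uniqueness of solutions\<close>

definition caratheodory :: "(real \<Rightarrow> real \<Rightarrow> real) \<Rightarrow> bool" where
  "caratheodory g \<longleftrightarrow> case_prod g \<in> borel_measurable (borel :: (real \<times> real) measure) \<and>
     locally_bounded g \<and> locally_lipschitz g"

abbreviation global_solution :: "(real \<Rightarrow> real \<Rightarrow> real) \<Rightarrow> (real \<Rightarrow> real) \<Rightarrow> bool" where
  "global_solution g x \<equiv> ac_derivative UNIV x (\<lambda>t. g t (x t))"

text \<open>The backward direction is the weak forward comparison with the roles exchanged.\<close>

lemma solutions_less_iff:
  assumes lip: "locally_lipschitz g" and st: "s \<le> t"
    and x: "ac_derivative {s..t} x (\<lambda>t. g t (x t))" and y: "ac_derivative {s..t} y (\<lambda>t. g t (y t))"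
  shows "x s < y s \<longleftrightarrow> x t < y t"
proof
  show "x s < y s \<Longrightarrow> x t < y t" by (rule compare_solutions(1)[OF lip x y _ _ st]) auto
  show "x s < y s" if "x t < y t"
  proof (rule ccontr)
    assume "\<not> x s < y s"
    then have "y t \<le> x t" by (intro compare_solutions(2)[OF lip y x _ _ st]) auto
    with that show False by simp
  qed
qed

lemma solutions_eq_iff:
  assumes lip: "locally_lipschitz g" and st: "s \<le> t"
    and x: "ac_derivative {s..t} x (\<lambda>t. g t (x t))" and y: "ac_derivative {s..t} y (\<lambda>t. g t (y t))"
  shows "x s = y s \<longleftrightarrow> x t = y t"
  using solutions_less_iff[OF lip st x y] solutions_less_iff[OF lip st y x] by linarith

lemma global_solutions_less:
  assumes lip: "locally_lipschitz g" and x: "global_solution g x" and y: "global_solution g y"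
    and "x s < y s"
  shows "x t < y t"
  using solutions_less_iff[OF lip _ ac_derivative_subset[OF x] ac_derivative_subset[OF y], of s t]
    solutions_less_iff[OF lip _ ac_derivative_subset[OF x] ac_derivative_subset[OF y], of t s] assms(4)
  by (cases "s \<le> t") auto

lemma global_solutions_le:
  assumes lip: "locally_lipschitz g" and x: "global_solution g x" and y: "global_solution g y"
    and "x s \<le> y s"
  shows "x t \<le> y t"
  using global_solutions_less[OF lip y x, of t s] assms(4) by linarith

lemma locally_lipschitz_truncated:
  assumes "locally_lipschitz g" and "K \<ge> 0"
  shows "locally_lipschitz (\<lambda>t x. g t (truncate K x))"
proof -
  obtain L where "AE t in lebesgue. \<forall>x y. \<bar>g t (truncate K x) - g t (truncate K y)\<bar> \<le> L * \<bar>x - y\<bar>"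
    using locally_lipschitz_truncate[OF assms] by blast
  then have "AE t in lebesgue. \<forall>x y. \<bar>x\<bar> \<le> K' \<longrightarrow> \<bar>y\<bar> \<le> K' \<longrightarrow>
      \<bar>g t (truncate K x) - g t (truncate K y)\<bar> \<le> L * \<bar>x - y\<bar>" for K'
    by eventually_elim blast
  then show ?thesis unfolding locally_lipschitz_def by blast
qed

text \<open>Both barriers also solve the equation truncated at \<open>K\<close>. Comparison with
  them confines the truncated solution to the region where the truncation is the identity.\<close>

lemma solution_between:
  assumes g: "caratheodory g" and l: "global_solution g l" and u: "global_solution g u"
    and K: "\<And>t. \<bar>l t\<bar> \<le> K" "\<And>t. \<bar>u t\<bar> \<le> K" and s: "l s \<le> x0" "x0 \<le> u s"
  obtains x where "x s = x0" "global_solution g x" "\<And>t. l t \<le> x t" "\<And>t. x t \<le> u t"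
proof -
  let ?F = "\<lambda>t x. g t (truncate K x)"
  have K0: "K \<ge> 0" using K(1)[of 0] by linarith
  obtain x where x: "x s = x0" "global_solution ?F x"
    using g unfolding caratheodory_def by (metis global_solution_truncate[OF _ _ _ K0])
  have lipF: "locally_lipschitz ?F"
    using g K0 by (intro locally_lipschitz_truncated) (simp_all add: caratheodory_def)
  have lF: "global_solution ?F l" and uF: "global_solution ?F u"
    using l u K by (simp_all add: truncate_id)
  have lx: "l t \<le> x t" for t
    by (rule global_solutions_le[OF lipF lF x(2), of s]) (use x(1) s in simp)
  have xu: "x t \<le> u t" for t
    by (rule global_solutions_le[OF lipF x(2) uF, of s]) (use x(1) s in simp)
  have "\<bar>x t\<bar> \<le> K" for t
    using lx[of t] xu[of t] K(1)[of t] K(2)[of t] by linarith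
  then have "global_solution g x" using x(2) by (simp add: truncate_id)
  with x(1) lx xu show thesis by (intro that)
qed

lemma global_solution_maximal: "global_solution g x \<Longrightarrow> maximal_solution g UNIV x"
  unfolding maximal_solution_def solution_iff_ac_derivative by auto

lemma solution_unique:
  assumes lip: "locally_lipschitz g" and x: "solution g I x" and y: "solution g J y"
    and s: "s \<in> I" "s \<in> J" "x s = y s" and t: "t \<in> I" "t \<in> J"
  shows "x t = y t"
proof -
  have I: "is_interval I" "ac_derivative I x (\<lambda>t. g t (x t))"
    and J: "is_interval J" "ac_derivative J y (\<lambda>t. g t (y t))"
    using x y by (simp_all add: solution_iff_ac_derivative)
  have sub: "{u..v} \<subseteq> I \<and> {u..v} \<subseteq> J" if "u \<in> I" "u \<in> J" "v \<in> I" "v \<in> J" for u v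
    using mem_is_interval_1_I[OF I(1) that(1,3)] mem_is_interval_1_I[OF J(1) that(2,4)]
    by (simp add: subset_iff)
  show ?thesis
  proof (cases "s \<le> t")
    case True
    from sub[OF s(1,2) t] solutions_eq_iff[OF lip True ac_derivative_subset[OF I(2)] ac_derivative_subset[OF J(2)]] s(3)
    show ?thesis by simp
  next
    case False
    then have ts: "t \<le> s" by simp
    from sub[OF t s(1,2)] solutions_eq_iff[OF lip ts ac_derivative_subset[OF I(2)] ac_derivative_subset[OF J(2)]] s(3)
    show ?thesis by simp
  qed
qed

text \<open>The two agree on \<open>I\<close>, so the global solution extends \<open>y\<close>, and
  maximality forces \<open>I\<close> to be the whole line. This is what makes the definite
  description in \<open>sol_value\<close> meaningful.\<close>

lemma maximal_solution_unique:
  assumes lip: "locally_lipschitz g" and x: "global_solution g x"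
    and y: "maximal_solution g I y" and s: "s \<in> I" "y s = x s"
  shows "I = UNIV" and "y = x"
proof -
  have sx: "solution g UNIV x" using x by (simp add: solution_iff_ac_derivative)
  have sy: "solution g I y" using y by (simp add: maximal_solution_def)
  have eq: "x t = y t" if "t \<in> I" for t
    using solution_unique[OF lip sx sy _ s(1) s(2)[symmetric] _ that] by simp
  show I: "I = UNIV"
    using y sx eq unfolding maximal_solution_def by blast
  show "y = x" using eq I by auto
qed

lemma sol_value_global_solution:
  assumes lip: "locally_lipschitz g" and x: "global_solution g x"
  shows "sol_value g t s (x s) = x t"
  unfolding sol_value_def
proof (rule the_equality)
  show "\<exists>I y. maximal_solution g I y \<and> s \<in> I \<and> y s = x s \<and> t \<in> I \<and> y t = x t"
    using global_solution_maximal[of x g] x by blast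
  fix v assume "\<exists>I y. maximal_solution g I y \<and> s \<in> I \<and> y s = x s \<and> t \<in> I \<and> y t = v"
  then show "v = x t" using maximal_solution_unique(2)[OF lip x] by blast
qed

section \<open>The gap at minus infinity\<close>

text \<open>The slope inequality at three points, multiplied out; unlike \<open>admissible\<close> below it does not
  mention \<open>g\<^sub>x\<close> and is preserved by \<open>(t, x) \<mapsto> (-t, -x)\<close>.\<close>

definition chord_concave :: "(real \<Rightarrow> real \<Rightarrow> real) \<Rightarrow> bool" where
  "chord_concave g \<longleftrightarrow> (\<forall>K. AE t in lebesgue. \<forall>p q s. - K \<le> p \<and> p < q \<and> q < s \<and> s \<le> K \<longrightarrow>
     (g t s - g t q) * (q - p) \<le> (g t q - g t p) * (s - q))"

text \<open>The deficit \<open>v = \<kappa> / L - w\<close> satisfies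
  \<open>v' \<le> - L * v\<close>. Once positive it grows exponentially backwards in time, while
  \<open>w \<ge> 0\<close> caps it at \<open>\<kappa> / L\<close>.\<close>

lemma backward_lower_bound:
  assumes w: "ac_derivative {..S} w p" and nonneg: "\<And>t. t \<le> S \<Longrightarrow> w t \<ge> 0"
    and p: "AE t in lebesgue. t \<le> S \<longrightarrow> p t \<ge> \<kappa> - L * w t" and L: "L > 0" and \<kappa>: "\<kappa> > 0" and t: "t \<le> S"
  shows "w t \<ge> \<kappa> / L"
proof (rule ccontr)
  assume "\<not> w t \<ge> \<kappa> / L"
  define v where "v t = \<kappa> / L - w t" for t
  have vt: "v t > 0" using \<open>\<not> w t \<ge> \<kappa> / L\<close> by (simp add: v_def)
  \<comment> \<open>So far back that already the linear lower bound of the exponential gives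
    \<open>(1 + L * (t - s)) * v t = v t + \<kappa> / L\<close>, beyond the cap.\<close>
  define s where "s = t - \<kappa> / L / (L * v t)"
  have st: "s \<le> t" using vt L \<kappa> by (simp add: s_def)
  have v: "ac_derivative {..S} v (\<lambda>t. 0 - p t)"
    unfolding v_def[abs_def] by (rule ac_derivative_diff[OF ac_derivative_const w])
  have "v s \<ge> exp (- (- L) * (t - s)) * v t"
  proof (rule positive_backward[OF ac_derivative_subset[OF v] st vt])
    show "AE l in lebesgue. l \<in> {s..t} \<longrightarrow> v l > 0 \<longrightarrow> 0 - p l \<le> - L * v l"
      using p by eventually_elim (use t L in \<open>auto simp: v_def right_diff_distrib\<close>)
  qed (use t in auto)
  moreover have "exp (- (- L) * (t - s)) * v t > \<kappa> / L"
  proof -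
    have "1 + L * (t - s) \<le> exp (L * (t - s))" by (rule exp_ge_add_one_self)
    then have "(1 + L * (t - s)) * v t \<le> exp (- (- L) * (t - s)) * v t"
      using vt by simp
    moreover have "(1 + L * (t - s)) * v t = v t + \<kappa> / L"
      using vt L by (simp add: s_def field_simps)
    ultimately show ?thesis using vt by linarith
  qed
  moreover have "v s \<le> \<kappa> / L" using nonneg[of s] st t by (simp add: v_def)
  ultimately show False by linarith
qed

text \<open>If \<open>a s < c s\<close>, the solution through \<open>(s, c s)\<close> is trapped between \<open>a\<close> and \<open>c\<close> in the past and
  by coercivity in the future, which contradicts the maximality of \<open>a\<close>. If \<open>r \<ge> c\<close> throughout, then
  concavity bounds \<open>(a - r)' / (a - r)\<close> by \<open>(r - c)' / (r - c)\<close> minus a positive constant.\<close>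

lemma gap_at_minus_infinity:
  assumes g: "caratheodory g" and conc: "chord_concave g"
    and coer: "AE t in lebesgue. \<forall>x. \<bar>x\<bar> \<ge> K0 \<longrightarrow> g t x \<le> 0"
    and a: "global_solution g a" "\<And>t. \<bar>a t\<bar> \<le> M"
    and r: "global_solution g r" "\<And>t. \<bar>r t\<bar> \<le> M" and ra: "\<And>t. r t < a t"
    and max: "\<And>x t. global_solution g x \<Longrightarrow> bounded (range x) \<Longrightarrow> x t \<le> a t"
    and c: "ac_derivative {..S} c c'" "\<And>t. t \<le> S \<Longrightarrow> \<bar>c t\<bar> \<le> M"
    and c': "AE t in lebesgue. t \<le> S \<longrightarrow> c' t \<le> g t (c t) - \<kappa>" and \<kappa>: "\<kappa> > 0"
  shows "\<exists>\<epsilon>>0. \<exists>S'. \<forall>t\<le>S'. a t - r t \<ge> \<epsilon>"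
proof -
  have lip: "locally_lipschitz g" using g by (simp add: caratheodory_def)
  have M: "M > 0" using ra[of 0] a(2)[of 0] r(2)[of 0] by linarith
  have below: "c s \<le> a s" if s: "s \<le> S" for s
  proof (rule ccontr)
    assume "\<not> c s \<le> a s"
    define K where "K = Orderings.max M K0"
    have K: "K \<ge> 0" "M \<le> K" "K0 \<le> K" using M by (auto simp: K_def)
    let ?F = "\<lambda>t x. g t (truncate K x)"
    obtain x where x: "x s = c s" "global_solution ?F x"
      using g unfolding caratheodory_def by (metis global_solution_truncate[OF _ _ _ K(1)])
    have lipF: "locally_lipschitz ?F" by (rule locally_lipschitz_truncated[OF lip K(1)])
    have aK: "\<bar>a t\<bar> \<le> K" for t using a(2)[of t] K by linarith
    then have aF: "global_solution ?F a" using a(1) by (simp add: truncate_id)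
    have ax: "a t < x t" for t
      using global_solutions_less[OF lipF aF x(2), of s t] x(1) \<open>\<not> c s \<le> a s\<close> by simp
    have xK: "x t \<le> K" for t
    proof (cases "s \<le> t")
      case True
      \<comment> \<open>Above \<open>K\<close> the truncated field is evaluated at \<open>K\<close>,
        where coercivity makes it nonpositive because \<open>K \<ge> K0\<close>.\<close>
      have "x t - K \<le> 0"
      proof (rule barrier_forward[OF ac_derivative_diff[OF ac_derivative_subset[OF x(2)] ac_derivative_const] True])
        show "x s - K \<le> 0" using x(1) c(2)[OF s] K by linarith
        show "AE l in lebesgue. l \<in> {s..t} \<longrightarrow> x l - K > 0 \<longrightarrow> g l (truncate K (x l)) - 0 \<le> 0 * (x l - K)"
          using coer by eventually_elim (use K in \<open>auto simp: truncate_def\<close>)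
      qed simp
      then show ?thesis by simp
    next
      case False
      then have ts: "t \<le> s" by simp
      have "x t \<le> c t"
      proof (rule ccontr)
        assume "\<not> x t \<le> c t"
        have "c s < x s"
        proof (rule compare_solutions(1)[OF lipF ac_derivative_subset[OF c(1)] ac_derivative_subset[OF x(2)] _ _ ts])
          show "AE l in lebesgue. l \<in> {t..s} \<longrightarrow> c' l \<le> g l (truncate K (c l))"
            using c'
          proof eventually_elim
            case (elim l)
            show ?case
            proof
              assume "l \<in> {t..s}"
              then have "l \<le> S" using s by simp
              moreover have "\<bar>c l\<bar> \<le> K" using c(2)[OF \<open>l \<le> S\<close>] K by linarith
              ultimately show "c' l \<le> g l (truncate K (c l))" using elim \<kappa> by (simp add: truncate_id)
            qed
          qed
        qed (use s \<open>\<not> x t \<le> c t\<close> in auto)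
        then show False using x(1) by simp
      qed
      then show ?thesis using c(2)[of t] ts s K by linarith
    qed
    have absx: "\<bar>x t\<bar> \<le> K" for t
      using ax[of t] xK[of t] aK[of t] by linarith
    then have "global_solution g x" using x(2) by (simp add: truncate_id)
    moreover have "bounded (range x)" using absx by (auto simp: bounded_iff)
    ultimately have "x s \<le> a s" by (rule max)
    then show False using ax[of s] by simp
  qed
  obtain L0 where L0: "AE t in lebesgue. \<forall>x y. \<bar>x\<bar> \<le> M \<longrightarrow> \<bar>y\<bar> \<le> M \<longrightarrow> \<bar>g t x - g t y\<bar> \<le> L0 * \<bar>x - y\<bar>"
    using lip unfolding locally_lipschitz_def by blast
  define L where "L = \<bar>L0\<bar> + 1"
  have L: "L > 0" by (simp add: L_def)
  have Llip: "AE t in lebesgue. \<forall>x y. \<bar>x\<bar> \<le> M \<longrightarrow> \<bar>y\<bar> \<le> M \<longrightarrow> \<bar>g t x - g t y\<bar> \<le> L * \<bar>x - y\<bar>"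
    using L0
  proof eventually_elim
    case (elim t)
    show ?case
    proof (intro allI impI)
      fix x y :: real assume "\<bar>x\<bar> \<le> M" "\<bar>y\<bar> \<le> M"
      then have "\<bar>g t x - g t y\<bar> \<le> L0 * \<bar>x - y\<bar>" using elim by blast
      also have "\<dots> \<le> L * \<bar>x - y\<bar>" by (intro mult_right_mono) (auto simp: L_def)
      finally show "\<bar>g t x - g t y\<bar> \<le> L * \<bar>x - y\<bar>" .
    qed
  qed
  \<comment> \<open>For any bounded solution above \<open>c\<close>, strictness and the Lipschitz
    bound give \<open>(x - c)' \<ge> \<kappa> - L * (x - c)\<close>, the situation of
    \<open>backward_lower_bound\<close>.\<close>
  have gap: "x t - c t \<ge> \<kappa> / L"
    if x: "global_solution g x" "\<And>t. \<bar>x t\<bar> \<le> M" and cx: "\<And>t. t \<le> S \<Longrightarrow> c t \<le> x t" and t: "t \<le> S" for x t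
  proof (rule backward_lower_bound[OF ac_derivative_diff[OF ac_derivative_subset[OF x(1)] c(1)] _ _ L \<kappa> t])
    show "AE t in lebesgue. t \<le> S \<longrightarrow> \<kappa> - L * (x t - c t) \<le> g t (x t) - c' t"
      using c' Llip
    proof eventually_elim
      case (elim t)
      show ?case
      proof
        assume t: "t \<le> S"
        have "\<bar>g t (x t) - g t (c t)\<bar> \<le> L * \<bar>x t - c t\<bar>"
          using elim(2) x(2)[of t] c(2)[OF t] by blast
        moreover have "c' t \<le> g t (c t) - \<kappa>" using elim(1) t by blast
        moreover have "\<bar>x t - c t\<bar> = x t - c t" using cx[OF t] by simp
        ultimately show "\<kappa> - L * (x t - c t) \<le> g t (x t) - c' t" by (simp add: abs_le_iff)
      qed
    qed
  qed (use cx in auto)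
  \<comment> \<open>If \<open>r\<close> is below \<open>c\<close> at one time, it is so at all
    earlier times, since a solution that is above \<open>c\<close> stays above. Then
    \<open>a - r\<close> exceeds \<open>a - c\<close>, which is bounded below by
    \<open>gap\<close>.\<close>
  show ?thesis
  proof (cases "\<exists>s1\<le>S. r s1 < c s1")
    case True
    then obtain s1 where s1: "s1 \<le> S" "r s1 < c s1" by blast
    have "a t - r t \<ge> \<kappa> / L" if t: "t \<le> s1" for t
    proof -
      have "r t < c t"
      proof (rule ccontr)
        assume "\<not> r t < c t"
        have "c s1 \<le> r s1"
        proof (rule compare_solutions(2)[OF lip ac_derivative_subset[OF c(1)] ac_derivative_subset[OF r(1)] _ _ t])
          show "AE l in lebesgue. l \<in> {t..s1} \<longrightarrow> c' l \<le> g l (c l)"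
            using c' by eventually_elim (use s1 \<kappa> in auto)
        qed (use s1 \<open>\<not> r t < c t\<close> in auto)
        then show False using s1 by simp
      qed
      then show ?thesis using gap[OF a below, of t] t s1 by simp
    qed
    then show ?thesis using L \<kappa> by (intro exI[of _ "\<kappa> / L"]) auto
  next
    case False
    then have cr: "c t \<le> r t" if "t \<le> S" for t using that by force
    define w where "w t = r t - c t" for t
    define d where "d t = a t - r t" for t
    have w_ge: "w t \<ge> \<kappa> / L" if "t \<le> S" for t using gap[OF r cr that] by (simp add: w_def)
    have w_pos: "w t > 0" if "t \<le> S" for t
      using w_ge[OF that] L \<kappa> by (meson divide_pos_pos less_le_trans)
    have w_le: "w t \<le> 2 * M" if "t \<le> S" for t using r(2)[of t] c(2)[OF that] unfolding w_def by linarith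
    have d_pos: "d t > 0" for t using ra[of t] by (simp add: d_def)
    have d_le: "d t \<le> 2 * M" for t using r(2)[of t] a(2)[of t] unfolding d_def by linarith
    have acw: "ac_derivative {..S} w (\<lambda>t. g t (r t) - c' t)"
      unfolding w_def[abs_def] by (rule ac_derivative_diff[OF ac_derivative_subset[OF r(1)] c(1)]) simp
    have acd: "ac_derivative {..S} d (\<lambda>t. g t (a t) - g t (r t))"
      unfolding d_def[abs_def] by (rule ac_derivative_diff[OF ac_derivative_subset[OF a(1)] ac_derivative_subset[OF r(1)]]) simp_all
    have lnd: "ac_derivative {..S} (\<lambda>t. ln (d t)) (\<lambda>t. (g t (a t) - g t (r t)) / d t)"
      by (rule ac_derivative_ln[OF acd]) (rule d_pos)
    have lnw: "ac_derivative {..S} (\<lambda>t. ln (w t)) (\<lambda>t. (g t (r t) - c' t) / w t)"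
      by (rule ac_derivative_ln[OF acw]) (use w_pos in auto)
    \<comment> \<open>Lower bound for \<open>\<kappa> / w\<close>, since \<open>w\<close> is at most
      \<open>2 * M\<close>. It is the constant lost between the two logarithmic derivatives.\<close>
    define \<theta> where "\<theta> = \<kappa> / (2 * M)"
    have \<theta>: "\<theta> > 0" using \<kappa> M by (simp add: \<theta>_def)
    have slope: "AE t in lebesgue. t \<le> S \<longrightarrow> (g t (a t) - g t (r t)) / d t \<le> (g t (r t) - c' t) / w t - \<theta>"
      using conc[unfolded chord_concave_def, rule_format, of M] c'
    proof eventually_elim
      case (elim t)
      show ?case
      proof
        assume t: "t \<le> S"
        have "(g t (a t) - g t (r t)) * (r t - c t) \<le> (g t (r t) - g t (c t)) * (a t - r t)"
          using elim(1)[rule_format, of "c t" "r t" "a t"] c(2)[OF t] a(2)[of t] ra[of t] w_pos[OF t]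
          by (auto simp: w_def abs_le_iff)
        then have "(g t (a t) - g t (r t)) * w t \<le> (g t (r t) - g t (c t)) * d t"
          by (simp add: w_def d_def)
        then have "(g t (a t) - g t (r t)) / d t \<le> (g t (r t) - g t (c t)) / w t"
          using d_pos[of t] w_pos[OF t] by (simp add: field_simps)
        also have "\<dots> \<le> (g t (r t) - c' t - \<kappa>) / w t"
          using elim(2) t w_pos[OF t] by (intro divide_right_mono) auto
        also have "\<dots> = (g t (r t) - c' t) / w t - \<kappa> / w t" by (rule diff_divide_distrib)
        also have "\<dots> \<le> (g t (r t) - c' t) / w t - \<theta>"
        proof -
          have "\<theta> \<le> \<kappa> / w t"
            unfolding \<theta>_def using w_pos[OF t] w_le[OF t] \<kappa> M by (intro divide_left_mono) auto
          then show ?thesis by simp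
        qed
        finally show "(g t (a t) - g t (r t)) / d t \<le> (g t (r t) - c' t) / w t - \<theta>" .
      qed
    qed
    have growth: "ln (d S) - ln (d t) \<le> ln (w S) - ln (w t) - \<theta> * (S - t)" if t: "t \<le> S" for t
    proof -
      have "ln (d S) - ln (d t) \<le> (ln (w S) - (\<theta> * S + 0)) - (ln (w t) - (\<theta> * t + 0))"
      proof (rule ac_derivative_le[OF lnd ac_derivative_diff[OF lnw ac_derivative_linear] _ t])
        show "AE l in lebesgue. l \<in> {t..S} \<longrightarrow>
            (g l (a l) - g l (r l)) / d l \<le> (g l (r l) - c' l) / w l - \<theta>"
          using slope by eventually_elim auto
      qed auto
      then show ?thesis by (simp add: algebra_simps)
    qed
    \<comment> \<open>Collects the bounds on the four logarithms in \<open>growth\<close>. They do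
      not depend on \<open>t\<close>, whereas \<open>\<theta> * (S - t)\<close> is unbounded as
      \<open>t\<close> decreases.\<close>
    define Q where "Q = ln (2 * M) - ln (d S) + ln (w S) - ln (\<kappa> / L)"
    have "\<theta> * (S - t) \<le> Q" if t: "t \<le> S" for t
    proof -
      have "ln (d t) \<le> ln (2 * M)" using d_pos[of t] d_le[of t] by (intro ln_mono) auto
      moreover have "ln (\<kappa> / L) \<le> ln (w t)" using w_ge[OF t] \<kappa> L by (intro ln_mono) auto
      ultimately show ?thesis using growth[OF t] unfolding Q_def by linarith
    qed
    from this[of "S - (\<bar>Q\<bar> + 1) / \<theta>"] \<theta> have "\<bar>Q\<bar> + 1 \<le> Q" by simp
    then show ?thesis by linarith
  qed
qed

section \<open>Concave coercive equations\<close>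

text \<open>The conditions in the form in which they are used: coercivity as a sign, and (f7) as
  strong concavity relative to tangents. The class is stable under bounded measurable shifts of the
  state, so it contains the perturbed equation. Condition (f5) enters separately, for the
  unperturbed pair.\<close>

definition admissible :: "(real \<Rightarrow> real \<Rightarrow> real) \<Rightarrow> bool" where
  "admissible g \<longleftrightarrow> caratheodory g \<and>
     (\<exists>K. AE t in lebesgue. \<forall>x. K \<le> \<bar>x\<bar> \<longrightarrow> g t x \<le> 0) \<and>
     (AE t in lebesgue. \<forall>x. (g t has_real_derivative partial_x g t x) (at x)) \<and>
     (\<forall>K. \<exists>\<delta>>0. AE t in lebesgue. \<forall>x y. \<bar>x\<bar> \<le> K \<longrightarrow> \<bar>y\<bar> \<le> K \<longrightarrow>
        g t y \<le> g t x + partial_x g t x * (y - x) - \<delta> * (y - x)\<^sup>2)"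

section \<open>From the seven conditions to admissibility, and stability under shifts\<close>

lemma cond_f2_locally_bounded:
  assumes "cond_f2 f"
  shows "locally_bounded f"
  unfolding locally_bounded_def
proof
  fix K :: real
  obtain j :: nat where j: "K \<le> real j" using real_arch_simple by blast
  obtain m where m: "AE t in lebesgue. (SUP x\<in>{- real j..real j}. ereal \<bar>f t x\<bar>) \<le> ereal m"
    using assms unfolding cond_f2_def by blast
  have "AE t in lebesgue. \<forall>x. \<bar>x\<bar> \<le> K \<longrightarrow> \<bar>f t x\<bar> \<le> m"
    using m
  proof eventually_elim
    case (elim t)
    show ?case
    proof (intro allI impI)
      fix x assume "\<bar>x\<bar> \<le> K"
      then have "x \<in> {- real j..real j}" using j by auto
      then have "ereal \<bar>f t x\<bar> \<le> (SUP x\<in>{- real j..real j}. ereal \<bar>f t x\<bar>)" by (rule SUP_upper)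
      also have "\<dots> \<le> ereal m" by fact
      finally show "\<bar>f t x\<bar> \<le> m" by simp
    qed
  qed
  then show "\<exists>m. AE t in lebesgue. \<forall>x. \<bar>x\<bar> \<le> K \<longrightarrow> \<bar>f t x\<bar> \<le> m" by blast
qed

lemma cond_f3_locally_lipschitz:
  assumes "cond_f3 f"
  shows "locally_lipschitz f"
  unfolding locally_lipschitz_def
proof
  fix K :: real
  obtain j :: nat where j: "K \<le> real j" using real_arch_simple by blast
  let ?A = "{(x1, x2). x1 \<in> {- real j..real j} \<and> x2 \<in> {- real j..real j} \<and> x1 \<noteq> x2}"
  obtain l where l: "AE t in lebesgue. (SUP (x1, x2)\<in>?A. ereal (\<bar>f t x2 - f t x1\<bar> / \<bar>x2 - x1\<bar>)) \<le> ereal l"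
    using assms unfolding cond_f3_def by blast
  have "AE t in lebesgue. \<forall>x y. \<bar>x\<bar> \<le> K \<longrightarrow> \<bar>y\<bar> \<le> K \<longrightarrow> \<bar>f t x - f t y\<bar> \<le> l * \<bar>x - y\<bar>"
    using l
  proof eventually_elim
    case (elim t)
    show ?case
    proof (intro allI impI)
      fix x y assume xy: "\<bar>x\<bar> \<le> K" "\<bar>y\<bar> \<le> K"
      show "\<bar>f t x - f t y\<bar> \<le> l * \<bar>x - y\<bar>"
      proof (cases "x = y")
        case False
        then have "(y, x) \<in> ?A" using xy j by auto
        from SUP_upper[OF this, of "\<lambda>(x1, x2). ereal (\<bar>f t x2 - f t x1\<bar> / \<bar>x2 - x1\<bar>)"]
        have "ereal (\<bar>f t x - f t y\<bar> / \<bar>x - y\<bar>) \<le> (SUP (x1, x2)\<in>?A. ereal (\<bar>f t x2 - f t x1\<bar> / \<bar>x2 - x1\<bar>))"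
          by simp
        also have "\<dots> \<le> ereal l" by fact
        finally show ?thesis using False by (simp add: pos_divide_le_eq)
      qed simp
    qed
  qed
  then show "\<exists>L. AE t in lebesgue. \<forall>x y. \<bar>x\<bar> \<le> K \<longrightarrow> \<bar>y\<bar> \<le> K \<longrightarrow> \<bar>f t x - f t y\<bar> \<le> L * \<bar>x - y\<bar>"
    by blast
qed

lemma cond_f4_derivative:
  assumes "cond_f4 f"
  shows "AE t in lebesgue. \<forall>x. (f t has_real_derivative partial_x f t x) (at x)"
  using assms unfolding cond_f4_def
proof eventually_elim
  case (elim t)
  then obtain D where D: "\<forall>x. (f t has_vector_derivative D x) (at x)"
    unfolding C1_differentiable_on_def by auto
  show ?case
  proof
    fix x
    have "(f t has_real_derivative D x) (at x)"
      using D by (simp add: has_real_derivative_iff_has_vector_derivative)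
    moreover from DERIV_imp_deriv[OF this] have "partial_x f t x = D x" by (simp add: partial_x_def)
    ultimately show "(f t has_real_derivative partial_x f t x) (at x)" by simp
  qed
qed

lemma cond_f6_coercive:
  assumes "cond_f6 f"
  shows "\<exists>K. AE t in lebesgue. \<forall>x. K \<le> \<bar>x\<bar> \<longrightarrow> f t x \<le> 0"
proof -
  obtain R \<delta> where R: "negligible (- R)" "\<delta> > 0"
    "Limsup at_top (\<lambda>x. SUP t\<in>R. ereal (f t x / x\<^sup>2)) < ereal (- \<delta>)"
    "Limsup at_bot (\<lambda>x. SUP t\<in>R. ereal (f t x / x\<^sup>2)) < ereal (- \<delta>)"
    using assms unfolding cond_f6_def by blast
  define s where "s x = (SUP t\<in>R. ereal (f t x / x\<^sup>2))" for x
  have "eventually (\<lambda>x. s x < ereal (- \<delta>)) at_top" "eventually (\<lambda>x. s x < ereal (- \<delta>)) at_bot"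
    using R(3,4) unfolding s_def by (auto intro: Limsup_lessD)
  then obtain K1 K2 where K1: "\<forall>x\<ge>K1. s x < ereal (- \<delta>)" and K2: "\<forall>x\<le>K2. s x < ereal (- \<delta>)"
    unfolding eventually_at_top_linorder eventually_at_bot_linorder by auto
  \<comment> \<open>The 1 keeps \<open>x\<close> away from 0, so that the quotient by its square can
    be cleared.\<close>
  define K where "K = max 1 (max K1 (- K2))"
  have "f t x \<le> 0" if t: "t \<in> R" and x: "K \<le> \<bar>x\<bar>" for t x
  proof -
    have "x \<ge> K1 \<or> x \<le> K2" using x by (auto simp: K_def)
    then have "s x < ereal (- \<delta>)" using K1 K2 by auto
    moreover have "ereal (f t x / x\<^sup>2) \<le> s x" unfolding s_def by (rule SUP_upper[OF t])
    ultimately have "ereal (f t x / x\<^sup>2) < ereal (- \<delta>)" by (rule le_less_trans[rotated])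
    then have "f t x / x\<^sup>2 < - \<delta>" by simp
    moreover have "x\<^sup>2 > 0" using x by (auto simp: K_def)
    ultimately have "f t x < - \<delta> * x\<^sup>2" by (simp add: pos_divide_less_eq)
    also have "\<dots> \<le> 0" using R(2) by simp
    finally show ?thesis by simp
  qed
  then have "{t. \<not> (\<forall>x. K \<le> \<bar>x\<bar> \<longrightarrow> f t x \<le> 0)} \<subseteq> - R" by blast
  then have "AE t in lebesgue. \<forall>x. K \<le> \<bar>x\<bar> \<longrightarrow> f t x \<le> 0"
    unfolding AE_lebesgue_iff_negligible by (rule negligible_subset[OF R(1)])
  then show ?thesis by blast
qed

text \<open>After subtracting the linear part of the tangent and adding back the parabola, the
  derivative has the sign opposite to \<open>z - x\<close>, so \<open>x\<close> is a maximum.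
  Integrating the slope decrease \<open>\<delta>\<close> produces the factor 1/2.\<close>

lemma strongly_concave_tangent:
  fixes f f' :: "real \<Rightarrow> real"
  assumes der: "\<And>z. (f has_real_derivative f' z) (at z)"
    and dec: "\<And>u v. \<bar>u\<bar> \<le> K \<Longrightarrow> \<bar>v\<bar> \<le> K \<Longrightarrow> u < v \<Longrightarrow> f' v - f' u \<le> - \<delta> * (v - u)"
    and x: "\<bar>x\<bar> \<le> K" and y: "\<bar>y\<bar> \<le> K"
  shows "f y \<le> f x + f' x * (y - x) - \<delta> / 2 * (y - x)\<^sup>2"
proof -
  define \<phi> where "\<phi> z = f z - f' x * (z - x) + \<delta> / 2 * (z - x)\<^sup>2" for z
  have d\<phi>: "(\<phi> has_real_derivative f' z - f' x + \<delta> * (z - x)) (at z)" for z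
    unfolding \<phi>_def by (auto intro!: derivative_eq_intros der)
  have "\<phi> y \<le> \<phi> x"
  proof (cases "x \<le> y")
    case True
    show ?thesis
    proof (rule DERIV_nonpos_imp_nonincreasing[OF True])
      fix z assume z: "x \<le> z" "z \<le> y"
      have "f' z - f' x + \<delta> * (z - x) \<le> 0"
        using dec[of x z] z x y by (cases "x = z") (auto simp: abs_le_iff algebra_simps)
      then show "\<exists>y. (\<phi> has_real_derivative y) (at z) \<and> y \<le> 0" using d\<phi>[of z] by blast
    qed
  next
    case False
    then have yx: "y \<le> x" by simp
    show ?thesis
    proof (rule DERIV_nonneg_imp_nondecreasing[OF yx])
      fix z assume z: "y \<le> z" "z \<le> x"
      have "0 \<le> f' z - f' x + \<delta> * (z - x)"
        using dec[of z x] z x y by (cases "x = z") (auto simp: abs_le_iff algebra_simps)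
      then show "\<exists>y. (\<phi> has_real_derivative y) (at z) \<and> 0 \<le> y" using d\<phi>[of z] by blast
    qed
  qed
  then show ?thesis by (simp add: \<phi>_def)
qed

lemma cond_f7_tangent:
  assumes "cond_f4 f" and "cond_f7 f"
  shows "\<exists>\<delta>>0. AE t in lebesgue. \<forall>x y. \<bar>x\<bar> \<le> K \<longrightarrow> \<bar>y\<bar> \<le> K \<longrightarrow>
        f t y \<le> f t x + partial_x f t x * (y - x) - \<delta> * (y - x)\<^sup>2"
proof -
  obtain j :: nat where j: "K \<le> real j" using real_arch_simple by blast
  let ?A = "{(x1, x2). x1 \<in> {- real j..real j} \<and> x2 \<in> {- real j..real j} \<and> x1 \<noteq> x2}"
  obtain \<delta> where \<delta>: "\<delta> > 0" "AE t in lebesgue. (SUP (x1, x2)\<in>?A.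
      ereal ((partial_x f t x2 - partial_x f t x1) / (x2 - x1))) < ereal (- \<delta>)"
    using assms(2) unfolding cond_f7_def by blast
  have "AE t in lebesgue. \<forall>x y. \<bar>x\<bar> \<le> K \<longrightarrow> \<bar>y\<bar> \<le> K \<longrightarrow>
        f t y \<le> f t x + partial_x f t x * (y - x) - \<delta> / 2 * (y - x)\<^sup>2"
    using \<delta>(2) cond_f4_derivative[OF assms(1)]
  proof eventually_elim
    case (elim t)
    have dec: "partial_x f t v - partial_x f t u \<le> - \<delta> * (v - u)"
      if "\<bar>u\<bar> \<le> K" "\<bar>v\<bar> \<le> K" "u < v" for u v
    proof -
      have "(u, v) \<in> ?A" using that j by auto
      from SUP_upper[OF this, of "\<lambda>(x1, x2). ereal ((partial_x f t x2 - partial_x f t x1) / (x2 - x1))"]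
      have "ereal ((partial_x f t v - partial_x f t u) / (v - u)) \<le>
          (SUP (x1, x2)\<in>?A. ereal ((partial_x f t x2 - partial_x f t x1) / (x2 - x1)))"
        by simp
      also have "\<dots> < ereal (- \<delta>)" by (rule elim)
      finally show ?thesis using that by (simp add: pos_divide_less_eq)
    qed
    show ?case
      using strongly_concave_tangent[of "f t" "partial_x f t" K \<delta>] elim(2) dec by blast
  qed
  then show ?thesis using \<delta>(1) by (intro exI[of _ "\<delta> / 2"]) simp
qed

lemma cond_f1_f7_admissible:
  assumes "cond_f1_f7 f"
  shows "admissible f"
  using assms cond_f2_locally_bounded cond_f3_locally_lipschitz cond_f4_derivative cond_f6_coercive cond_f7_tangent
  unfolding cond_f1_f7_def cond_f1_def admissible_def caratheodory_def by simp

lemma cond_f1_f7_partial_lipschitz: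
  "cond_f1_f7 f \<Longrightarrow> locally_lipschitz (partial_x f)"
  by (simp add: cond_f1_f7_def cond_f5_def cond_f3_locally_lipschitz)

text \<open>Both chord slopes are compared with the tangent slope at the middle point
  \<open>q\<close>.\<close>

lemma admissible_chord_concave:
  assumes "admissible g"
  shows "chord_concave g"
  unfolding chord_concave_def
proof
  fix K
  obtain \<delta> where \<delta>: "\<delta> > 0" "AE t in lebesgue. \<forall>x y. \<bar>x\<bar> \<le> K \<longrightarrow> \<bar>y\<bar> \<le> K \<longrightarrow>
        g t y \<le> g t x + partial_x g t x * (y - x) - \<delta> * (y - x)\<^sup>2"
    using assms unfolding admissible_def by blast
  show "AE t in lebesgue. \<forall>p q s. - K \<le> p \<and> p < q \<and> q < s \<and> s \<le> K \<longrightarrow>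
     (g t s - g t q) * (q - p) \<le> (g t q - g t p) * (s - q)"
    using \<delta>(2)
  proof eventually_elim
    case (elim t)
    show ?case
    proof (intro allI impI)
      fix p q s assume pqs: "- K \<le> p \<and> p < q \<and> q < s \<and> s \<le> K"
      have tangent: "g t y \<le> g t q + partial_x g t q * (y - q)" if "\<bar>y\<bar> \<le> K" for y
      proof -
        have "g t y \<le> g t q + partial_x g t q * (y - q) - \<delta> * (y - q)\<^sup>2"
          using elim that pqs by (simp add: abs_le_iff)
        moreover have "0 \<le> \<delta> * (y - q)\<^sup>2" using \<delta>(1) by simp
        ultimately show ?thesis by linarith
      qed
      have "(g t s - g t q) * (q - p) \<le> (partial_x g t q * (s - q)) * (q - p)"
        using tangent[of s] pqs by (intro mult_right_mono) (auto simp: abs_le_iff)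
      also have "\<dots> = (partial_x g t q * (q - p)) * (s - q)" by simp
      also have "\<dots> \<le> (g t q - g t p) * (s - q)"
        using tangent[of p] pqs by (intro mult_right_mono) (auto simp: abs_le_iff algebra_simps)
      finally show "(g t s - g t q) * (q - p) \<le> (g t q - g t p) * (s - q)" .
    qed
  qed
qed

text \<open>The shift merely enlarges the interval of states from which the constants are taken,
  from \<open>K\<close> to \<open>K + B\<close>.\<close>

lemma admissible_shift:
  assumes f: "admissible f" and \<sigma>: "\<sigma> \<in> borel_measurable borel" "\<And>t. \<bar>\<sigma> t\<bar> \<le> B"
  shows "admissible (\<lambda>t x. f t (x - \<sigma> t))"
proof -
  let ?g = "\<lambda>t x. f t (x - \<sigma> t)"
  have abs: "\<bar>x - \<sigma> t\<bar> \<le> K + B" if "\<bar>x\<bar> \<le> K" for x t K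
    using that \<sigma>(2)[of t] by linarith
  have meas: "case_prod ?g \<in> borel_measurable borel"
  proof -
    have [measurable]: "\<sigma> \<in> borel_measurable borel" by fact
    have "(\<lambda>(t, x). (t, x - \<sigma> t)) \<in> borel_measurable (borel :: (real \<times> real) measure)"
      unfolding borel_prod[symmetric] by measurable
    moreover have "case_prod f \<in> borel_measurable borel"
      using f by (simp add: admissible_def caratheodory_def)
    ultimately have "(\<lambda>p. case_prod f (case p of (t, x) \<Rightarrow> (t, x - \<sigma> t))) \<in> borel_measurable borel"
      by (rule measurable_compose)
    then show ?thesis by (simp add: case_prod_unfold)
  qed
  have "locally_bounded ?g"
    unfolding locally_bounded_def
  proof
    fix K
    obtain m where "AE t in lebesgue. \<forall>x. \<bar>x\<bar> \<le> K + B \<longrightarrow> \<bar>f t x\<bar> \<le> m"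
      using f unfolding admissible_def caratheodory_def locally_bounded_def by blast
    then have "AE t in lebesgue. \<forall>x. \<bar>x\<bar> \<le> K \<longrightarrow> \<bar>?g t x\<bar> \<le> m"
      by eventually_elim (use abs in blast)
    then show "\<exists>m. AE t in lebesgue. \<forall>x. \<bar>x\<bar> \<le> K \<longrightarrow> \<bar>?g t x\<bar> \<le> m" by blast
  qed
  moreover have "locally_lipschitz ?g"
    unfolding locally_lipschitz_def
  proof
    fix K
    obtain L where L: "AE t in lebesgue. \<forall>x y. \<bar>x\<bar> \<le> K + B \<longrightarrow> \<bar>y\<bar> \<le> K + B \<longrightarrow> \<bar>f t x - f t y\<bar> \<le> L * \<bar>x - y\<bar>"
      using f unfolding admissible_def caratheodory_def locally_lipschitz_def by blast
    have "AE t in lebesgue. \<forall>x y. \<bar>x\<bar> \<le> K \<longrightarrow> \<bar>y\<bar> \<le> K \<longrightarrow> \<bar>?g t x - ?g t y\<bar> \<le> L * \<bar>x - y\<bar>"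
      using L
    proof eventually_elim
      case (elim t)
      show ?case
      proof (intro allI impI)
        fix x y assume "\<bar>x\<bar> \<le> K" "\<bar>y\<bar> \<le> K"
        then have "\<bar>?g t x - ?g t y\<bar> \<le> L * \<bar>(x - \<sigma> t) - (y - \<sigma> t)\<bar>" using elim abs by blast
        then show "\<bar>?g t x - ?g t y\<bar> \<le> L * \<bar>x - y\<bar>" by simp
      qed
    qed
    then show "\<exists>L. AE t in lebesgue. \<forall>x y. \<bar>x\<bar> \<le> K \<longrightarrow> \<bar>y\<bar> \<le> K \<longrightarrow> \<bar>?g t x - ?g t y\<bar> \<le> L * \<bar>x - y\<bar>"
      by blast
  qed
  moreover have coer: "\<exists>K. AE t in lebesgue. \<forall>x. K \<le> \<bar>x\<bar> \<longrightarrow> ?g t x \<le> 0"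
  proof -
    obtain K where K: "AE t in lebesgue. \<forall>x. K \<le> \<bar>x\<bar> \<longrightarrow> f t x \<le> 0"
      using f unfolding admissible_def by blast
    have far: "K \<le> \<bar>x - \<sigma> t\<bar>" if "K + B \<le> \<bar>x\<bar>" for x t
      using that \<sigma>(2)[of t] by linarith
    from K have "AE t in lebesgue. \<forall>x. K + B \<le> \<bar>x\<bar> \<longrightarrow> ?g t x \<le> 0"
      by eventually_elim (use far in blast)
    then show ?thesis by blast
  qed
  have der: "AE t in lebesgue. \<forall>x. partial_x ?g t x = partial_x f t (x - \<sigma> t) \<and>
      (?g t has_real_derivative partial_x ?g t x) (at x)"
  proof -
    have "AE t in lebesgue. \<forall>x. (f t has_real_derivative partial_x f t x) (at x)"
      using f unfolding admissible_def by blast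
    then show ?thesis
    proof eventually_elim
      case (elim t)
      show ?case
      proof
        fix x
        have "((\<lambda>x. f t (x - \<sigma> t)) has_real_derivative partial_x f t (x - \<sigma> t) * 1) (at x)"
          by (rule DERIV_chain2[of "f t"]) (use elim in \<open>auto intro!: derivative_eq_intros\<close>)
        moreover from DERIV_imp_deriv[OF this] have "partial_x ?g t x = partial_x f t (x - \<sigma> t)"
          by (simp add: partial_x_def)
        ultimately show "partial_x ?g t x = partial_x f t (x - \<sigma> t) \<and>
            (?g t has_real_derivative partial_x ?g t x) (at x)" by simp
      qed
    qed
  qed
  moreover from der have "AE t in lebesgue. \<forall>x. (?g t has_real_derivative partial_x ?g t x) (at x)"
    by eventually_elim blast
  moreover have "\<exists>\<delta>>0. AE t in lebesgue. \<forall>x y. \<bar>x\<bar> \<le> K \<longrightarrow> \<bar>y\<bar> \<le> K \<longrightarrow>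
        ?g t y \<le> ?g t x + partial_x ?g t x * (y - x) - \<delta> * (y - x)\<^sup>2" for K
  proof -
    obtain \<delta> where \<delta>: "\<delta> > 0" "AE t in lebesgue. \<forall>x y. \<bar>x\<bar> \<le> K + B \<longrightarrow> \<bar>y\<bar> \<le> K + B \<longrightarrow>
        f t y \<le> f t x + partial_x f t x * (y - x) - \<delta> * (y - x)\<^sup>2"
      using f unfolding admissible_def by blast
    from \<delta>(2) der have "AE t in lebesgue. \<forall>x y. \<bar>x\<bar> \<le> K \<longrightarrow> \<bar>y\<bar> \<le> K \<longrightarrow>
        ?g t y \<le> ?g t x + partial_x ?g t x * (y - x) - \<delta> * (y - x)\<^sup>2"
    proof eventually_elim
      case (elim t)
      show ?case
      proof (intro allI impI)
        fix x y assume "\<bar>x\<bar> \<le> K" "\<bar>y\<bar> \<le> K"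
        then have "?g t y \<le> ?g t x + partial_x f t (x - \<sigma> t) * ((y - \<sigma> t) - (x - \<sigma> t))
            - \<delta> * ((y - \<sigma> t) - (x - \<sigma> t))\<^sup>2"
          using elim(1) abs by blast
        then show "?g t y \<le> ?g t x + partial_x ?g t x * (y - x) - \<delta> * (y - x)\<^sup>2"
          using elim(2) by simp
      qed
    qed
    then show ?thesis using \<delta>(1) by blast
  qed
  ultimately show ?thesis
    using meas coer unfolding admissible_def caratheodory_def by simp
qed

section \<open>Reflection in time and state, and the gap at plus infinity\<close>

text \<open>If \<open>x\<close> solves the equation of \<open>g\<close>, then
  \<open>- x (- t)\<close> solves the reflected one. The sign in time alone would turn concave into
  convex; the second sign restores concavity and exchanges upper with lower bounded
  solutions.\<close>

definition reflected :: "(real \<Rightarrow> real \<Rightarrow> real) \<Rightarrow> real \<Rightarrow> real \<Rightarrow> real" where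
  "reflected g t x = g (- t) (- x)"

lemma caratheodory_reflected:
  assumes "caratheodory g"
  shows "caratheodory (reflected g)"
  unfolding caratheodory_def
proof (intro conjI)
  have "(\<lambda>(t, x). (- t, - x)) \<in> borel_measurable (borel :: (real \<times> real) measure)"
    unfolding borel_prod[symmetric] by measurable
  moreover have "case_prod g \<in> borel_measurable borel"
    using assms by (simp add: caratheodory_def)
  ultimately have "(\<lambda>p. case_prod g (case p of (t, x) \<Rightarrow> (- t, - x))) \<in> borel_measurable borel"
    by (rule measurable_compose)
  then show "case_prod (reflected g) \<in> borel_measurable borel"
    by (simp add: reflected_def case_prod_unfold)
  show "locally_bounded (reflected g)"
    unfolding locally_bounded_def
  proof
    fix K
    obtain m where "AE t in lebesgue. \<forall>x. \<bar>x\<bar> \<le> K \<longrightarrow> \<bar>g t x\<bar> \<le> m"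
      using assms unfolding caratheodory_def locally_bounded_def by blast
    from AE_lebesgue_uminus[OF this] have "AE t in lebesgue. \<forall>x. \<bar>x\<bar> \<le> K \<longrightarrow> \<bar>reflected g t x\<bar> \<le> m"
      by eventually_elim (simp add: reflected_def)
    then show "\<exists>m. AE t in lebesgue. \<forall>x. \<bar>x\<bar> \<le> K \<longrightarrow> \<bar>reflected g t x\<bar> \<le> m" by blast
  qed
  show "locally_lipschitz (reflected g)"
    unfolding locally_lipschitz_def
  proof
    fix K
    obtain L where "AE t in lebesgue. \<forall>x y. \<bar>x\<bar> \<le> K \<longrightarrow> \<bar>y\<bar> \<le> K \<longrightarrow> \<bar>g t x - g t y\<bar> \<le> L * \<bar>x - y\<bar>"
      using assms unfolding caratheodory_def locally_lipschitz_def by blast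
    from AE_lebesgue_uminus[OF this]
    have "AE t in lebesgue. \<forall>x y. \<bar>x\<bar> \<le> K \<longrightarrow> \<bar>y\<bar> \<le> K \<longrightarrow> \<bar>reflected g t x - reflected g t y\<bar> \<le> L * \<bar>x - y\<bar>"
    proof eventually_elim
      case (elim t)
      show ?case
      proof (intro allI impI)
        fix x y :: real assume "\<bar>x\<bar> \<le> K" "\<bar>y\<bar> \<le> K"
        then have "\<bar>g (- t) (- x) - g (- t) (- y)\<bar> \<le> L * \<bar>- x - - y\<bar>"
          using elim[rule_format, of "- x" "- y"] by simp
        then show "\<bar>reflected g t x - reflected g t y\<bar> \<le> L * \<bar>x - y\<bar>"
          by (simp add: reflected_def abs_minus_commute)
      qed
    qed
    then show "\<exists>L. AE t in lebesgue. \<forall>x y. \<bar>x\<bar> \<le> K \<longrightarrow> \<bar>y\<bar> \<le> K \<longrightarrow>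
        \<bar>reflected g t x - reflected g t y\<bar> \<le> L * \<bar>x - y\<bar>" by blast
  qed
qed

lemma chord_concave_reflected:
  assumes "chord_concave g"
  shows "chord_concave (reflected g)"
  unfolding chord_concave_def
proof
  fix K
  from AE_lebesgue_uminus[OF assms[unfolded chord_concave_def, rule_format, of K]]
  show "AE t in lebesgue. \<forall>p q s. - K \<le> p \<and> p < q \<and> q < s \<and> s \<le> K \<longrightarrow>
     (reflected g t s - reflected g t q) * (q - p) \<le> (reflected g t q - reflected g t p) * (s - q)"
  proof eventually_elim
    case (elim t)
    show ?case
    proof (intro allI impI)
      fix p q s :: real assume "- K \<le> p \<and> p < q \<and> q < s \<and> s \<le> K"
      then have "(g (- t) (- p) - g (- t) (- q)) * (- q - - s) \<le> (g (- t) (- q) - g (- t) (- s)) * (- p - - q)"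
        by (intro elim[rule_format]) auto
      then show "(reflected g t s - reflected g t q) * (q - p) \<le> (reflected g t q - reflected g t p) * (s - q)"
        by (simp add: reflected_def algebra_simps)
    qed
  qed
qed

lemma global_solution_reflected:
  assumes g: "caratheodory g" and x: "global_solution g x" and b: "\<And>t. \<bar>x t\<bar> \<le> M"
  shows "global_solution (reflected g) (\<lambda>t. - x (- t))"
proof -
  obtain m where m: "AE t in lebesgue. \<forall>x. \<bar>x\<bar> \<le> M \<longrightarrow> \<bar>g t x\<bar> \<le> m"
    using g unfolding caratheodory_def locally_bounded_def by blast
  have "ac_derivative (uminus ` UNIV) (\<lambda>t. - x (- t)) (\<lambda>t. g (- t) (x (- t)))"
  proof (rule ac_derivative_uminus_arg[OF x])
    fix a b
    have "AE t in lebesgue. t \<in> {a..b} \<longrightarrow> \<bar>g t (x t)\<bar> \<le> m"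
      using m by eventually_elim (use b in blast)
    then show "\<exists>C. AE t in lebesgue. t \<in> {a..b} \<longrightarrow> \<bar>g t (x t)\<bar> \<le> C" by blast
  qed
  moreover have "uminus ` UNIV = (UNIV :: real set)" by (metis surj_def minus_minus)
  ultimately show ?thesis by (simp add: reflected_def)
qed

text \<open>Under the reflection \<open>- r (- t)\<close> becomes the upper solution and
  \<open>- a (- t)\<close> the lower one, while a strict lower solution stays a strict lower
  solution. The bound on \<open>c'\<close> makes the reflected \<open>c\<close> absolutely
  continuous.\<close>

lemma gap_at_plus_infinity:
  assumes g: "caratheodory g" and conc: "chord_concave g"
    and coer: "AE t in lebesgue. \<forall>x. \<bar>x\<bar> \<ge> K0 \<longrightarrow> g t x \<le> 0"
    and a: "global_solution g a" "\<And>t. \<bar>a t\<bar> \<le> M"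
    and r: "global_solution g r" "\<And>t. \<bar>r t\<bar> \<le> M" and ra: "\<And>t. r t < a t"
    and min: "\<And>x t. global_solution g x \<Longrightarrow> bounded (range x) \<Longrightarrow> r t \<le> x t"
    and c: "ac_derivative {S..} c c'" "\<And>t. S \<le> t \<Longrightarrow> \<bar>c t\<bar> \<le> M"
    and c'_bounded: "AE t in lebesgue. \<bar>c' t\<bar> \<le> C"
    and c': "AE t in lebesgue. S \<le> t \<longrightarrow> c' t \<le> g t (c t) - \<kappa>" and \<kappa>: "\<kappa> > 0"
  shows "\<exists>\<epsilon>>0. \<exists>S'. \<forall>t\<ge>S'. a t - r t \<ge> \<epsilon>"
proof -
  have "\<exists>\<epsilon>>0. \<exists>S'. \<forall>t\<le>S'. - r (- t) - - a (- t) \<ge> \<epsilon>"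
  proof (rule gap_at_minus_infinity[where g = "reflected g" and ?K0.0 = K0 and M = M
        and S = "- S" and c = "\<lambda>t. - c (- t)" and c' = "\<lambda>t. c' (- t)" and \<kappa> = \<kappa>])
    show "caratheodory (reflected g)" by (rule caratheodory_reflected[OF g])
    show "chord_concave (reflected g)" by (rule chord_concave_reflected[OF conc])
    show "global_solution (reflected g) (\<lambda>t. - r (- t))" by (rule global_solution_reflected[OF g r])
    show "global_solution (reflected g) (\<lambda>t. - a (- t))" by (rule global_solution_reflected[OF g a])
    show "AE t in lebesgue. \<forall>x. K0 \<le> \<bar>x\<bar> \<longrightarrow> reflected g t x \<le> 0"
      using AE_lebesgue_uminus[OF coer] by eventually_elim (simp add: reflected_def)
    show "ac_derivative {..- S} (\<lambda>t. - c (- t)) (\<lambda>t. c' (- t))"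
    proof -
      have "ac_derivative (uminus ` {S..}) (\<lambda>t. - c (- t)) (\<lambda>t. c' (- t))"
      proof (rule ac_derivative_uminus_arg[OF c(1)])
        fix a b
        have "AE t in lebesgue. t \<in> {a..b} \<longrightarrow> \<bar>c' t\<bar> \<le> C" using c'_bounded by eventually_elim simp
        then show "\<exists>C. AE t in lebesgue. t \<in> {a..b} \<longrightarrow> \<bar>c' t\<bar> \<le> C" by blast
      qed
      then show ?thesis by simp
    qed
    show "AE t in lebesgue. t \<le> - S \<longrightarrow> c' (- t) \<le> reflected g t (- c (- t)) - \<kappa>"
      using AE_lebesgue_uminus[OF c'] by eventually_elim (simp add: reflected_def)
    show "x t \<le> - r (- t)" if x: "global_solution (reflected g) x" "bounded (range x)" for x t
    proof -
      obtain K where K: "\<And>t. \<bar>x t\<bar> \<le> K" using x(2) by (auto simp: bounded_iff)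
      have rr: "reflected (reflected g) = g" by (simp add: reflected_def fun_eq_iff)
      have gs: "global_solution g (\<lambda>t. - x (- t))"
        using global_solution_reflected[OF caratheodory_reflected[OF g] x(1) K] unfolding rr .
      have "bounded (range (\<lambda>t. - x (- t)))" using K by (auto simp: bounded_iff)
      from min[OF gs this, of "- t"] show ?thesis by simp
    qed
    show "\<bar>- r (- t)\<bar> \<le> M" "\<bar>- a (- t)\<bar> \<le> M" "- a (- t) < - r (- t)" for t
      using r(2) a(2) ra by simp_all
    show "\<bar>- c (- t)\<bar> \<le> M" if "t \<le> - S" for t
      using c(2)[of "- t"] that by simp
  qed (fact \<kappa>)
  then obtain \<epsilon> S' where *: "\<epsilon> > 0" "\<And>t. t \<le> S' \<Longrightarrow> - r (- t) - - a (- t) \<ge> \<epsilon>" by blast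
  have "a t - r t \<ge> \<epsilon>" if "t \<ge> - S'" for t
    using *(2)[of "- t"] that by simp
  then show ?thesis using *(1) by blast
qed

section \<open>Hyperbolicity and separation\<close>

lemma locally_lipschitz_nonneg:
  assumes "locally_lipschitz g"
  obtains L where "L \<ge> 0" "AE t in lebesgue. \<forall>x y. \<bar>x\<bar> \<le> K \<longrightarrow> \<bar>y\<bar> \<le> K \<longrightarrow> \<bar>g t x - g t y\<bar> \<le> L * \<bar>x - y\<bar>"
proof -
  obtain L where L: "AE t in lebesgue. \<forall>x y. \<bar>x\<bar> \<le> K \<longrightarrow> \<bar>y\<bar> \<le> K \<longrightarrow> \<bar>g t x - g t y\<bar> \<le> L * \<bar>x - y\<bar>"
    using assms unfolding locally_lipschitz_def by blast
  have le: "L * \<bar>x - y\<bar> \<le> \<bar>L\<bar> * \<bar>x - y\<bar>" for x y :: real by (intro mult_right_mono) auto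
  from L have "AE t in lebesgue. \<forall>x y. \<bar>x\<bar> \<le> K \<longrightarrow> \<bar>y\<bar> \<le> K \<longrightarrow> \<bar>g t x - g t y\<bar> \<le> \<bar>L\<bar> * \<bar>x - y\<bar>"
    by eventually_elim (use le order_trans in blast)
  then show thesis by (intro that[of "\<bar>L\<bar>"]) auto
qed

lemma ac_derivative_borel_measurable:
  assumes "ac_derivative UNIV x p"
  shows "x \<in> borel_measurable borel"
proof -
  have "continuous (at t) x" for t
    using ac_derivative_continuous_on[OF assms, of "t - 1" "t + 1"]
    by (rule continuous_on_interior) auto
  then show ?thesis
    by (intro borel_measurable_continuous_onI) (simp add: continuous_on_eq_continuous_at)
qed

text \<open>The derivative is an almost everywhere limit of difference quotients, hence measurable.\<close>

lemma partial_x_absolutely_integrable: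
  assumes g: "admissible g" and x: "global_solution g x" and M: "\<And>t. \<bar>x t\<bar> \<le> M"
  shows "(\<lambda>l. partial_x g l (x l)) absolutely_integrable_on {a..b}"
proof -
  have meas: "case_prod g \<in> borel_measurable borel" and lip: "locally_lipschitz g"
    using g by (simp_all add: admissible_def caratheodory_def)
  have der: "AE t in lebesgue. \<forall>x. (g t has_real_derivative partial_x g t x) (at x)"
    using g by (simp add: admissible_def)
  \<comment> \<open>\<open>M + 1\<close> leaves room for the increments \<open>1 / Suc n\<close> of
    the difference quotients.\<close>
  obtain L where L: "AE t in lebesgue. \<forall>x y. \<bar>x\<bar> \<le> M + 1 \<longrightarrow> \<bar>y\<bar> \<le> M + 1 \<longrightarrow> \<bar>g t x - g t y\<bar> \<le> L * \<bar>x - y\<bar>"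
    using lip unfolding locally_lipschitz_def by blast
  define u where "u n l = (g l (x l + 1 / real (Suc n)) - g l (x l)) / (1 / real (Suc n))" for n l
  \<comment> \<open>Where the quotients do not converge \<open>lim\<close> has an unspecified value,
    which concerns a null set only.\<close>
  define B where "B l = lim (\<lambda>n. u n l)" for l
  have xb: "x \<in> borel_measurable borel" by (rule ac_derivative_borel_measurable[OF x])
  have "u n \<in> borel_measurable lebesgue" for n
  proof -
    have "(\<lambda>l. g l (x l + 1 / real (Suc n))) \<in> borel_measurable lebesgue"
      by (rule superposition_measurable[OF meas]) (use xb in measurable)
    moreover have "(\<lambda>l. g l (x l)) \<in> borel_measurable lebesgue"
      by (rule superposition_measurable[OF meas xb])
    ultimately show ?thesis unfolding u_def[abs_def]
      by (intro borel_measurable_divide borel_measurable_diff borel_measurable_const)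
  qed
  then have Bmeas: "B \<in> borel_measurable lebesgue"
    unfolding B_def[abs_def] by (rule borel_measurable_lim_metric)
  have AB: "AE l in lebesgue. B l = partial_x g l (x l) \<and> \<bar>B l\<bar> \<le> L"
    using der L
  proof eventually_elim
    case (elim l)
    have "filterlim (\<lambda>n. 1 / real (Suc n)) (at 0) sequentially"
      using LIMSEQ_inverse_real_of_nat by (intro filterlim_atI) (auto simp: inverse_eq_divide)
    moreover have "((\<lambda>h. (g l (x l + h) - g l (x l)) / h) \<longlongrightarrow> partial_x g l (x l)) (at 0)"
      using elim(1) by (intro DERIV_D) blast
    ultimately have lim: "(\<lambda>n. u n l) \<longlonglongrightarrow> partial_x g l (x l)"
      unfolding u_def by (rule filterlim_compose[rotated])
    then have B: "B l = partial_x g l (x l)" unfolding B_def by (rule limI)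
    have "\<bar>u n l\<bar> \<le> L" for n
    proof -
      define h where "h = 1 / real (Suc n)"
      have h: "0 < h" "h \<le> 1" by (auto simp: h_def)
      have "\<bar>x l + h\<bar> \<le> M + 1" "\<bar>x l\<bar> \<le> M + 1"
        using M[of l] h by linarith+
      then have "\<bar>g l (x l + h) - g l (x l)\<bar> \<le> L * \<bar>x l + h - x l\<bar>"
        using elim(2) by blast
      then have "\<bar>(g l (x l + h) - g l (x l)) / h\<bar> \<le> L"
        using h by (simp add: abs_divide pos_divide_le_eq)
      then show ?thesis by (simp only: u_def h_def)
    qed
    then have "\<bar>partial_x g l (x l)\<bar> \<le> L"
      using tendsto_rabs[OF lim] by (intro LIMSEQ_le_const2) auto
    with B show ?case by simp
  qed
  have "B absolutely_integrable_on {a..b}"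
  proof (rule bounded_measurable_absolutely_integrable[OF Bmeas])
    show "AE t in lebesgue. t \<in> {a..b} \<longrightarrow> \<bar>B t\<bar> \<le> L" using AB by eventually_elim blast
  qed
  moreover have "negligible {l. \<not> (B l = partial_x g l (x l) \<and> \<bar>B l\<bar> \<le> L)}"
    using AB by (simp only: AE_lebesgue_iff_negligible)
  ultimately show ?thesis
    by (rule absolutely_integrable_spike) auto
qed

lemma interval_lebesgue_integral_eq_integral:
  fixes \<phi> :: "real \<Rightarrow> real"
  assumes \<phi>: "\<And>a b. \<phi> absolutely_integrable_on {a..b}"
  shows "s \<le> t \<Longrightarrow> (LINT l=ereal s..ereal t|lebesgue. \<phi> l) = integral {s..t} \<phi>"
    and "t \<le> s \<Longrightarrow> (LINT l=ereal s..ereal t|lebesgue. \<phi> l) = - integral {t..s} \<phi>"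
proof -
  have eq: "(LINT l:{u<..<v}|lebesgue. \<phi> l) = integral {u..v} \<phi>" for u v
  proof -
    have "\<phi> absolutely_integrable_on {u<..<v}"
      by (rule set_integrable_subset[OF \<phi>[of u v]]) auto
    from set_lebesgue_integral_eq_integral(2)[OF this] show ?thesis
      by (simp add: integral_open_interval_real)
  qed
  show "s \<le> t \<Longrightarrow> (LINT l=ereal s..ereal t|lebesgue. \<phi> l) = integral {s..t} \<phi>"
    by (simp add: interval_lebesgue_integral_def eq)
  show "t \<le> s \<Longrightarrow> (LINT l=ereal s..ereal t|lebesgue. \<phi> l) = - integral {t..s} \<phi>"
  proof (cases "s = t")
    case True
    then show ?thesis by (simp add: interval_lebesgue_integral_def set_lebesgue_integral_def)
  next
    case False
    moreover assume "t \<le> s"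
    ultimately show ?thesis by (simp add: interval_lebesgue_integral_def eq)
  qed
qed

text \<open>Companion of \<open>ac_derivative_le\<close> in which one side is merely integrable, as
  \<open>partial_x\<close> along a solution is.\<close>

lemma integral_le_increment:
  assumes w: "ac_derivative I w q" and I: "{a..b} \<subseteq> I" and ab: "a \<le> b" and \<phi>: "\<phi> integrable_on {a..b}"
  shows "AE l in lebesgue. l \<in> {a..b} \<longrightarrow> \<phi> l \<le> q l \<Longrightarrow> integral {a..b} \<phi> \<le> w b - w a"
    and "AE l in lebesgue. l \<in> {a..b} \<longrightarrow> q l \<le> \<phi> l \<Longrightarrow> w b - w a \<le> integral {a..b} \<phi>"
proof -
  note q = ac_derivative_has_integral[OF w I ab]
  show "integral {a..b} \<phi> \<le> w b - w a" if le: "AE l in lebesgue. l \<in> {a..b} \<longrightarrow> \<phi> l \<le> q l"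
  proof -
    define N where "N = {t. \<not> (t \<in> {a..b} \<longrightarrow> \<phi> t \<le> q t)}"
    have N: "negligible N" using le by (simp add: AE_lebesgue_iff_negligible N_def)
    have "((\<lambda>t. if t \<in> N then 0 else \<phi> t) has_integral integral {a..b} \<phi>) {a..b}"
      by (rule has_integral_spike[OF N _ integrable_integral[OF \<phi>]]) auto
    moreover have "((\<lambda>t. if t \<in> N then 0 else q t) has_integral (w b - w a)) {a..b}"
      by (rule has_integral_spike[OF N _ q]) auto
    ultimately show ?thesis by (rule has_integral_le) (auto simp: N_def)
  qed
  show "w b - w a \<le> integral {a..b} \<phi>" if le: "AE l in lebesgue. l \<in> {a..b} \<longrightarrow> q l \<le> \<phi> l"
  proof -
    define N where "N = {t. \<not> (t \<in> {a..b} \<longrightarrow> q t \<le> \<phi> t)}"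
    have N: "negligible N" using le by (simp add: AE_lebesgue_iff_negligible N_def)
    have "((\<lambda>t. if t \<in> N then 0 else q t) has_integral (w b - w a)) {a..b}"
      by (rule has_integral_spike[OF N _ q]) auto
    moreover have "((\<lambda>t. if t \<in> N then 0 else \<phi> t) has_integral integral {a..b} \<phi>) {a..b}"
      by (rule has_integral_spike[OF N _ integrable_integral[OF \<phi>]]) auto
    ultimately show ?thesis by (rule has_integral_le) (auto simp: N_def)
  qed
qed

text \<open>With \<open>d = a - r\<close>, strong concavity gives \<open>g\<^sub>x(t, a) \<le> d' / d - \<delta> d\<close> and
  \<open>g\<^sub>x(t, r) \<ge> d' / d + \<delta> d\<close>.\<close>

lemma attractor_repeller_pairI:
  assumes g: "admissible g"
    and a: "global_solution g a" "\<And>t. \<bar>a t\<bar> \<le> M"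
    and r: "global_solution g r" "\<And>t. \<bar>r t\<bar> \<le> M"
    and \<epsilon>: "\<epsilon> > 0" "\<And>t. a t - r t \<ge> \<epsilon>"
    and extremal: "\<And>x t. global_solution g x \<Longrightarrow> bounded (range x) \<Longrightarrow> r t \<le> x t \<and> x t \<le> a t"
  shows "attractor_repeller_pair g a r"
proof -
  define d where "d t = a t - r t" for t
  have d_pos: "d t > 0" and d_ge: "d t \<ge> \<epsilon>" for t
    using \<epsilon>(1) \<epsilon>(2)[of t] unfolding d_def by linarith+
  have d_le: "d t \<le> 2 * M" for t using a(2)[of t] r(2)[of t] unfolding d_def by linarith
  have M: "M > 0" using d_pos[of 0] d_le[of 0] by linarith
  define p where "p t = (g t (a t) - g t (r t)) / d t" for t
  have lnd: "ac_derivative UNIV (\<lambda>t. ln (d t)) p"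
    unfolding p_def[abs_def]
  proof (rule ac_derivative_ln)
    show "ac_derivative UNIV d (\<lambda>t. g t (a t) - g t (r t))"
      unfolding d_def[abs_def] by (rule ac_derivative_diff[OF a(1) r(1)])
  qed (rule d_pos)
  obtain \<delta> where \<delta>: "\<delta> > 0" "AE t in lebesgue. \<forall>x y. \<bar>x\<bar> \<le> M \<longrightarrow> \<bar>y\<bar> \<le> M \<longrightarrow>
        g t y \<le> g t x + partial_x g t x * (y - x) - \<delta> * (y - x)\<^sup>2"
    using g unfolding admissible_def by blast
  \<comment> \<open>The concavity surplus per unit of \<open>d\<close> is
    \<open>\<delta> * d\<close>, hence at least \<open>\<delta> * \<epsilon>\<close>.\<close>
  define \<beta> where "\<beta> = \<delta> * \<epsilon>"
  have \<beta>: "\<beta> > 0" using \<delta> \<epsilon> by (simp add: \<beta>_def)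
  have slopes: "AE t in lebesgue. partial_x g t (a t) \<le> p t - \<beta> \<and> p t + \<beta> \<le> partial_x g t (r t)"
    using \<delta>(2)
  proof eventually_elim
    case (elim t)
    have "\<beta> * d t \<le> \<delta> * (d t)\<^sup>2"
      using d_ge[of t] d_pos[of t] \<delta>(1) by (simp add: \<beta>_def power2_eq_square)
    moreover have "g t (r t) \<le> g t (a t) + partial_x g t (a t) * (r t - a t) - \<delta> * (r t - a t)\<^sup>2"
      using elim a(2) r(2) by blast
    moreover have "g t (a t) \<le> g t (r t) + partial_x g t (r t) * (a t - r t) - \<delta> * (a t - r t)\<^sup>2"
      using elim a(2) r(2) by blast
    moreover have "(r t - a t)\<^sup>2 = (d t)\<^sup>2" "(a t - r t)\<^sup>2 = (d t)\<^sup>2"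
      by (simp_all add: d_def power2_commute)
    moreover have "a t = r t + d t" by (simp add: d_def)
    ultimately have "partial_x g t (a t) * d t \<le> (g t (a t) - g t (r t)) - \<beta> * d t"
      "(g t (a t) - g t (r t)) + \<beta> * d t \<le> partial_x g t (r t) * d t"
      by (simp_all add: algebra_simps)
    then show ?case
      using d_pos[of t] by (simp add: p_def field_simps)
  qed
  have inta: "(\<lambda>l. partial_x g l (a l)) absolutely_integrable_on {u..v}" for u v
    by (rule partial_x_absolutely_integrable[OF g a])
  have intr: "(\<lambda>l. partial_x g l (r l)) absolutely_integrable_on {u..v}" for u v
    by (rule partial_x_absolutely_integrable[OF g r])
  have int: "(\<lambda>l. partial_x g l (a l)) integrable_on {u..v}" "(\<lambda>l. partial_x g l (r l)) integrable_on {u..v}" for u v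
    using inta intr by (simp_all add: absolutely_integrable_on_def)
  \<comment> \<open>Since \<open>d\<close> takes values between \<open>\<epsilon>\<close> and
    \<open>2 * M\<close>, this bounds the exponential of every increment of
    \<open>ln d\<close>.\<close>
  define k where "k = max 1 (2 * M / \<epsilon>)"
  have k: "k \<ge> 1" by (simp add: k_def)
  have ratio: "exp (ln (d u) - ln (d v)) \<le> k" for u v
  proof -
    have "exp (ln (d u) - ln (d v)) = d u / d v" using d_pos[of u] d_pos[of v] by (simp add: exp_diff)
    also have "\<dots> \<le> 2 * M / \<epsilon>" using d_le[of u] d_ge[of v] d_pos[of u] \<epsilon>(1) M by (intro frac_le) auto
    also have "\<dots> \<le> k" by (simp add: k_def)
    finally show ?thesis .
  qed
  have attr: "exp (LINT l=ereal s..ereal t|lebesgue. partial_x g l (a l)) \<le> k * exp (- \<beta> * (t - s))"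
    if "s \<le> t" for s t
  proof -
    have "integral {s..t} (\<lambda>l. partial_x g l (a l)) \<le> (ln (d t) + (- \<beta> * t + 0)) - (ln (d s) + (- \<beta> * s + 0))"
    proof (rule integral_le_increment(1)[OF ac_derivative_add[OF lnd ac_derivative_linear] _ that int(1)])
      show "AE l in lebesgue. l \<in> {s..t} \<longrightarrow> partial_x g l (a l) \<le> p l + - \<beta>"
        using slopes by eventually_elim simp
    qed simp
    also have "\<dots> = (ln (d t) - ln (d s)) + (- \<beta> * (t - s))" by (simp add: algebra_simps)
    finally have "exp (LINT l=ereal s..ereal t|lebesgue. partial_x g l (a l))
        \<le> exp ((ln (d t) - ln (d s)) + (- \<beta> * (t - s)))"
      using interval_lebesgue_integral_eq_integral(1)[OF inta that] by simp
    also have "\<dots> = exp (ln (d t) - ln (d s)) * exp (- \<beta> * (t - s))" by (rule exp_add)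
    also have "\<dots> \<le> k * exp (- \<beta> * (t - s))" by (intro mult_right_mono ratio) simp
    finally show ?thesis .
  qed
  have rep: "exp (LINT l=ereal s..ereal t|lebesgue. partial_x g l (r l)) \<le> k * exp (\<beta> * (t - s))"
    if "t \<le> s" for s t
  proof -
    have "(ln (d s) + (\<beta> * s + 0)) - (ln (d t) + (\<beta> * t + 0)) \<le> integral {t..s} (\<lambda>l. partial_x g l (r l))"
    proof (rule integral_le_increment(2)[OF ac_derivative_add[OF lnd ac_derivative_linear] _ that int(2)])
      show "AE l in lebesgue. l \<in> {t..s} \<longrightarrow> p l + \<beta> \<le> partial_x g l (r l)"
        using slopes by eventually_elim simp
    qed simp
    then have "- integral {t..s} (\<lambda>l. partial_x g l (r l)) \<le> (ln (d t) - ln (d s)) + \<beta> * (t - s)"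
      by (simp add: algebra_simps)
    then have "exp (LINT l=ereal s..ereal t|lebesgue. partial_x g l (r l))
        \<le> exp ((ln (d t) - ln (d s)) + \<beta> * (t - s))"
      using interval_lebesgue_integral_eq_integral(2)[OF intr that] by simp
    also have "\<dots> = exp (ln (d t) - ln (d s)) * exp (\<beta> * (t - s))" by (rule exp_add)
    also have "\<dots> \<le> k * exp (\<beta> * (t - s))" by (intro mult_right_mono ratio) simp
    finally show ?thesis .
  qed
  have bnd: "bounded (range a)" "bounded (range r)"
    using a(2) r(2) by (auto simp: bounded_iff)
  show ?thesis
    unfolding attractor_repeller_pair_def bounded_solution_def solution_iff_ac_derivative
  proof (intro conjI)
    show "\<exists>k \<beta>. k \<ge> 1 \<and> \<beta> > 0 \<and>
       (\<forall>s t. t \<ge> s \<longrightarrow>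
          exp (LINT l=ereal s..ereal t|lebesgue. partial_x g l (a l)) \<le> k * exp (- \<beta> * (t - s))) \<and>
       (\<forall>s t. t \<le> s \<longrightarrow>
          exp (LINT l=ereal s..ereal t|lebesgue. partial_x g l (r l)) \<le> k * exp (\<beta> * (t - s)))"
      by (rule exI[of _ k], rule exI[of _ \<beta>]) (intro conjI allI impI k \<beta> attr rep)
    show "\<forall>x. (is_interval UNIV \<and> global_solution g x) \<and> bounded (range x) \<longrightarrow>
        (\<forall>t. r t \<le> x t \<and> x t \<le> a t)"
      using extremal by blast
  qed (use a(1) r(1) bnd in simp_all)
qed

text \<open>If \<open>a\<close> and \<open>r\<close> are very close at \<open>t0\<close>, they stay close on a long interval around \<open>t0\<close>, on
  which \<open>g\<^sub>x\<close> would then have nearly the same integral along both solutions.\<close>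

lemma attractor_repeller_pair_gap:
  assumes g: "admissible g" and gx: "locally_lipschitz (partial_x g)"
    and pair: "attractor_repeller_pair g a r"
  shows "\<exists>\<epsilon>>0. \<forall>t. a t - r t \<ge> \<epsilon>"
proof -
  have ab: "bounded_solution g a" "bounded_solution g r"
    and ra: "r t \<le> a t" for t
    using pair unfolding attractor_repeller_pair_def by blast+
  have a: "global_solution g a" and r: "global_solution g r"
    using ab by (simp_all add: bounded_solution_def solution_iff_ac_derivative)
  obtain M1 where M1: "\<And>t. \<bar>a t\<bar> \<le> M1" using ab(1) by (auto simp: bounded_solution_def bounded_iff)
  obtain M2 where M2: "\<And>t. \<bar>r t\<bar> \<le> M2" using ab(2) by (auto simp: bounded_solution_def bounded_iff)
  define M where "M = max M1 M2"
  have M: "\<bar>a t\<bar> \<le> M" "\<bar>r t\<bar> \<le> M" for t using M1[of t] M2[of t] by (auto simp: M_def)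
  obtain k \<beta> where k: "k \<ge> 1" and \<beta>: "\<beta> > 0"
    and attr: "\<And>s t. s \<le> t \<Longrightarrow> exp (LINT l=ereal s..ereal t|lebesgue. partial_x g l (a l)) \<le> k * exp (- \<beta> * (t - s))"
    and rep: "\<And>s t. t \<le> s \<Longrightarrow> exp (LINT l=ereal s..ereal t|lebesgue. partial_x g l (r l)) \<le> k * exp (\<beta> * (t - s))"
    using pair unfolding attractor_repeller_pair_def by auto
  have inta: "(\<lambda>l. partial_x g l (a l)) absolutely_integrable_on {u..v}" for u v
    by (rule partial_x_absolutely_integrable[OF g a M(1)])
  have intr: "(\<lambda>l. partial_x g l (r l)) absolutely_integrable_on {u..v}" for u v
    by (rule partial_x_absolutely_integrable[OF g r M(2)])
  have int: "(\<lambda>l. partial_x g l (a l)) integrable_on {u..v}" "(\<lambda>l. partial_x g l (r l)) integrable_on {u..v}" for u v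
    using inta intr by (simp_all add: absolutely_integrable_on_def)
  have lip: "locally_lipschitz g" using g by (simp add: admissible_def caratheodory_def)
  obtain L where L: "L \<ge> 0" "AE t in lebesgue. \<forall>x y. \<bar>x\<bar> \<le> M \<longrightarrow> \<bar>y\<bar> \<le> M \<longrightarrow> \<bar>g t x - g t y\<bar> \<le> L * \<bar>x - y\<bar>"
    by (rule locally_lipschitz_nonneg[OF lip], rule that)
  obtain l where l: "l \<ge> 0" "AE t in lebesgue. \<forall>x y. \<bar>x\<bar> \<le> M \<longrightarrow> \<bar>y\<bar> \<le> M \<longrightarrow>
      \<bar>partial_x g t x - partial_x g t y\<bar> \<le> l * \<bar>x - y\<bar>"
    by (rule locally_lipschitz_nonneg[OF gx], rule that)
  \<comment> \<open>Chosen so that \<open>2 * \<beta> * T = ln k + 1\<close>: over an interval of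
    length \<open>2 * T\<close> the integral of \<open>partial_x\<close> is then at most -1 along
    \<open>a\<close> and at least 1 along \<open>r\<close>.\<close>
  define T where "T = (ln k + 1) / (2 * \<beta>)"
  have T: "T > 0" using k \<beta> by (simp add: T_def add_nonneg_pos)
  define d where "d t = a t - r t" for t
  have d0: "d t \<ge> 0" for t using ra[of t] by (simp add: d_def)
  have acd: "ac_derivative UNIV d (\<lambda>t. g t (a t) - g t (r t))"
    unfolding d_def[abs_def] by (rule ac_derivative_diff[OF a r])
  have d': "AE t in lebesgue. \<bar>g t (a t) - g t (r t)\<bar> \<le> L * d t"
    using L(2)
  proof eventually_elim
    case (elim t)
    have "\<bar>g t (a t) - g t (r t)\<bar> \<le> L * \<bar>a t - r t\<bar>" using elim M by blast
    then show ?case using ra[of t] by (simp add: d_def)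
  qed
  \<comment> \<open>Both are solutions, so the derivative of \<open>d\<close> is at most
    \<open>L * d\<close> in absolute value, and the growth estimates apply in either time
    direction.\<close>
  have near: "d t \<le> d t0 * exp (L * T)" if t: "\<bar>t - t0\<bar> \<le> T" for t t0
  proof (cases "d t > 0")
    case True
    have "exp (- L * \<bar>t - t0\<bar>) * d t \<le> d t0"
    proof (cases "t0 \<le> t")
      case t0: True
      have "AE l in lebesgue. l \<in> {t0..t} \<longrightarrow> d l > 0 \<longrightarrow> g l (a l) - g l (r l) \<le> L * d l"
        using d' by eventually_elim (simp add: abs_le_iff)
      from positive_backward[OF ac_derivative_subset[OF acd] t0 True this] t0 show ?thesis by simp
    next
      case False
      then have t0: "t \<le> t0" by simp
      have "AE l in lebesgue. l \<in> {t..t0} \<longrightarrow> d l > 0 \<longrightarrow> g l (a l) - g l (r l) \<ge> - L * d l"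
        using d' by eventually_elim (simp add: abs_le_iff)
      from positive_forward[OF ac_derivative_subset[OF acd] t0 True this] t0 show ?thesis by simp
    qed
    moreover have "exp (- L * T) \<le> exp (- L * \<bar>t - t0\<bar>)"
      using mult_left_mono[OF t L(1)] by simp
    then have "exp (- L * T) * d t \<le> exp (- L * \<bar>t - t0\<bar>) * d t"
      using True by (intro mult_right_mono) auto
    ultimately have "exp (- L * T) * d t \<le> d t0" by linarith
    moreover have "exp (- L * T) = 1 / exp (L * T)" by (simp add: exp_minus inverse_eq_divide)
    ultimately show ?thesis by (simp add: pos_divide_le_eq mult.commute)
  next
    case False
    moreover have "0 \<le> d t0 * exp (L * T)" using d0[of t0] by simp
    ultimately show ?thesis by linarith
  qed
  \<comment> \<open>The two integrals differ by at least 2 and by at most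
    \<open>2 * T * (l + 1) * exp (L * T) * d t0\<close>; solving for \<open>d t0\<close> gives this
    value.\<close>
  define \<epsilon> where "\<epsilon> = 1 / (T * (l + 1) * exp (L * T))"
  have \<epsilon>: "\<epsilon> > 0" using T l(1) by (simp add: \<epsilon>_def)
  have "d t0 \<ge> \<epsilon>" for t0
  proof -
    let ?s = "t0 - T" and ?t = "t0 + T"
    let ?A = "integral {?s..?t} (\<lambda>l. partial_x g l (a l))"
    let ?R = "integral {?s..?t} (\<lambda>l. partial_x g l (r l))"
    have st: "?s \<le> ?t" using T by simp
    have two: "- \<beta> * (?t - ?s) = - (2 * \<beta> * T)" "\<beta> * (?s - ?t) = - (2 * \<beta> * T)" by (simp_all add: algebra_simps)
    have logk: "k * exp (- (2 * \<beta> * T)) = exp (ln k - 2 * \<beta> * T)"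
      using k by (simp add: exp_diff exp_minus field_simps)
    have "exp ?A \<le> k * exp (- (2 * \<beta> * T))"
      using attr[OF st] unfolding interval_lebesgue_integral_eq_integral(1)[OF inta st] two(1) .
    then have A: "?A \<le> ln k - 2 * \<beta> * T" unfolding logk by simp
    have "exp (- ?R) \<le> k * exp (- (2 * \<beta> * T))"
      using rep[OF st] unfolding interval_lebesgue_integral_eq_integral(2)[OF intr st] two(2) .
    then have R: "- ?R \<le> ln k - 2 * \<beta> * T" unfolding logk by simp
    define c where "c = (l + 1) * (d t0 * exp (L * T))"
    have "integral {?s..?t} (\<lambda>l. partial_x g l (r l) - partial_x g l (a l)) \<le> (c * ?t + 0) - (c * ?s + 0)"
    proof (rule integral_le_increment(1)[OF ac_derivative_linear[of UNIV] _ st integrable_diff[OF int(2,1)]])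
      show "AE u in lebesgue. u \<in> {?s..?t} \<longrightarrow> partial_x g u (r u) - partial_x g u (a u) \<le> c"
        using l(2)
      proof eventually_elim
        case (elim u)
        show ?case
        proof
          assume "u \<in> {?s..?t}"
          then have "\<bar>u - t0\<bar> \<le> T" by auto
          have "\<bar>partial_x g u (r u) - partial_x g u (a u)\<bar> \<le> l * \<bar>r u - a u\<bar>" using elim M by blast
          moreover have "\<bar>r u - a u\<bar> = d u" using ra[of u] by (simp add: d_def)
          moreover have "l * d u \<le> (l + 1) * d u" using d0[of u] by (simp add: distrib_right)
          moreover have "(l + 1) * d u \<le> c"
            unfolding c_def using near[OF \<open>\<bar>u - t0\<bar> \<le> T\<close>] l(1) by (intro mult_left_mono) auto
          ultimately show "partial_x g u (r u) - partial_x g u (a u) \<le> c" by (simp add: abs_le_iff)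
        qed
      qed
    qed simp
    then have "?R - ?A \<le> 2 * T * c"
      using integral_diff[OF int(2,1), of ?s ?t] by (simp add: algebra_simps)
    moreover have "2 * \<beta> * T = ln k + 1" using \<beta> by (simp add: T_def)
    ultimately have "2 \<le> 2 * T * c" using A R by linarith
    then have "1 \<le> d t0 * (T * (l + 1) * exp (L * T))" by (simp add: c_def mult_ac)
    then show ?thesis using T l(1) by (simp add: \<epsilon>_def pos_divide_le_eq)
  qed
  then show ?thesis using \<epsilon> by (auto simp: d_def)
qed

text \<open>By strong concavity the midpoint of the pair is a strict lower solution, and it remains one
  under small shifts.\<close>

lemma midpoint_strict_lower_solution:
  assumes f: "admissible f"
    and a: "global_solution f a" "\<And>t. \<bar>a t\<bar> \<le> M"
    and r: "global_solution f r" "\<And>t. \<bar>r t\<bar> \<le> M"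
    and \<epsilon>: "\<epsilon> > 0" "\<And>t. a t - r t \<ge> \<epsilon>"
  obtains b b' \<kappa> \<eta> C where "\<kappa> > 0" "\<eta> > 0" "ac_derivative UNIV b b'" "\<And>t. \<bar>b t\<bar> \<le> M"
    "AE t in lebesgue. \<bar>b' t\<bar> \<le> C" "AE t in lebesgue. \<forall>z. \<bar>z\<bar> \<le> \<eta> \<longrightarrow> b' t \<le> f t (b t + z) - \<kappa>"
proof -
  define b where "b t = 1 / 2 * (a t + r t)" for t
  define b' where "b' t = 1 / 2 * (f t (a t) + f t (r t))" for t
  have acb: "ac_derivative UNIV b b'"
    unfolding b_def[abs_def] b'_def[abs_def] by (rule ac_derivative_cmult[OF ac_derivative_add[OF a(1) r(1)]])
  have b: "\<bar>b t\<bar> \<le> M" for t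
    using a(2)[of t] r(2)[of t] by (auto simp: b_def abs_le_iff)
  obtain C where "AE t in lebesgue. \<forall>x. \<bar>x\<bar> \<le> M \<longrightarrow> \<bar>f t x\<bar> \<le> C"
    using f unfolding admissible_def caratheodory_def locally_bounded_def by blast
  then have b'_bounded: "AE t in lebesgue. \<bar>b' t\<bar> \<le> C"
  proof eventually_elim
    case (elim t)
    then have "\<bar>f t (a t)\<bar> \<le> C" "\<bar>f t (r t)\<bar> \<le> C" using a(2) r(2) by blast+
    then show ?case by (auto simp: b'_def abs_le_iff)
  qed
  obtain \<delta> where \<delta>: "\<delta> > 0" "AE t in lebesgue. \<forall>x y. \<bar>x\<bar> \<le> M \<longrightarrow> \<bar>y\<bar> \<le> M \<longrightarrow>
        f t y \<le> f t x + partial_x f t x * (y - x) - \<delta> * (y - x)\<^sup>2"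
    using f unfolding admissible_def by blast
  \<comment> \<open>Concavity at the midpoint yields a surplus of at least
    \<open>\<delta> * (\<epsilon> / 2)\<^sup>2\<close>. One half becomes the margin, the other half
    pays for the shift \<open>z\<close>.\<close>
  define \<kappa> where "\<kappa> = \<delta> * (\<epsilon> / 2)\<^sup>2 / 2"
  have \<kappa>: "\<kappa> > 0" using \<delta>(1) \<epsilon>(1) by (simp add: \<kappa>_def)
  have lip: "locally_lipschitz f" using f by (simp add: admissible_def caratheodory_def)
  obtain L where L: "L \<ge> 0" "AE t in lebesgue. \<forall>x y. \<bar>x\<bar> \<le> M + 1 \<longrightarrow> \<bar>y\<bar> \<le> M + 1 \<longrightarrow>
      \<bar>f t x - f t y\<bar> \<le> L * \<bar>x - y\<bar>"
    by (rule locally_lipschitz_nonneg[OF lip], rule that)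
  \<comment> \<open>Ensures \<open>L * \<eta> \<le> \<kappa>\<close> and keeps the shifted midpoint
    within \<open>M + 1\<close>, where \<open>L\<close> is a Lipschitz constant.\<close>
  define \<eta> where "\<eta> = min 1 (\<kappa> / (L + 1))"
  have \<eta>: "\<eta> > 0" using \<kappa> L(1) by (simp add: \<eta>_def)
  have L\<eta>: "L * \<eta> \<le> \<kappa>"
  proof -
    have "L * \<eta> \<le> (L + 1) * (\<kappa> / (L + 1))"
      using L(1) \<eta> by (intro mult_mono) (auto simp: \<eta>_def)
    then show ?thesis using L(1) by simp
  qed
  have "AE t in lebesgue. \<forall>z. \<bar>z\<bar> \<le> \<eta> \<longrightarrow> b' t \<le> f t (b t + z) - \<kappa>"
    using \<delta>(2) L(2)
  proof eventually_elim
    case (elim t)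
    show ?case
    proof (intro allI impI)
      fix z assume z: "\<bar>z\<bar> \<le> \<eta>"
      let ?d = "(a t - r t) / 2"
      have ab: "a t - b t = ?d" and rb: "r t - b t = - ?d" by (simp_all add: b_def field_simps)
      have "f t (a t) \<le> f t (b t) + partial_x f t (b t) * (a t - b t) - \<delta> * (a t - b t)\<^sup>2"
        using elim(1) a(2) b by blast
      moreover have "f t (r t) \<le> f t (b t) + partial_x f t (b t) * (r t - b t) - \<delta> * (r t - b t)\<^sup>2"
        using elim(1) r(2) b by blast
      ultimately have "b' t \<le> f t (b t) - \<delta> * ?d\<^sup>2"
        unfolding ab rb b'_def by simp
      moreover have "\<delta> * (\<epsilon> / 2)\<^sup>2 \<le> \<delta> * ?d\<^sup>2"
        using \<delta>(1) \<epsilon>(1) \<epsilon>(2)[of t] by (intro mult_left_mono power_mono) auto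
      moreover have "2 * \<kappa> = \<delta> * (\<epsilon> / 2)\<^sup>2" by (simp add: \<kappa>_def)
      moreover have "\<bar>f t (b t) - f t (b t + z)\<bar> \<le> \<kappa>"
      proof -
        have "\<bar>b t\<bar> \<le> M + 1" "\<bar>b t + z\<bar> \<le> M + 1"
          using b[of t] z unfolding \<eta>_def by linarith+
        then have "\<bar>f t (b t) - f t (b t + z)\<bar> \<le> L * \<bar>b t - (b t + z)\<bar>" using elim(2) by blast
        also have "\<dots> \<le> L * \<eta>" using z L(1) by (intro mult_left_mono) auto
        finally show ?thesis using L\<eta> by simp
      qed
      ultimately show "b' t \<le> f t (b t + z) - \<kappa>" by linarith
    qed
  qed
  with \<kappa> \<eta> acb b b'_bounded show thesis by (rule that)
qed

section \<open>The piecewise constant perturbation\<close>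

lemma step_fun_borel_measurable:
  assumes "continuous_on UNIV \<Gamma>"
  shows "step_fun h \<Gamma> \<in> borel_measurable borel"
proof -
  have "\<Gamma> \<in> borel_measurable borel" by (rule borel_measurable_continuous_onI[OF assms])
  moreover have "(\<lambda>t. of_int \<lfloor>t / h\<rfloor> * h) \<in> borel_measurable (borel :: real measure)" by measurable
  ultimately show ?thesis unfolding step_fun_def[abs_def] by (rule measurable_compose[rotated])
qed

lemma step_fun_eq:
  assumes "h > 0" and "of_int j * h \<le> t" and "t < of_int (j + 1) * h"
  shows "step_fun h \<Gamma> t = \<Gamma> (of_int j * h)"
proof -
  have "\<lfloor>t / h\<rfloor> = j"
    using assms by (intro floor_unique) (auto simp: pos_le_divide_eq pos_divide_less_eq)
  then show ?thesis by (simp add: step_fun_def)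
qed

text \<open>The sampling point lies between \<open>t - h\<close> and \<open>t\<close>, so it tends
  to infinity together with \<open>t\<close>.\<close>

lemma step_fun_tendsto:
  assumes h: "h > 0"
  shows "(\<Gamma> \<longlongrightarrow> \<gamma>) at_top \<Longrightarrow> (step_fun h \<Gamma> \<longlongrightarrow> \<gamma>) at_top"
    and "(\<Gamma> \<longlongrightarrow> \<gamma>) at_bot \<Longrightarrow> (step_fun h \<Gamma> \<longlongrightarrow> \<gamma>) at_bot"
proof -
  have bounds: "t - h \<le> of_int \<lfloor>t / h\<rfloor> * h" "of_int \<lfloor>t / h\<rfloor> * h \<le> t" for t
  proof -
    have "t / h * h \<le> (of_int \<lfloor>t / h\<rfloor> + 1) * h" "of_int \<lfloor>t / h\<rfloor> * h \<le> t / h * h"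
      using h by (intro mult_right_mono; linarith)+
    moreover have "t / h * h = t" using h by simp
    ultimately show "t - h \<le> of_int \<lfloor>t / h\<rfloor> * h" "of_int \<lfloor>t / h\<rfloor> * h \<le> t"
      by (simp_all add: distrib_right)
  qed
  have "filterlim (\<lambda>t. of_int \<lfloor>t / h\<rfloor> * h) at_top at_top"
    unfolding filterlim_at_top
  proof
    fix Z
    have "t \<ge> Z + h \<Longrightarrow> Z \<le> of_int \<lfloor>t / h\<rfloor> * h" for t using bounds(1)[of t] by linarith
    then show "\<forall>\<^sub>F t in at_top. Z \<le> of_int \<lfloor>t / h\<rfloor> * h"
      unfolding eventually_at_top_linorder by blast
  qed
  then show "(\<Gamma> \<longlongrightarrow> \<gamma>) at_top \<Longrightarrow> (step_fun h \<Gamma> \<longlongrightarrow> \<gamma>) at_top"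
    unfolding step_fun_def[abs_def] by (rule filterlim_compose[rotated])
  have "filterlim (\<lambda>t. of_int \<lfloor>t / h\<rfloor> * h) at_bot at_bot"
    unfolding filterlim_at_bot
  proof
    fix Z
    have "t \<le> Z \<Longrightarrow> of_int \<lfloor>t / h\<rfloor> * h \<le> Z" for t using bounds(2)[of t] by linarith
    then show "\<forall>\<^sub>F t in at_bot. of_int \<lfloor>t / h\<rfloor> * h \<le> Z"
      unfolding eventually_at_bot_linorder by blast
  qed
  then show "(\<Gamma> \<longlongrightarrow> \<gamma>) at_bot \<Longrightarrow> (step_fun h \<Gamma> \<longlongrightarrow> \<gamma>) at_bot"
    unfolding step_fun_def[abs_def] by (rule filterlim_compose[rotated])
qed

text \<open>On \<open>[jh, (j+1)h)\<close> the function \<open>a - \<Gamma>(jh)\<close> solves the unperturbed equation, so the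
  bounded solution \<open>X\<close> below it prevents \<open>a\<close> from blowing up.\<close>

lemma upper_special_solution_step:
  assumes lip: "locally_lipschitz f" and h: "h > 0"
    and a: "upper_special_solution (perturbed f h \<Gamma>) D a"
    and X: "global_solution f X" "\<And>t. \<bar>X t\<bar> \<le> M"
    and D: "of_int j * h \<in> D" and le: "X (of_int j * h) \<le> a (of_int j * h) - \<Gamma> (of_int j * h)"
  shows "of_int (j + 1) * h \<in> D"
    and "X (of_int (j + 1) * h) \<le> a (of_int (j + 1) * h) - \<Gamma> (of_int j * h)"
proof -
  define s where "s = of_int j * h"
  have s': "of_int (j + 1) * h = s + h" by (simp add: s_def distrib_right)
  have sol: "ac_derivative D a (\<lambda>t. perturbed f h \<Gamma> t (a t))" and D_cases: "D = UNIV \<or> (\<exists>c. D = {..<c} \<and> filterlim a at_bot (at_left c))"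
    using a by (simp_all add: upper_special_solution_def maximal_solution_def solution_iff_ac_derivative)
  have below: "X t \<le> a t - \<Gamma> s" if t: "t \<in> D" "s \<le> t" "t \<le> s + h" for t
  proof -
    have sub: "{s..t} \<subseteq> D" using D_cases t by auto
    define y where "y t = a t - \<Gamma> s" for t
    have acy: "ac_derivative {s..t} y (\<lambda>t. perturbed f h \<Gamma> t (a t) - 0)"
      unfolding y_def[abs_def]
      by (rule ac_derivative_diff[OF ac_derivative_subset[OF sol sub] ac_derivative_const])
    have "X t \<le> y t"
    proof (rule compare_solutions(2)[OF lip ac_derivative_subset[OF X(1)] acy _ _ t(2)])
      \<comment> \<open>At the right end of the step the perturbation already has its next value,
        but a single point is a null set.\<close>
      have "AE l in lebesgue. l \<noteq> s + h"
        unfolding AE_lebesgue_iff_negligible by (rule negligible_subset[of "{s + h}"]) auto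
      then show "AE l in lebesgue. l \<in> {s..t} \<longrightarrow> f l (y l) \<le> perturbed f h \<Gamma> l (a l) - 0"
      proof eventually_elim
        case (elim l)
        show ?case
        proof
          assume "l \<in> {s..t}"
          then have "step_fun h \<Gamma> l = \<Gamma> s"
            unfolding s_def using elim t(3) s' by (intro step_fun_eq[OF h]) (auto simp: s_def)
          then show "f l (y l) \<le> perturbed f h \<Gamma> l (a l) - 0" by (simp add: perturbed_def y_def)
        qed
      qed
    qed (use le in \<open>auto simp: y_def s_def\<close>)
    then show ?thesis by (simp add: y_def)
  qed
  have "s + h \<in> D"
  proof (rule ccontr)
    assume nD: "s + h \<notin> D"
    then obtain c where c: "D = {..<c}" "filterlim a at_bot (at_left c)" using D_cases by blast
    have sc: "s < c" "c \<le> s + h" using D nD c(1) by (auto simp: s_def)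
    have "\<forall>\<^sub>F t in at_left c. a t \<le> \<Gamma> s - M - 1"
      using c(2) unfolding filterlim_at_bot by blast
    moreover have "\<forall>\<^sub>F t in at_left c. t \<in> {s<..<c}"
      by (rule eventually_at_left_real[OF sc(1)])
    ultimately have "\<forall>\<^sub>F t in at_left c. False"
    proof eventually_elim
      case (elim t)
      then have "X t \<le> a t - \<Gamma> s" using sc c(1) by (intro below) auto
      then show False using elim(1) X(2)[of t] by linarith
    qed
    then show False by simp
  qed
  with below[of "s + h"] h s' show "of_int (j + 1) * h \<in> D"
    "X (of_int (j + 1) * h) \<le> a (of_int (j + 1) * h) - \<Gamma> (of_int j * h)"
    by (simp_all add: s_def)
qed

section \<open>From ordered special solutions to an attractor-repeller pair\<close>

lemma bounded_global_solution:
  assumes x: "ac_derivative UNIV x p" and top: "Bfun x at_top" and bot: "Bfun x at_bot"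
  obtains M where "\<And>t. \<bar>x t\<bar> \<le> M"
proof -
  obtain K1 T1 where K1: "\<And>t. t \<ge> T1 \<Longrightarrow> \<bar>x t\<bar> \<le> K1"
    using top unfolding Bfun_def eventually_at_top_linorder by auto
  obtain K2 T2 where K2: "\<And>t. t \<le> T2 \<Longrightarrow> \<bar>x t\<bar> \<le> K2"
    using bot unfolding Bfun_def eventually_at_bot_linorder by auto
  obtain K3 where K3: "\<And>t. t \<in> {T2..T1} \<Longrightarrow> \<bar>x t\<bar> \<le> K3"
    by (rule ac_derivative_bounded_on_interval[OF ac_derivative_subset[OF x subset_UNIV]], rule that)
  have "\<bar>x t\<bar> \<le> max K1 (max K2 K3)" for t
    using K1[of t] K2[of t] K3[of t] by (cases "t \<ge> T1"; cases "t \<le> T2") auto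
  then show thesis by (rule that)
qed

text \<open>Away from the two half-lines a compact interval remains, on which the positive
  continuous difference attains its minimum.\<close>

lemma uniform_gap:
  assumes a: "ac_derivative UNIV a p" and r: "ac_derivative UNIV r q" and ra: "\<And>t. r t < a t"
    and bot: "\<exists>\<epsilon>>0. \<exists>S. \<forall>t\<le>S. a t - r t \<ge> \<epsilon>" and top: "\<exists>\<epsilon>>0. \<exists>S. \<forall>t\<ge>S. a t - r t \<ge> \<epsilon>"
  obtains \<epsilon> where "\<epsilon> > (0 :: real)" "\<And>t. a t - r t \<ge> \<epsilon>"
proof -
  obtain e1 S1 where e1: "e1 > 0" "\<And>t. t \<le> S1 \<Longrightarrow> a t - r t \<ge> e1" using bot by blast
  obtain e2 S2 where e2: "e2 > 0" "\<And>t. t \<ge> S2 \<Longrightarrow> a t - r t \<ge> e2" using top by blast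
  \<comment> \<open>Taking \<open>min\<close> and \<open>max\<close> keeps the interval nonempty
    when the half-lines overlap.\<close>
  have cont: "continuous_on {min S1 S2..max S1 S2} (\<lambda>t. a t - r t)"
    by (rule ac_derivative_continuous_on[OF ac_derivative_diff[OF a r] subset_UNIV])
  have "{min S1 S2..max S1 S2} \<noteq> {}" by simp
  from continuous_attains_inf[OF compact_Icc this cont]
  obtain t0 where t0: "\<forall>t\<in>{min S1 S2..max S1 S2}. a t0 - r t0 \<le> a t - r t" by blast
  have "a t - r t \<ge> min e1 (min e2 (a t0 - r t0))" for t
    using e1(2)[of t] e2(2)[of t] t0[rule_format, of t] by (cases "t \<le> S1"; cases "t \<ge> S2") auto
  moreover have "min e1 (min e2 (a t0 - r t0)) > 0" using e1 e2 ra[of t0] by simp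
  ultimately show thesis by (rule that[rotated])
qed

text \<open>As soon as the two special solutions are ordered at one point, each inherits the boundedness
  of the other at the opposite end.\<close>

lemma special_solutions_bounded:
  assumes a: "upper_special_solution g D_a a" and r: "lower_special_solution g D_r r"
    and s: "s \<in> D_a" "s \<in> D_r" "r s \<le> a s"
  shows "D_a = UNIV" and "D_r = UNIV"
    and "Bfun a at_top" and "Bfun a at_bot" and "Bfun r at_top" and "Bfun r at_bot"
proof -
  have a': "maximal_solution g D_a a" "D_a = UNIV \<or> (\<exists>c. D_a = {..<c})"
    and char_a: "\<And>I x. maximal_solution g I x \<Longrightarrow> s \<in> I \<Longrightarrow>
        (\<forall>\<^sub>F t in at_bot. t \<in> I) \<and> Bfun x at_bot \<longleftrightarrow> x s \<le> a s"
    using a s(1) unfolding upper_special_solution_def by blast+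
  have r': "maximal_solution g D_r r" "D_r = UNIV \<or> (\<exists>c. D_r = {c<..})"
    and char_r: "\<And>I x. maximal_solution g I x \<Longrightarrow> s \<in> I \<Longrightarrow>
        (\<forall>\<^sub>F t in at_top. t \<in> I) \<and> Bfun x at_top \<longleftrightarrow> r s \<le> x s"
    using r s(2) unfolding lower_special_solution_def by blast+
  have top: "\<forall>\<^sub>F t in at_top. t \<in> D_a" and bot: "\<forall>\<^sub>F t in at_bot. t \<in> D_r"
    using char_r[OF a'(1) s(1)] char_a[OF r'(1) s(2)] s(3) by auto
  show "Bfun a at_top" "Bfun a at_bot" "Bfun r at_top" "Bfun r at_bot"
    using char_r[OF a'(1) s(1)] char_a[OF a'(1) s(1)] char_r[OF r'(1) s(2)] char_a[OF r'(1) s(2)] s(3)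
    by auto
  show "D_a = UNIV"
  proof (rule ccontr)
    assume "D_a \<noteq> UNIV"
    then obtain c where "D_a = {..<c}" using a'(2) by blast
    with top obtain T where "\<forall>t\<ge>T. t < c" unfolding eventually_at_top_linorder by auto
    from this[rule_format, of "max T c"] show False by simp
  qed
  show "D_r = UNIV"
  proof (rule ccontr)
    assume "D_r \<noteq> UNIV"
    then obtain c where "D_r = {c<..}" using r'(2) by blast
    with bot obtain T where "\<forall>t\<le>T. c < t" unfolding eventually_at_bot_linorder by auto
    from this[rule_format, of "min T c"] show False by simp
  qed
qed

text \<open>A bounded solution passes, at every time, both boundedness tests that characterise the
  special solutions.\<close>

lemma special_solutions_extremal:
  assumes a: "upper_special_solution g UNIV a" and r: "lower_special_solution g UNIV r"
    and x: "global_solution g x" "bounded (range x)"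
  shows "r t \<le> x t \<and> x t \<le> a t"
proof -
  have max: "maximal_solution g UNIV x" by (rule global_solution_maximal) (rule x(1))
  obtain K where "\<And>t. norm (x t) \<le> K" using x(2) by (auto simp: bounded_iff)
  then have B: "Bfun x F" for F by (intro BfunI[of _ K] always_eventually) simp
  have "(\<forall>\<^sub>F t in at_bot. t \<in> I) \<and> Bfun y at_bot \<longleftrightarrow> y s \<le> a s"
    if "maximal_solution g I y" "s \<in> I" for I y s
    using a that by (simp add: upper_special_solution_def)
  from this[OF max, of t] have "x t \<le> a t" using B by simp
  have "(\<forall>\<^sub>F t in at_top. t \<in> I) \<and> Bfun y at_top \<longleftrightarrow> r s \<le> y s"
    if "maximal_solution g I y" "s \<in> I" for I y s
    using r that by (simp add: lower_special_solution_def)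
  from this[OF max, of t] have "r t \<le> x t" using B by simp
  with \<open>x t \<le> a t\<close> show ?thesis by simp
qed

text \<open>All that follows the induction over the steps. Strict order at the single time
  \<open>s\<close> spreads to all times by uniqueness.\<close>

lemma ordered_special_solutions_pair:
  assumes f: "admissible f" and fx: "locally_lipschitz (partial_x f)"
    and pair: "attractor_repeller_pair f a_tilde r_tilde"
    and \<Gamma>: "bounded (range \<Gamma>)" "continuous_on UNIV \<Gamma>"
    and lim: "(\<Gamma> \<longlongrightarrow> \<gamma>_plus) at_top" "(\<Gamma> \<longlongrightarrow> \<gamma>_minus) at_bot" and h: "h > 0"
    and a: "upper_special_solution (perturbed f h \<Gamma>) D_a a"
    and r: "lower_special_solution (perturbed f h \<Gamma>) D_r r"
    and s: "s \<in> D_a" "s \<in> D_r" "r s < a s"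
  shows "attractor_repeller_pair (perturbed f h \<Gamma>) a r"
proof -
  let ?g = "perturbed f h \<Gamma>"
  define \<sigma> where "\<sigma> = step_fun h \<Gamma>"
  obtain B where "\<And>t. \<bar>\<Gamma> t\<bar> \<le> B" using \<Gamma>(1) by (auto simp: bounded_iff)
  then have \<sigma>: "\<bar>\<sigma> t\<bar> \<le> B" for t by (simp add: \<sigma>_def step_fun_def)
  have g_eq: "?g = (\<lambda>t x. f t (x - \<sigma> t))" by (simp add: fun_eq_iff perturbed_def \<sigma>_def)
  have g: "admissible ?g"
    unfolding g_eq using step_fun_borel_measurable[OF \<Gamma>(2)] \<sigma>
    by (intro admissible_shift[OF f]) (auto simp: \<sigma>_def)
  have cara: "caratheodory ?g" and lip: "locally_lipschitz ?g"
    using g by (simp_all add: admissible_def caratheodory_def)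
  have conc: "chord_concave ?g" by (rule admissible_chord_concave[OF g])
  obtain K0 where coer: "AE t in lebesgue. \<forall>x. K0 \<le> \<bar>x\<bar> \<longrightarrow> ?g t x \<le> 0"
    using g unfolding admissible_def by blast
  note bnd = special_solutions_bounded[OF a r s(1,2) less_imp_le[OF s(3)]]
  have a': "upper_special_solution ?g UNIV a" and r': "lower_special_solution ?g UNIV r"
    using a r bnd(1,2) by simp_all
  have ga: "global_solution ?g a" and gr: "global_solution ?g r"
    using a' r' unfolding upper_special_solution_def lower_special_solution_def maximal_solution_def
      solution_iff_ac_derivative by blast+
  have ra: "r t < a t" for t by (rule global_solutions_less[OF lip gr ga s(3)])
  have ext: "r t \<le> x t \<and> x t \<le> a t" if "global_solution ?g x" "bounded (range x)" for x t
    by (rule special_solutions_extremal[OF a' r' that])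
  obtain Ma where Ma: "\<And>t. \<bar>a t\<bar> \<le> Ma" by (rule bounded_global_solution[OF ga bnd(3,4)], rule that)
  obtain Mr where Mr: "\<And>t. \<bar>r t\<bar> \<le> Mr" by (rule bounded_global_solution[OF gr bnd(5,6)], rule that)

  have tilde: "bounded_solution f a_tilde" "bounded_solution f r_tilde"
    using pair by (simp_all add: attractor_repeller_pair_def)
  then have gat: "global_solution f a_tilde" and grt: "global_solution f r_tilde"
    by (simp_all add: bounded_solution_def solution_iff_ac_derivative)
  obtain M1 where M1: "\<And>t. \<bar>a_tilde t\<bar> \<le> M1" using tilde(1) by (auto simp: bounded_solution_def bounded_iff)
  obtain M2 where M2: "\<And>t. \<bar>r_tilde t\<bar> \<le> M2" using tilde(2) by (auto simp: bounded_solution_def bounded_iff)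
  define Mt where "Mt = max M1 M2"
  have Mt: "\<bar>a_tilde t\<bar> \<le> Mt" "\<bar>r_tilde t\<bar> \<le> Mt" for t
    using M1[of t] M2[of t] by (auto simp: Mt_def)
  obtain \<epsilon> where \<epsilon>: "\<epsilon> > 0" "\<And>t. a_tilde t - r_tilde t \<ge> \<epsilon>"
    using attractor_repeller_pair_gap[OF f fx pair] by blast
  obtain b b' \<kappa> \<eta> C where \<kappa>: "\<kappa> > 0" and \<eta>: "\<eta> > 0" and acb: "ac_derivative UNIV b b'"
    and b: "\<And>t. \<bar>b t\<bar> \<le> Mt" and b'_bounded: "AE t in lebesgue. \<bar>b' t\<bar> \<le> C"
    and b': "AE t in lebesgue. \<forall>z. \<bar>z\<bar> \<le> \<eta> \<longrightarrow> b' t \<le> f t (b t + z) - \<kappa>"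
    by (rule midpoint_strict_lower_solution[OF f gat Mt(1) grt Mt(2) \<epsilon>], rule that)
  \<comment> \<open>One bound for \<open>a\<close>, \<open>r\<close> and the midpoint shifted by
    either limit.\<close>
  define M where "M = max Ma (max Mr (Mt + max \<bar>\<gamma>_plus\<bar> \<bar>\<gamma>_minus\<bar>))"
  have aM: "\<bar>a t\<bar> \<le> M" and rM: "\<bar>r t\<bar> \<le> M" for t
    using Ma[of t] Mr[of t] by (auto simp: M_def)
  have cM: "\<bar>b t + \<gamma>\<bar> \<le> M" if "\<gamma> \<in> {\<gamma>_plus, \<gamma>_minus}" for t \<gamma>
  proof -
    have "\<bar>b t + \<gamma>\<bar> \<le> Mt + max \<bar>\<gamma>_plus\<bar> \<bar>\<gamma>_minus\<bar>"
      using b[of t] that by auto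
    then show ?thesis unfolding M_def by linarith
  qed
  have acc: "ac_derivative UNIV (\<lambda>t. b t + \<gamma>) b'" for \<gamma>
    using ac_derivative_add[OF acb ac_derivative_const[of UNIV \<gamma>]] by simp
  \<comment> \<open>The perturbed field at \<open>b t + \<gamma>\<close> is the unperturbed one at
    \<open>b t + z\<close> with \<open>z = \<gamma> - \<sigma> t\<close>, a small shift once
    \<open>\<sigma>\<close> is near its limit.\<close>
  have lower: "AE t in lebesgue. \<bar>\<sigma> t - \<gamma>\<bar> < \<eta> \<longrightarrow> b' t \<le> ?g t (b t + \<gamma>) - \<kappa>" for \<gamma>
    using b'
  proof eventually_elim
    case (elim t)
    show ?case
    proof
      assume "\<bar>\<sigma> t - \<gamma>\<bar> < \<eta>"
      then have "b' t \<le> f t (b t + (\<gamma> - \<sigma> t)) - \<kappa>" using elim by simp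
      then show "b' t \<le> ?g t (b t + \<gamma>) - \<kappa>" by (simp add: g_eq algebra_simps)
    qed
  qed
  have bot: "\<exists>\<epsilon>>0. \<exists>S. \<forall>t\<le>S. a t - r t \<ge> \<epsilon>"
  proof -
    have "(\<sigma> \<longlongrightarrow> \<gamma>_minus) at_bot" unfolding \<sigma>_def by (rule step_fun_tendsto(2)[OF h lim(2)])
    from tendstoD[OF this \<eta>] obtain S where S: "\<forall>t\<le>S. \<bar>\<sigma> t - \<gamma>_minus\<bar> < \<eta>"
      unfolding eventually_at_bot_linorder dist_real_def by blast
    have "AE t in lebesgue. t \<le> S \<longrightarrow> b' t \<le> ?g t (b t + \<gamma>_minus) - \<kappa>"
      using lower[of \<gamma>_minus] by eventually_elim (use S in blast)
    from gap_at_minus_infinity[OF cara conc coer ga aM gr rM ra _ ac_derivative_subset[OF acc subset_UNIV] cM this \<kappa>]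
    show ?thesis using ext by blast
  qed
  have top: "\<exists>\<epsilon>>0. \<exists>S. \<forall>t\<ge>S. a t - r t \<ge> \<epsilon>"
  proof -
    have "(\<sigma> \<longlongrightarrow> \<gamma>_plus) at_top" unfolding \<sigma>_def by (rule step_fun_tendsto(1)[OF h lim(1)])
    from tendstoD[OF this \<eta>] obtain S where S: "\<forall>t\<ge>S. \<bar>\<sigma> t - \<gamma>_plus\<bar> < \<eta>"
      unfolding eventually_at_top_linorder dist_real_def by blast
    have "AE t in lebesgue. S \<le> t \<longrightarrow> b' t \<le> ?g t (b t + \<gamma>_plus) - \<kappa>"
      using lower[of \<gamma>_plus] by eventually_elim (use S in blast)
    from gap_at_plus_infinity[OF cara conc coer ga aM gr rM ra _ ac_derivative_subset[OF acc subset_UNIV] cM b'_bounded this \<kappa>]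
    show ?thesis using ext by blast
  qed
  obtain e where e: "e > 0" "\<And>t. a t - r t \<ge> e"
    by (rule uniform_gap[OF ga gr ra bot top], rule that)
  show ?thesis
  proof (rule attractor_repeller_pairI[OF g _ aM _ rM e])
    show "global_solution ?g a" "global_solution ?g r" by (rule ga, rule gr)
    show "r t \<le> x t \<and> x t \<le> a t" if "global_solution ?g x" "bounded (range x)" for x t
      by (rule ext[OF that])
  qed
qed

theorem theorem5p4:
  fixes f :: "real \<Rightarrow> real \<Rightarrow> real"
    and \<Gamma> a_tilde r_tilde a_h r_h :: "real \<Rightarrow> real"
    and D_a D_r :: "real set"
    and \<gamma>_plus \<gamma>_minus h :: real
    and j0 :: int and n :: nat and \<nu> :: "int \<Rightarrow> real"
  assumes "cond_f1_f7 f"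
    and "attractor_repeller_pair f a_tilde r_tilde"
    and "bounded (range \<Gamma>)" and "continuous_on UNIV \<Gamma>"
    and "(\<Gamma> \<longlongrightarrow> \<gamma>_plus) at_top" and "(\<Gamma> \<longlongrightarrow> \<gamma>_minus) at_bot"
    and "h > 0"
    and "upper_special_solution (perturbed f h \<Gamma>) D_a a_h"
    and "lower_special_solution (perturbed f h \<Gamma>) D_r r_h"
    and "\<And>j. j \<in> {j0..j0 + int n} \<Longrightarrow> \<nu> j \<in> {0..1}"
    and "of_int j0 * h \<in> D_a"
    and "a_h (of_int j0 * h) - \<Gamma> (of_int j0 * h)
           \<ge> conv_comb a_tilde r_tilde (\<nu> j0) (of_int j0 * h)"
    and "of_int (j0 + int n) * h \<in> D_r"
    and "r_h (of_int (j0 + int n) * h) - \<Gamma> (of_int (j0 + int n) * h)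
           < conv_comb a_tilde r_tilde (\<nu> (j0 + int n)) (of_int (j0 + int n) * h)"
    and "\<And>j. j \<in> {j0..j0 + int n - 1} \<Longrightarrow>
           sol_value f (of_int (j + 1) * h) (of_int j * h)
               (conv_comb a_tilde r_tilde (\<nu> j) (of_int j * h))
             - conv_comb a_tilde r_tilde (\<nu> (j + 1)) (of_int (j + 1) * h)
           \<ge> \<Gamma> (of_int (j + 1) * h) - \<Gamma> (of_int j * h)"
  shows "\<exists>a r. attractor_repeller_pair (perturbed f h \<Gamma>) a r"
proof -
  note pair = assms(2) and h = assms(7) and a = assms(8) and r = assms(9) and nu = assms(10)
  have f: "admissible f" by (rule cond_f1_f7_admissible[OF assms(1)])
  have cara: "caratheodory f" and lip: "locally_lipschitz f"
    using f by (simp_all add: admissible_def caratheodory_def)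
  let ?b = "\<lambda>j. conv_comb a_tilde r_tilde (\<nu> j) (of_int j * h)"
  have tilde: "bounded_solution f a_tilde" "bounded_solution f r_tilde" and le: "r_tilde t \<le> a_tilde t" for t
    using pair unfolding attractor_repeller_pair_def by blast+
  have gat: "global_solution f a_tilde" and grt: "global_solution f r_tilde"
    using tilde by (simp_all add: bounded_solution_def solution_iff_ac_derivative)
  obtain M1 where M1: "\<And>t. \<bar>a_tilde t\<bar> \<le> M1" using tilde(1) by (auto simp: bounded_solution_def bounded_iff)
  obtain M2 where M2: "\<And>t. \<bar>r_tilde t\<bar> \<le> M2" using tilde(2) by (auto simp: bounded_solution_def bounded_iff)
  define M where "M = max M1 M2"
  have M: "\<bar>a_tilde t\<bar> \<le> M" "\<bar>r_tilde t\<bar> \<le> M" for t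
    using M1[of t] M2[of t] by (auto simp: M_def)
  have conv: "r_tilde t \<le> conv_comb a_tilde r_tilde \<mu> t \<and> conv_comb a_tilde r_tilde \<mu> t \<le> a_tilde t"
    if "\<mu> \<in> {0..1}" for \<mu> t
  proof -
    have "conv_comb a_tilde r_tilde \<mu> t = r_tilde t + \<mu> * (a_tilde t - r_tilde t)"
      "conv_comb a_tilde r_tilde \<mu> t = a_tilde t - (1 - \<mu>) * (a_tilde t - r_tilde t)"
      by (simp_all add: conv_comb_def algebra_simps)
    moreover have "0 \<le> \<mu> * (a_tilde t - r_tilde t)" "0 \<le> (1 - \<mu>) * (a_tilde t - r_tilde t)"
      using that le[of t] by simp_all
    ultimately show ?thesis by linarith
  qed
  have step: "of_int (j0 + int i) * h \<in> D_a \<and>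
      ?b (j0 + int i) \<le> a_h (of_int (j0 + int i) * h) - \<Gamma> (of_int (j0 + int i) * h)" if "i \<le> n" for i
    using that
  proof (induction i)
    case 0
    then show ?case using assms(11,12) by simp
  next
    case (Suc i)
    define j where "j = j0 + int i"
    have j: "j \<in> {j0..j0 + int n}" "j \<in> {j0..j0 + int n - 1}" using Suc.prems by (auto simp: j_def)
    have IH: "of_int j * h \<in> D_a" "?b j \<le> a_h (of_int j * h) - \<Gamma> (of_int j * h)"
      using Suc by (simp_all add: j_def)
    have bj: "r_tilde (of_int j * h) \<le> ?b j" "?b j \<le> a_tilde (of_int j * h)"
      using conv[OF nu[OF j(1)]] by simp_all
    \<comment> \<open>The convex combination lies between the members of the pair, so its solution
      is global and bounded. This identifies \<open>sol_value\<close> and supplies the barrier for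
      the step.\<close>
    obtain X where X: "X (of_int j * h) = ?b j" "global_solution f X"
      "\<And>t. r_tilde t \<le> X t" "\<And>t. X t \<le> a_tilde t"
      by (rule solution_between[OF cara grt gat M(2,1) bj], rule that)
    have XM: "\<bar>X t\<bar> \<le> M" for t using X(3)[of t] X(4)[of t] M[of t] by linarith
    have val: "sol_value f (of_int (j + 1) * h) (of_int j * h) (?b j) = X (of_int (j + 1) * h)"
      using sol_value_global_solution[OF lip X(2), of _ "of_int j * h"] unfolding X(1) .
    have Xle: "X (of_int j * h) \<le> a_h (of_int j * h) - \<Gamma> (of_int j * h)" using IH(2) X(1) by simp
    note next_step = upper_special_solution_step[OF lip h a X(2) XM IH(1) Xle]
    \<comment> \<open>The step lemma still subtracts the old value of \<open>\<Gamma>\<close>; the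
      surplus assumed of \<open>sol_value\<close> pays for the jump to the new one.\<close>
    have "?b (j + 1) \<le> a_h (of_int (j + 1) * h) - \<Gamma> (of_int (j + 1) * h)"
      using next_step(2) assms(15)[OF j(2)] unfolding val by linarith
    moreover have eq: "j0 + int (Suc i) = j + 1" by (simp add: j_def)
    ultimately show ?case unfolding eq using next_step(1) by blast
  qed
  \<comment> \<open>At the last node \<open>a_h\<close> and \<open>r_h\<close> are compared with the
    same convex combination; the strict inequality for \<open>r_h\<close> makes their order
    strict.\<close>
  have "of_int (j0 + int n) * h \<in> D_a"
    and "r_h (of_int (j0 + int n) * h) < a_h (of_int (j0 + int n) * h)"
    using step[of n] assms(14) by auto
  then have "attractor_repeller_pair (perturbed f h \<Gamma>) a_h r_h"
    using ordered_special_solutions_pair[OF f cond_f1_f7_partial_lipschitz[OF assms(1)] assms(2-9)] assms(13)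
    by blast
  then show ?thesis by blast
qed

end
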